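(* Let $\alpha>0$. For $n\ge 1$ observe $X^{(n)}$ from the Gaussian white noise model $dX^{(n)}(t)=f(t)\,dt+n^{-1/2}\,dW(t)$, $t\in[0,1]$, with $W$ standard Brownian motion. Suppose the true $f_0$ belongs to the Besov space $B^\alpha_{\infty,\infty}[0,1]$, i.e. $\sup_{l\ge0,0\le k\le2^l-1}2^{l(1/2+\alpha)}|\langle f_0,\psi_{lk}\rangle_2|<\infty$. Let $\varphi$ be a continuous probability density on $\mathbb{R}$, strictly positive on $[-1,1]$, such that there exist $b_1,b_2,c_1,c_2,\delta>0$ with $$c_1e^{-b_1|x|^{1+\delta}}\le\varphi(x)\le c_2e^{-b_2|x|^{1+\delta}}\quad\text{for all }|x|\ge1.$$ Let the prior $\Pi$ on $f$ make the coefficients $f_{lk}=\langle f,\psi_{lk}\rangle_2$ independent, $f_{lk}$ having Lebesgue density $x\mapsto\sigma_l^{-1}\varphi(x/\sigma_l)$ on $\mathbb{R}$, where $$\sigma_l=\frac{2^{-l(1/2+\alpha)}}{(l+1)^{\mu}},\qquad \mu=\frac1{1+\delta}.$$ Then there exists $M>0$ such that for all $n\ge2$, $$E_{f_0}^n\int\|f-f_0\|_\infty\,d\Pi(f\mid X^{(n)})\le M\Big(\frac{\log n}{n}\Big)^{\alpha/(2\alpha+1)}.$$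
   Context: $\{\psi_{lk}: l\ge0,\ 0\le k\le 2^l-1\}$ is the boundary-corrected wavelet basis of $L^2[0,1]$ of Cohen–Daubechies–Vial (relabelled so that levels start at $l=0$), chosen sufficiently regular: orthonormal basis of $L^2[0,1]$; supports of diameter $\lesssim2^{-l}$; $\|\psi_{lk}\|_\infty\lesssim2^{l/2}$; $\|\sum_k|\psi_{lk}|\|_\infty\lesssim2^{l/2}$; $\psi_{lk}$ Hölder of order $S\ge\alpha$; the basis characterises $B^s_{\infty,\infty}[0,1]$, $s\le\alpha$, via the norm $\sup_{l,k}2^{l(1/2+s)}|\langle g,\psi_{lk}\rangle_2|$. Projecting onto the basis, the model is equivalent to observing $x_{lk}=f_{lk}+n^{-1/2}\varepsilon_{lk}$ with i.i.d. $N(0,1)$ errors. $\Pi(\cdot\mid X^{(n)})$ is the posterior, $E^n_{f_0}$ expectation when $f=f_0$. *)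

theory Defs
  imports "HOL-Probability.Probability"
begin

definition wav_index :: "(nat \<times> nat) set" where
  "wav_index = {(l, k). k < 2 ^ l}"

definition ip01 :: "(real \<Rightarrow> real) \<Rightarrow> (real \<Rightarrow> real) \<Rightarrow> real" where
  "ip01 g h = (LINT t:{0..1}|lborel. g t * h t)"

text \<open>The standing properties of the (boundary-corrected, CDV) wavelet basis psi l k,
  restricted to what is expressible: orthonormal basis of L2[0,1] (orthonormality plus
  Parseval identity for every square-integrable g), support diameter \<lesssim> 2^-l,
  sup-norm \<lesssim> 2^(l/2), sum over k of |psi l k| \<lesssim> 2^(l/2), and Hoelder regularity
  (of order min alpha 1, which follows from Hoelder order S \<ge> alpha on [0,1]).\<close>
definition wavelet_basis :: "(nat \<Rightarrow> nat \<Rightarrow> real \<Rightarrow> real) \<Rightarrow> real \<Rightarrow> bool" where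
  "wavelet_basis \<psi> \<alpha> \<longleftrightarrow>
     (\<forall>l k. k < 2 ^ l \<longrightarrow> \<psi> l k \<in> borel_measurable lborel) \<and>
     (\<forall>l k l' k'. k < 2 ^ l \<longrightarrow> k' < 2 ^ l' \<longrightarrow>
        ip01 (\<psi> l k) (\<psi> l' k') = (if (l, k) = (l', k') then 1 else 0)) \<and>
     (\<forall>g. g \<in> borel_measurable lborel \<longrightarrow> set_integrable lborel {0..1} (\<lambda>t. (g t)\<^sup>2) \<longrightarrow>
        ((\<lambda>(l, k). (ip01 g (\<psi> l k))\<^sup>2) has_sum ip01 g g) wav_index) \<and>
     (\<exists>C>0. \<forall>l k. k < 2 ^ l \<longrightarrow>
        (\<exists>a. \<forall>t\<in>{0..1}. \<psi> l k t \<noteq> 0 \<longrightarrow> \<bar>t - a\<bar> \<le> C * 2 powr (- real l)) \<and>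
        (\<forall>t\<in>{0..1}. \<bar>\<psi> l k t\<bar> \<le> C * 2 powr (real l / 2))) \<and>
     (\<exists>C>0. \<forall>l. \<forall>t\<in>{0..1}. (\<Sum>k<2 ^ l. \<bar>\<psi> l k t\<bar>) \<le> C * 2 powr (real l / 2)) \<and>
     (\<forall>l k. k < 2 ^ l \<longrightarrow> (\<exists>H. \<forall>s\<in>{0..1}. \<forall>t\<in>{0..1}.
        \<bar>\<psi> l k s - \<psi> l k t\<bar> \<le> H * \<bar>s - t\<bar> powr min \<alpha> 1))"

definition level_term :: "(nat \<Rightarrow> nat \<Rightarrow> real \<Rightarrow> real) \<Rightarrow> (nat \<times> nat \<Rightarrow> real) \<Rightarrow> real \<Rightarrow> nat \<Rightarrow> real" where
  "level_term \<psi> \<theta> t l = (\<Sum>k<2 ^ l. \<theta> (l, k) * \<psi> l k t)"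

definition sup_dist :: "(nat \<Rightarrow> nat \<Rightarrow> real \<Rightarrow> real) \<Rightarrow> (real \<Rightarrow> real) \<Rightarrow> (nat \<times> nat \<Rightarrow> real) \<Rightarrow> ennreal" where
  "sup_dist \<psi> f0 \<theta> =
     (if AE t in restrict_space lborel {0..1}. summable (level_term \<psi> \<theta> t)
      then esssup (restrict_space lborel {0..1})
             (\<lambda>t. ennreal \<bar>suminf (level_term \<psi> \<theta> t) - f0 t\<bar>)
      else \<infinity>)"

definition coef_space :: "(nat \<times> nat \<Rightarrow> real) measure" where
  "coef_space = PiM wav_index (\<lambda>_. borel)"

definition wav_prior :: "(real \<Rightarrow> real) \<Rightarrow> (nat \<Rightarrow> real) \<Rightarrow> (nat \<times> nat \<Rightarrow> real) measure" where
  "wav_prior \<phi> \<sigma> = PiM wav_index (\<lambda>(l, k). density lborel (\<lambda>x. ennreal (\<phi> (x / \<sigma> l) / \<sigma> l)))"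

definition obs_law :: "nat \<Rightarrow> (nat \<times> nat \<Rightarrow> real) \<Rightarrow> (nat \<times> nat \<Rightarrow> real) measure" where
  "obs_law n \<theta> = PiM wav_index (\<lambda>i. density lborel (normal_density (\<theta> i) (1 / sqrt (real n))))"

text \<open>K is a version of the posterior distribution (a Markov kernel from observations to
  parameters) of the Bayesian model theta ~ prior, X | theta ~ obs_law n theta:
  P(theta \<in> A, X \<in> B) = E[ 1_B(X) K(X)(A) ] for all measurable A, B.\<close>
definition is_posterior :: "(nat \<times> nat \<Rightarrow> real) measure \<Rightarrow> ((nat \<times> nat \<Rightarrow> real) \<Rightarrow> (nat \<times> nat \<Rightarrow> real) measure)
     \<Rightarrow> ((nat \<times> nat \<Rightarrow> real) \<Rightarrow> (nat \<times> nat \<Rightarrow> real) measure) \<Rightarrow> bool" where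
  "is_posterior prior P K \<longleftrightarrow>
     K \<in> coef_space \<rightarrow>\<^sub>M prob_algebra prior \<and>
     (\<forall>A\<in>sets prior. \<forall>B\<in>sets coef_space.
        (\<integral>\<^sup>+ \<theta>. indicator A \<theta> * emeasure (P \<theta>) B \<partial>prior) =
        (\<integral>\<^sup>+ \<theta>. (\<integral>\<^sup>+ x. indicator B x * emeasure (K x) A \<partial>P \<theta>) \<partial>prior))"

end

theory Submission
  imports Defs
begin

text \<open>Under the product prior the posterior factorises over the coefficients, so everything reduces to
  one-dimensional bounds: the marginal likelihood of a coefficient at level \<open>l\<close> is at least
  \<open>exp (-C (l + 1)) / sqrt n\<close> times the likelihood of the truth, and hence posterior expectations are
  at most the inverse of this factor times prior expectations. At levels \<open>l\<close> with
  \<open>2 ^ l \<le> (n / ln n) powr (1 / (2 \<alpha> + 1))\<close> Gaussian tails beat this factor once the deviation exceeds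
  a large multiple of \<open>sqrt (ln n / n)\<close>; at higher levels the tails of \<open>\<phi>\<close> do so beyond a large
  multiple of \<open>2 powr (- l (1/2 + \<alpha>))\<close>, which is exactly where the logarithmic factor in \<open>\<sigma>\<^sub>l\<close> enters.
  Summing the maximal deviation of each level against \<open>2 powr (l/2)\<close> gives the rate. A posterior is
  only determined up to null sets of the marginal law of the data, so one also needs the law of the
  data under the truth to be absolutely continuous with respect to that marginal law.\<close>

text \<open>The maximum over the 2^l coefficients of a level is never estimated as such: it is at
  most a threshold plus the sum of all excesses over that threshold, and a sum can be integrated
  term by term. Hence only the law of a single coefficient under \<open>K\<close> has to be
  identified, and the price is that each excess must beat the target by a factor 2^(-l), which the
  exponentially small tails supply. The loss exp (-C (l + 1)) has its origin in the truth, which may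
  lie (l + 1)^\<mu> multiples of \<open>\<sigma> l\<close> away from 0; since \<mu> (1 + \<delta>) =
  1, the exponent of \<open>\<phi>\<close> at that point is linear in l. The factor 1 / sqrt n is
  the width, relative to \<open>\<sigma> l\<close>, of the window around the truth on which the
  likelihood is compared with its value at the truth. On low levels the inverse of the product is a
  power of n; on high levels even sqrt n is at most exponential in l. \<open>sup_dist\<close> enters
  only through a measurable majorant, because nonnegative integrals are monotone for arbitrary
  functions.\<close>

section \<open>Product measures\<close>

text \<open>The sets that can be approximated form a sigma-algebra: a countable union is cut off
  after finitely many members, and each of these n members receives the error e / (2 n). One and the
  same \<open>C\<close> has to serve both measures, because the cylinder inequality in
  \<open>PiM_absolutely_continuous\<close> relates the two measures of a single cylinder.\<close>

lemma finite_measure_approx_algebra: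
  assumes "algebra \<Omega> G" "finite_measure M" "finite_measure N"
    and sM: "sets M = sigma_sets \<Omega> G" and sN: "sets N = sigma_sets \<Omega> G"
    and A: "A \<in> sets M" and e: "(0::real) < e"
  shows "\<exists>C\<in>G. measure M ((A - C) \<union> (C - A)) < e \<and> measure N ((A - C) \<union> (C - A)) < e"
proof -
  interpret algebra \<Omega> G by fact
  interpret M: finite_measure M by fact
  interpret N: finite_measure N by fact
  have G_sets: "C \<in> sets M" "C \<in> sets N" if "C \<in> G" for C
    using that sM sN by auto
  have "A \<in> sigma_sets \<Omega> G" using A sM by simp
  then show ?thesis using e
  proof (induction arbitrary: e)
    case (Basic a)
    then show ?case by (intro bexI[of _ a]) auto
  next
    case Empty
    then show ?case by (intro bexI[of _ "{}"]) auto
  next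
    case (Compl a)
    from Compl.IH[OF Compl.prems] obtain C where C: "C \<in> G"
      "measure M ((a - C) \<union> (C - a)) < e" "measure N ((a - C) \<union> (C - a)) < e" by auto
    have "((\<Omega> - a) - (\<Omega> - C)) \<union> ((\<Omega> - C) - (\<Omega> - a)) = (a - C) \<union> (C - a)"
      using sets_into_space[OF C(1)] sigma_sets_into_sp[OF space_closed Compl.hyps] by auto
    then show ?case using C by (intro bexI[of _ "\<Omega> - C"]) auto
  next
    case (Union a)
    have a_sets: "a i \<in> sets M" "a i \<in> sets N" for i using Union.hyps sM sN by auto
    have tail: "\<exists>n. measure Q ((\<Union>i. a i) - (\<Union>i<n. a i)) < e/2"
      if "finite_measure Q" "\<And>i. a i \<in> sets Q" for Q :: "'a measure"
    proof -
      interpret Q: finite_measure Q by fact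
      have "(\<lambda>n. measure Q ((\<Union>i. a i) - (\<Union>i<n. a i))) \<longlonglongrightarrow>
          measure Q (\<Inter>n. (\<Union>i. a i) - (\<Union>i<n. a i))"
        using that(2) by (intro Q.finite_Lim_measure_decseq) (auto simp: decseq_def)
      also have "(\<Inter>n. (\<Union>i. a i) - (\<Union>i<n. a i)) = {}" by auto
      finally have "eventually (\<lambda>n. measure Q ((\<Union>i. a i) - (\<Union>i<n. a i)) < e/2) sequentially"
        using Union.prems by (intro order_tendstoD) auto
      then show ?thesis by (auto simp: eventually_sequentially)
    qed
    from tail[OF \<open>finite_measure M\<close> a_sets(1)] obtain n1
      where n1: "measure M ((\<Union>i. a i) - (\<Union>i<n1. a i)) < e/2" ..
    from tail[OF \<open>finite_measure N\<close> a_sets(2)] obtain n2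
      where n2: "measure N ((\<Union>i. a i) - (\<Union>i<n2. a i)) < e/2" ..
    \<comment> \<open>A common cut-off for both measures; \<open>Suc\<close> keeps the divisor in e
      / (2 n) nonzero.\<close>
    define n where "n = Suc (max n1 n2)"
    have n: "measure M ((\<Union>i. a i) - (\<Union>i<n. a i)) < e/2"
    proof (rule le_less_trans[OF M.finite_measure_mono n1])
      show "(\<Union>i. a i) - (\<Union>i<n. a i) \<subseteq> (\<Union>i. a i) - (\<Union>i<n1. a i)"
        by (intro Diff_mono UN_mono) (auto simp: n_def)
      show "(\<Union>i. a i) - (\<Union>i<n1. a i) \<in> sets M"
        using a_sets by (intro sets.Diff sets.countable_UN sets.finite_UN) auto
    qed
    have n': "measure N ((\<Union>i. a i) - (\<Union>i<n. a i)) < e/2"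
    proof (rule le_less_trans[OF N.finite_measure_mono n2])
      show "(\<Union>i. a i) - (\<Union>i<n. a i) \<subseteq> (\<Union>i. a i) - (\<Union>i<n2. a i)"
        by (intro Diff_mono UN_mono) (auto simp: n_def)
      show "(\<Union>i. a i) - (\<Union>i<n2. a i) \<in> sets N"
        using a_sets by (intro sets.Diff sets.countable_UN sets.finite_UN) auto
    qed
    have "n > 0" by (simp add: n_def)
    then have "e / (2 * n) > 0" using Union.prems by simp
    then have "\<forall>i. \<exists>C\<in>G. measure M ((a i - C) \<union> (C - a i)) < e / (2*n)
        \<and> measure N ((a i - C) \<union> (C - a i)) < e / (2*n)"
      using Union.IH by blast
    then obtain C where C: "\<And>i. C i \<in> G" "\<And>i. measure M ((a i - C i) \<union> (C i - a i)) < e / (2*n)"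
        "\<And>i. measure N ((a i - C i) \<union> (C i - a i)) < e / (2*n)"
      by metis
    let ?C = "\<Union>i<n. C i" and ?A = "\<Union>i. a i"
    have bound: "measure Q ((?A - ?C) \<union> (?C - ?A)) < e"
      if Q: "finite_measure Q" "\<And>i. a i \<in> sets Q" "\<And>i. C i \<in> sets Q"
        "measure Q ((\<Union>i. a i) - (\<Union>i<n. a i)) < e/2"
        "\<And>i. measure Q ((a i - C i) \<union> (C i - a i)) < e / (2*n)" for Q :: "'a measure"
    proof -
      interpret Q: finite_measure Q by fact
      note [measurable] = Q(2,3)
      have "measure Q ((?A - ?C) \<union> (?C - ?A)) \<le>
          measure Q ((?A - (\<Union>i<n. a i)) \<union> (\<Union>i<n. (a i - C i) \<union> (C i - a i)))"
        by (rule Q.finite_measure_mono) auto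
      also have "\<dots> \<le> measure Q (?A - (\<Union>i<n. a i)) + measure Q (\<Union>i<n. (a i - C i) \<union> (C i - a i))"
        by (rule measure_Un_le) auto
      also have "measure Q (\<Union>i<n. (a i - C i) \<union> (C i - a i))
          \<le> (\<Sum>i<n. measure Q ((a i - C i) \<union> (C i - a i)))"
        by (rule Q.finite_measure_subadditive_finite) auto
      also have "\<dots> \<le> (\<Sum>i<n. e / (2*n))"
        using Q(5) by (intro sum_mono less_imp_le)
      also have "\<dots> = e / 2" using \<open>n > 0\<close> by simp
      finally show ?thesis using Q(4) by simp
    qed
    show ?case
    proof (intro bexI[of _ ?C] conjI)
      show "?C \<in> G" using C(1) by auto
      show "measure M ((?A - ?C) \<union> (?C - ?A)) < e"
        by (rule bound[OF \<open>finite_measure M\<close> a_sets(1) G_sets(1)[OF C(1)] n C(2)])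
      show "measure N ((?A - ?C) \<union> (?C - ?A)) < e"
        by (rule bound[OF \<open>finite_measure N\<close> a_sets(2) G_sets(2)[OF C(1)] n' C(3)])
    qed
  qed
qed

lemma borel_measurable_prod_component:
  fixes f :: "'i \<Rightarrow> 'a \<Rightarrow> ennreal"
  assumes "\<And>j. j \<in> J \<Longrightarrow> f j \<in> borel_measurable (M j)" "J \<subseteq> I"
  shows "(\<lambda>x. \<Prod>j\<in>J. f j (x j)) \<in> borel_measurable (PiM I M)"
proof (rule borel_measurable_prod_ennreal)
  fix j assume "j \<in> J"
  then have "(\<lambda>x. x j) \<in> PiM I M \<rightarrow>\<^sub>M M j" "f j \<in> borel_measurable (M j)"
    using assms by auto
  then show "(\<lambda>x. f j (x j)) \<in> borel_measurable (PiM I M)"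
    by (rule measurable_compose)
qed

lemma (in product_prob_space) nn_integral_prod_PiM:
  assumes J: "finite J" "J \<subseteq> I" and f: "\<And>j. j \<in> J \<Longrightarrow> f j \<in> borel_measurable (M j)"
  shows "(\<integral>\<^sup>+x. (\<Prod>j\<in>J. f j (x j)) \<partial>PiM I M) = (\<Prod>j\<in>J. \<integral>\<^sup>+y. f j y \<partial>M j)"
proof -
  have [measurable]: "(\<lambda>x. \<Prod>j\<in>J. f j (x j)) \<in> borel_measurable (PiM J M)"
    by (intro borel_measurable_prod_component f) auto
  have "(\<Prod>j\<in>J. \<integral>\<^sup>+y. f j y \<partial>M j) = (\<integral>\<^sup>+x. (\<Prod>j\<in>J. f j (x j)) \<partial>PiM J M)"
    using J f by (simp add: product_nn_integral_prod)
  also have "\<dots> = (\<integral>\<^sup>+x. (\<Prod>j\<in>J. f j (x j)) \<partial>distr (PiM I M) (PiM J M) (\<lambda>x. restrict x J))"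
    using J by (simp add: distr_PiM_restrict_finite)
  also have "\<dots> = (\<integral>\<^sup>+x. (\<Prod>j\<in>J. f j (restrict x J j)) \<partial>PiM I M)"
    using J by (intro nn_integral_distr measurable_restrict_subset) auto
  finally show ?thesis by simp
qed

lemma (in product_prob_space) nn_integral_component_PiM:
  assumes "i \<in> I" "f \<in> borel_measurable (M i)"
  shows "(\<integral>\<^sup>+x. f (x i) \<partial>PiM I M) = (\<integral>\<^sup>+y. f y \<partial>M i)"
  using nn_integral_prod_PiM[of "{i}" "\<lambda>_. f"] assms by simp

lemma PiM_density_finite:
  assumes M: "product_prob_space M" and N: "product_prob_space N"
    and r[measurable]: "\<And>i. r i \<in> borel_measurable (M i)" and Nr: "\<And>i. N i = density (M i) (r i)"
    and J: "finite J"
  shows "PiM J N = density (PiM J M) (\<lambda>x. \<Prod>j\<in>J. r j (x j))"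
proof -
  interpret M: product_prob_space M by fact
  interpret N: product_prob_space N by fact
  have sN: "sets (N i) = sets (M i)" for i by (simp add: Nr)
  have m[measurable]: "(\<lambda>x. \<Prod>j\<in>J. r j (x j)) \<in> borel_measurable (PiM J M)"
    by (intro borel_measurable_prod_component r) auto
  show ?thesis
  proof (rule N.PiM_eqI[symmetric, OF J])
    show "sets (density (PiM J M) (\<lambda>x. \<Prod>j\<in>J. r j (x j))) = sets (PiM J N)"
      by (simp add: sN cong: sets_PiM_cong)
    fix A assume A: "\<And>i. i \<in> J \<Longrightarrow> A i \<in> sets (N i)"
    then have A': "i \<in> J \<Longrightarrow> A i \<in> sets (M i)" for i by (simp add: sN)
    have "emeasure (density (PiM J M) (\<lambda>x. \<Prod>j\<in>J. r j (x j))) (Pi\<^sub>E J A)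
        = (\<integral>\<^sup>+x. (\<Prod>j\<in>J. r j (x j)) * indicator (Pi\<^sub>E J A) x \<partial>PiM J M)"
      using A' J by (intro emeasure_density sets_PiM_I_finite) auto
    also have "\<dots> = (\<integral>\<^sup>+x. (\<Prod>j\<in>J. r j (x j) * indicator (A j) (x j)) \<partial>PiM J M)"
    proof (intro nn_integral_cong)
      fix x assume "x \<in> space (PiM J M)"
      then have "indicator (Pi\<^sub>E J A) x = (\<Prod>j\<in>J. indicator (A j) (x j) :: ennreal)"
        using J by (auto simp: space_PiM PiE_iff indicator_def prod_zero_iff)
      then show "(\<Prod>j\<in>J. r j (x j)) * indicator (Pi\<^sub>E J A) x = (\<Prod>j\<in>J. r j (x j) * indicator (A j) (x j))"
        by (simp add: prod.distrib)
    qed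
    also have "\<dots> = (\<Prod>j\<in>J. \<integral>\<^sup>+y. r j y * indicator (A j) y \<partial>M j)"
      using J A' by (intro M.product_nn_integral_prod) auto
    also have "\<dots> = (\<Prod>j\<in>J. emeasure (N j) (A j))"
      using A' by (intro prod.cong) (auto simp: Nr emeasure_density)
    finally show "emeasure (density (PiM J M) (\<lambda>x. \<Prod>j\<in>J. r j (x j))) (Pi\<^sub>E J A)
        = (\<Prod>j\<in>J. emeasure (N j) (A j))" .
  qed
qed

text \<open>A linearised Cauchy-Schwarz inequality: the quadratic term dominates for a >= 1 /
  \<eta>, the constant below. It trades a first moment for a second one without square roots, and
  serves both for likelihood ratios and for posterior excesses.\<close>

lemma ennreal_le_square_plus:
  fixes a :: ennreal assumes "0 < (\<eta>::real)"
  shows "a \<le> ennreal \<eta> * a^2 + ennreal (1/\<eta>)"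
proof (cases a)
  case top
  then show ?thesis using assms by (simp add: ennreal_mult_top power2_eq_square ennreal_top_mult)
next
  case (real r)
  have "r \<le> \<eta> * r^2 + 1/\<eta>"
  proof (cases "\<eta> * r \<le> 1")
    case True
    then have "r \<le> 1/\<eta>" using assms by (simp add: field_simps)
    moreover have "0 \<le> \<eta> * r^2" using assms by simp
    ultimately show ?thesis by linarith
  next
    case False
    then have "r * 1 \<le> r * (\<eta> * r)" using real by (intro mult_left_mono) auto
    moreover have "0 \<le> 1/\<eta>" using assms by simp
    moreover have "r * (\<eta> * r) = \<eta> * r^2" by (simp add: power2_eq_square)
    ultimately show ?thesis by linarith
  qed
  then show ?thesis using real assms
    by (simp add: ennreal_power ennreal_mult[symmetric] ennreal_plus[symmetric] del: ennreal_plus)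
qed

text \<open>The easy half of Kakutani's dichotomy: cylinders \<open>C\<close> satisfy
  \<open>N(C) \<le> \<eta> c + M(C) / \<eta>\<close> for every \<open>\<eta> > 0\<close>, and cylinders approximate all measurable sets.\<close>

lemma PiM_absolutely_continuous:
  assumes M: "product_prob_space M" and N: "product_prob_space N"
    and r[measurable]: "\<And>i. r i \<in> borel_measurable (M i)" and Nr: "\<And>i. N i = density (M i) (r i)"
    and c: "\<And>J. finite J \<Longrightarrow> J \<subseteq> I \<Longrightarrow> (\<Prod>j\<in>J. \<integral>\<^sup>+y. (r j y)^2 \<partial>M j) \<le> ennreal c"
  shows "absolutely_continuous (PiM I M) (PiM I N)"
proof -
  interpret M: product_prob_space M I by (rule M)
  interpret N: product_prob_space N I by (rule N)
  have sN: "sets (N i) = sets (M i)" for i by (simp add: Nr)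
  have spN: "space (N i) = space (M i)" for i by (simp add: Nr)
  have sPi: "sets (PiM J N) = sets (PiM J M)" for J
    by (simp add: sN cong: sets_PiM_cong)
  have cyl: "emeasure (PiM I N) C \<le> ennreal \<eta> * ennreal c + ennreal (1/\<eta>) * emeasure (PiM I M) C"
    if C: "C \<in> M.generator" and \<eta>: "0 < \<eta>" for C \<eta>
    using C
  proof cases
    case (1 J X)
    have m[measurable]: "(\<lambda>x. \<Prod>j\<in>J. r j (x j)) \<in> borel_measurable (PiM J M)"
      by (intro borel_measurable_prod_component r) auto
    note [measurable] = 1(4)
    have "C = prod_emb I N J X" using 1 by (simp add: prod_emb_def spN)
    then have "emeasure (PiM I N) C = emeasure (PiM J N) X"
      using 1 by (simp add: N.emeasure_PiM_emb' sPi)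
    also have "\<dots> = (\<integral>\<^sup>+x. (\<Prod>j\<in>J. r j (x j)) * indicator X x \<partial>PiM J M)"
      by (subst PiM_density_finite[OF M N r Nr 1(2)]) (simp add: emeasure_density)
    also have "\<dots> \<le> (\<integral>\<^sup>+x. ennreal \<eta> * (\<Prod>j\<in>J. (r j (x j))^2) + ennreal (1/\<eta>) * indicator X x \<partial>PiM J M)"
    proof (intro nn_integral_mono)
      fix x
      show "(\<Prod>j\<in>J. r j (x j)) * indicator X x
          \<le> ennreal \<eta> * (\<Prod>j\<in>J. (r j (x j))^2) + ennreal (1/\<eta>) * indicator X x"
        using ennreal_le_square_plus[OF \<eta>, of "\<Prod>j\<in>J. r j (x j)"]
        by (cases "x \<in> X") (auto simp: prod_power_distrib)
    qed
    also have "\<dots> = ennreal \<eta> * (\<integral>\<^sup>+x. (\<Prod>j\<in>J. (r j (x j))^2) \<partial>PiM J M) + ennreal (1/\<eta>) * emeasure (PiM J M) X"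
    proof -
      have [measurable]: "(\<lambda>x. \<Prod>j\<in>J. (r j (x j))^2) \<in> borel_measurable (PiM J M)"
        unfolding prod_power_distrib by measurable
      show ?thesis by (simp add: nn_integral_add nn_integral_cmult)
    qed
    also have "(\<integral>\<^sup>+x. (\<Prod>j\<in>J. (r j (x j))^2) \<partial>PiM J M) = (\<Prod>j\<in>J. \<integral>\<^sup>+y. (r j y)^2 \<partial>M j)"
      using 1 by (intro M.product_nn_integral_prod) auto
    also have "emeasure (PiM J M) X = emeasure (PiM I M) C"
      using 1 by (simp add: M.emeasure_PiM_emb')
    finally show ?thesis
      using c[OF 1(2,3)] by (elim order_trans) (intro add_mono mult_left_mono, auto)
  qed
  show ?thesis
    unfolding absolutely_continuous_def
  proof
    fix A assume "A \<in> null_sets (PiM I M)"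
    then have A: "A \<in> sets (PiM I M)" "emeasure (PiM I M) A = 0" by auto
    have "emeasure (PiM I N) A \<le> 0 + ennreal e" if e: "0 < e" for e
    proof -
      \<comment> \<open>\<open>\<eta>\<close> makes the second-moment term of \<open>cyl\<close> at
        most e / 3, with |c| + 1 guarding against c <= 0; \<open>d\<close> is then so small that
        M(C) < d still contributes at most e / 3 after division by \<open>\<eta>\<close>, and the
        approximation error is a third e / 3.\<close>
      define \<eta> where "\<eta> = e / (3 * (\<bar>c\<bar> + 1))"
      have \<eta>: "0 < \<eta>" using e by (simp add: \<eta>_def)
      define d where "d = min (e/3) (e/3 * \<eta>)"
      have d: "0 < d" using e \<eta> by (simp add: d_def)
      obtain C where C: "C \<in> M.generator"
        "measure (PiM I M) ((A - C) \<union> (C - A)) < d" "measure (PiM I N) ((A - C) \<union> (C - A)) < d"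
        using finite_measure_approx_algebra[OF M.algebra_generator, of "PiM I M" "PiM I N" A d]
          d A M.sets_PiM_generator sPi by (auto intro: M.P.finite_measure_axioms N.P.finite_measure_axioms)
      have CM: "C \<in> sets (PiM I M)" using C(1) M.sets_PiM_generator by auto
      have "measure (PiM I M) C \<le> measure (PiM I M) (((A - C) \<union> (C - A)) \<union> A)"
        using A CM by (intro M.P.finite_measure_mono) auto
      also have "\<dots> \<le> measure (PiM I M) ((A - C) \<union> (C - A)) + measure (PiM I M) A"
        using A CM by (intro measure_Un_le) auto
      also have "measure (PiM I M) A = 0" using A by (simp add: measure_def)
      finally have 1: "measure (PiM I M) C < d" using C by simp
      have 2: "measure (PiM I N) A \<le> measure (PiM I N) C + d"
      proof -
        have "measure (PiM I N) A \<le> measure (PiM I N) (C \<union> ((A - C) \<union> (C - A)))"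
          using A CM by (intro N.P.finite_measure_mono) (auto simp: sPi)
        also have "\<dots> \<le> measure (PiM I N) C + measure (PiM I N) ((A - C) \<union> (C - A))"
          using A CM by (intro measure_Un_le) (auto simp: sPi)
        finally show ?thesis using C by simp
      qed
      have "ennreal (measure (PiM I N) C) \<le> ennreal (\<eta> * \<bar>c\<bar> + 1/\<eta> * measure (PiM I M) C)"
      proof -
        have "ennreal (measure (PiM I N) C) \<le> ennreal \<eta> * ennreal c + ennreal (1/\<eta>) * emeasure (PiM I M) C"
          using cyl[OF C(1) \<eta>] by (simp add: N.P.emeasure_eq_measure)
        also have "\<dots> \<le> ennreal \<eta> * ennreal \<bar>c\<bar> + ennreal (1/\<eta>) * ennreal (measure (PiM I M) C)"
          by (intro add_mono mult_left_mono) (auto simp: M.P.emeasure_eq_measure intro: ennreal_leI)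
        also have "\<dots> = ennreal (\<eta> * \<bar>c\<bar> + 1/\<eta> * measure (PiM I M) C)"
          using \<eta> by (subst ennreal_plus) (auto simp: ennreal_mult[symmetric])
        finally show ?thesis .
      qed
      then have "measure (PiM I N) C \<le> \<eta> * \<bar>c\<bar> + 1/\<eta> * measure (PiM I M) C"
        using \<eta> by (subst (asm) ennreal_le_iff) auto
      also have "\<dots> \<le> e/3 + 1/\<eta> * (e/3 * \<eta>)"
      proof (intro add_mono mult_left_mono)
        have "\<eta> * \<bar>c\<bar> \<le> \<eta> * (\<bar>c\<bar> + 1)" using \<eta> by (intro mult_left_mono) auto
        also have "\<dots> = e/3"
        proof -
          have "\<bar>c\<bar> + 1 \<noteq> 0" by linarith
          then show ?thesis by (simp add: \<eta>_def field_simps)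
        qed
        finally show "\<eta> * \<bar>c\<bar> \<le> e/3" .
        show "measure (PiM I M) C \<le> e/3 * \<eta>" using 1 by (simp add: d_def)
      qed (use \<eta> in auto)
      also have "\<dots> = 2 * e / 3" using \<eta> by simp
      finally have "measure (PiM I N) A \<le> e" using 2 by (simp add: d_def)
      then show ?thesis by (simp add: N.P.emeasure_eq_measure ennreal_leI)
    qed
    note eps = this
    have "emeasure (PiM I N) A \<le> 0" by (rule ennreal_le_epsilon, rule eps)
    then show "A \<in> null_sets (PiM I N)" using A by (auto simp: sPi)
  qed
qed

section \<open>The Gaussian sequence model with a product prior\<close>

lemma borel_measurable_normal_density2 [measurable (raw)]:
  fixes f g :: "'a \<Rightarrow> real"
  assumes [measurable]: "f \<in> borel_measurable M" "g \<in> borel_measurable M"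
  shows "(\<lambda>x. normal_density (f x) s (g x)) \<in> borel_measurable M"
  unfolding normal_density_def by measurable

lemma normal_density_le: "0 < s \<Longrightarrow> normal_density \<mu> s x \<le> 1 / sqrt (2 * pi * s\<^sup>2)"
  unfolding normal_density_def by (intro mult_left_le) auto

locale gaussian_sequence =
  fixes I :: "'i::countable set" and \<pi> :: "'i \<Rightarrow> real measure" and s :: real
  assumes prob_prior: "\<And>i. prob_space (\<pi> i)"
    and sets_prior [measurable_cong]: "\<And>i. sets (\<pi> i) = sets borel"
    and s_pos: "0 < s"
begin

definition obs :: "('i \<Rightarrow> real) \<Rightarrow> ('i \<Rightarrow> real) measure" where
  "obs \<theta> = PiM I (\<lambda>i. density lborel (normal_density (\<theta> i) s))"

definition marginal_density :: "'i \<Rightarrow> real \<Rightarrow> ennreal" where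
  "marginal_density i y = (\<integral>\<^sup>+\<theta>. normal_density \<theta> s y \<partial>\<pi> i)"

definition marginal :: "('i \<Rightarrow> real) measure" where
  "marginal = PiM I \<pi> \<bind> obs"

sublocale prior: product_prob_space \<pi> I
  by (intro product_prob_spaceI prob_prior)

lemma obs_product_prob_space: "product_prob_space (\<lambda>i. density lborel (normal_density (\<theta> i) s))"
  by (intro product_prob_spaceI prob_space_normal_density s_pos)

lemma prob_space_obs: "prob_space (obs \<theta>)"
  unfolding obs_def by (intro prob_space_PiM prob_space_normal_density s_pos)

lemma sets_obs [measurable_cong]: "sets (obs \<theta>) = sets (PiM I (\<lambda>_. borel))"
  unfolding obs_def by (intro sets_PiM_cong) auto

lemma space_obs: "space (obs \<theta>) = space (PiM I (\<lambda>_. borel :: real measure))"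
  by (rule sets_eq_imp_space_eq[OF sets_obs])

lemma sets_PiM_prior [measurable_cong]: "sets (PiM I \<pi>) = sets (PiM I (\<lambda>_. borel))"
  by (intro sets_PiM_cong) (auto simp: sets_prior)

lemma space_PiM_prior: "space (PiM I \<pi>) = space (PiM I (\<lambda>_. borel :: real measure))"
  by (rule sets_eq_imp_space_eq[OF sets_PiM_prior])

lemma measurable_prior_iff [simp]: "measurable (\<pi> i) N = measurable borel N"
  by (rule measurable_cong_sets[OF sets_prior refl])

lemma nn_integral_obs_prod:
  assumes "finite J" "J \<subseteq> I" and [measurable]: "\<And>j. j \<in> J \<Longrightarrow> g j \<in> borel_measurable borel"
  shows "(\<integral>\<^sup>+x. (\<Prod>j\<in>J. g j (x j)) \<partial>obs \<theta>) = (\<Prod>j\<in>J. \<integral>\<^sup>+y. g j y * normal_density (\<theta> j) s y \<partial>lborel)"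
proof -
  interpret product_prob_space "\<lambda>i. density lborel (normal_density (\<theta> i) s)" I
    by (rule obs_product_prob_space)
  have "(\<integral>\<^sup>+x. (\<Prod>j\<in>J. g j (x j)) \<partial>obs \<theta>)
      = (\<Prod>j\<in>J. \<integral>\<^sup>+y. g j y \<partial>density lborel (normal_density (\<theta> j) s))"
    unfolding obs_def using assms by (intro nn_integral_prod_PiM) auto
  also have "\<dots> = (\<Prod>j\<in>J. \<integral>\<^sup>+y. g j y * normal_density (\<theta> j) s y \<partial>lborel)"
    by (intro prod.cong refl, subst nn_integral_density) (auto simp: mult.commute)
  finally show ?thesis .
qed

lemma nn_integral_obs_component:
  assumes "i \<in> I" "g \<in> borel_measurable borel"
  shows "(\<integral>\<^sup>+x. g (x i) \<partial>obs \<theta>) = (\<integral>\<^sup>+y. g y * normal_density (\<theta> i) s y \<partial>lborel)"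
  using nn_integral_obs_prod[of "{i}" "\<lambda>_. g"] assms by simp

lemma indicator_prod_emb:
  assumes "J \<subseteq> I" "x \<in> space (PiM I (\<lambda>_. borel :: real measure))" "finite J"
  shows "indicator (prod_emb I (\<lambda>_. borel) J (Pi\<^sub>E J A)) x = (\<Prod>j\<in>J. indicator (A j) (x j) :: ennreal)"
  using assms by (auto simp: prod_emb_def space_PiM PiE_iff indicator_def prod_zero_iff)

text \<open>Cylinders over rectangles are an intersection-stable generator, and the mass of such a
  cylinder is a finite product of measurable functions of single parameters.\<close>

lemma obs_kernel: "obs \<in> PiM I (\<lambda>_. borel) \<rightarrow>\<^sub>M prob_algebra (PiM I (\<lambda>_. borel))"
proof (rule measurable_prob_algebra_generated[OF sets_PiM Int_stable_prod_algebra prod_algebra_sets_into_space])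
  fix X assume "X \<in> prod_algebra I (\<lambda>_. borel :: real measure)"
  then obtain J A where X: "X = prod_emb I (\<lambda>_. borel) J (Pi\<^sub>E J A)"
    and J: "finite J" "J \<subseteq> I" and A[measurable]: "\<And>j. j \<in> J \<Longrightarrow> A j \<in> sets borel"
    by (auto elim!: prod_algebraE)
  have X_sets: "X \<in> sets (PiM I (\<lambda>_. borel :: real measure))"
    unfolding X using J A by (intro sets_PiM_I) auto
  have "emeasure (obs \<theta>) X = (\<Prod>j\<in>J. \<integral>\<^sup>+y. (indicator (A j) y :: ennreal) * normal_density (\<theta> j) s y \<partial>lborel)" for \<theta>
  proof -
    have "emeasure (obs \<theta>) X = (\<integral>\<^sup>+x. indicator X x \<partial>obs \<theta>)"
      using X_sets by (simp add: sets_obs)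
    also have "\<dots> = (\<integral>\<^sup>+x. (\<Prod>j\<in>J. indicator (A j) (x j)) \<partial>obs \<theta>)"
      unfolding X using J by (intro nn_integral_cong indicator_prod_emb) (auto simp: space_obs)
    also have "\<dots> = (\<Prod>j\<in>J. \<integral>\<^sup>+y. (indicator (A j) y :: ennreal) * normal_density (\<theta> j) s y \<partial>lborel)"
      using J by (intro nn_integral_obs_prod) auto
    finally show ?thesis .
  qed
  moreover have "(\<lambda>\<theta>. \<Prod>j\<in>J. \<integral>\<^sup>+y. (indicator (A j) y :: ennreal) * normal_density (\<theta> j) s y \<partial>lborel)
      \<in> borel_measurable (PiM I (\<lambda>_. borel))"
  proof (rule borel_measurable_prod_component[OF _ J(2)])
    fix j assume "j \<in> J"
    note [measurable] = A[OF this]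
    show "(\<lambda>\<theta>. \<integral>\<^sup>+y. (indicator (A j) y :: ennreal) * normal_density \<theta> s y \<partial>lborel) \<in> borel_measurable borel"
      by measurable
  qed
  ultimately show "(\<lambda>\<theta>. emeasure (obs \<theta>) X) \<in> borel_measurable (PiM I (\<lambda>_. borel))" by simp
qed (auto simp: prob_space_obs sets_obs)

lemma obs_kernel_prior [measurable]: "obs \<in> PiM I \<pi> \<rightarrow>\<^sub>M subprob_algebra (PiM I (\<lambda>_. borel))"
  using measurable_prob_algebraD[OF obs_kernel] by (simp cong: measurable_cong_sets add: sets_PiM_prior)

lemma space_PiM_prior_nonempty: "space (PiM I \<pi>) \<noteq> {}"
  by (rule prior.P.not_empty)

lemma sets_marginal [measurable_cong]: "sets marginal = sets (PiM I (\<lambda>_. borel))"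
  unfolding marginal_def by (rule sets_bind_measurable[OF obs_kernel_prior space_PiM_prior_nonempty])

lemma nn_integral_marginal:
  "f \<in> borel_measurable (PiM I (\<lambda>_. borel)) \<Longrightarrow>
    (\<integral>\<^sup>+x. f x \<partial>marginal) = (\<integral>\<^sup>+\<theta>. \<integral>\<^sup>+x. f x \<partial>obs \<theta> \<partial>PiM I \<pi>)"
  unfolding marginal_def by (rule nn_integral_bind[OF _ obs_kernel_prior])

lemma prob_space_marginal: "prob_space marginal"
proof
  have "space marginal = space (PiM I (\<lambda>_. borel :: real measure))"
    by (rule sets_eq_imp_space_eq[OF sets_marginal])
  then have "emeasure marginal (space marginal) = (\<integral>\<^sup>+\<theta>. emeasure (obs \<theta>) (space (obs \<theta>)) \<partial>PiM I \<pi>)"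
    unfolding marginal_def space_obs
    by (subst emeasure_bind[OF space_PiM_prior_nonempty obs_kernel_prior]) auto
  then show "emeasure marginal (space marginal) = 1"
    by (simp add: prob_space.emeasure_space_1[OF prob_space_obs] prior.P.emeasure_space_1)
qed

lemma marginal_density_measurable [measurable]: "marginal_density i \<in> borel_measurable borel"
proof -
  show ?thesis unfolding marginal_density_def by measurable
qed

lemma marginal_density_pos: "marginal_density i y \<noteq> 0"
proof -
  have "\<not> (AE \<theta> in \<pi> i. normal_density \<theta> s y \<le> 0)"
  proof
    assume "AE \<theta> in \<pi> i. normal_density \<theta> s y \<le> 0"
    then have "AE \<theta> in \<pi> i. False"
      by eventually_elim (use normal_density_pos[OF s_pos] in \<open>simp add: not_le[symmetric]\<close>)
    then show False by simp
  qed
  then show ?thesis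
    unfolding marginal_density_def by (subst nn_integral_0_iff_AE) (auto simp: ennreal_eq_0_iff)
qed

lemma marginal_density_finite: "marginal_density i y \<noteq> \<top>"
proof -
  have "marginal_density i y \<le> (\<integral>\<^sup>+\<theta>. ennreal (1 / sqrt (2 * pi * s\<^sup>2)) \<partial>\<pi> i)"
    unfolding marginal_density_def using s_pos by (intro nn_integral_mono ennreal_leI normal_density_le)
  then show ?thesis by (auto simp: prior.M.emeasure_space_1 top_unique)
qed

text \<open>Bayes' formula for one coefficient, with a weight \<open>w\<close> in place of an event.
  The quotient is a genuine one, as the denominator is neither 0
  (\<open>marginal_density_pos\<close>) nor infinite
  (\<open>marginal_density_finite\<close>).\<close>

definition posterior_mean :: "'i \<Rightarrow> (real \<Rightarrow> ennreal) \<Rightarrow> real \<Rightarrow> ennreal" where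
  "posterior_mean i w y = (\<integral>\<^sup>+\<theta>. w \<theta> * normal_density \<theta> s y \<partial>\<pi> i) / marginal_density i y"

lemma posterior_mean_measurable [measurable]:
  assumes [measurable]: "w \<in> borel_measurable borel"
  shows "posterior_mean i w \<in> borel_measurable borel"
proof -
  show ?thesis unfolding posterior_mean_def by measurable
qed

lemma posterior_mean_times_marginal_density:
  "posterior_mean i w y * marginal_density i y = (\<integral>\<^sup>+\<theta>. w \<theta> * normal_density \<theta> s y \<partial>\<pi> i)"
  unfolding posterior_mean_def
  using marginal_density_pos[of i y] marginal_density_finite[of i y]
  by (simp add: ennreal_divide_times ennreal_divide_self less_top)

lemma nn_integral_prior_lborel_swap:
  fixes f :: "real \<Rightarrow> real \<Rightarrow> ennreal"
  assumes [measurable]: "(\<lambda>(\<theta>, y). f \<theta> y) \<in> borel_measurable (borel \<Otimes>\<^sub>M borel)"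
  shows "(\<integral>\<^sup>+\<theta>. \<integral>\<^sup>+y. f \<theta> y \<partial>lborel \<partial>\<pi> i) = (\<integral>\<^sup>+y. \<integral>\<^sup>+\<theta>. f \<theta> y \<partial>\<pi> i \<partial>lborel)"
proof -
  interpret pair_sigma_finite "\<pi> i" lborel ..
  show ?thesis by (rule Fubini'[symmetric]) measurable
qed

text \<open>The pairs of parameter and observation are independent over the coordinates. Keeping
  \<open>f\<close> (parameter) and \<open>g\<close> (observation) apart allows reading the identity
  in both directions: forwards with an event for the parameter, backwards with \<open>f\<close> = 1
  once that event has become a function of the datum.\<close>

lemma nn_integral_joint_prod:
  assumes J: "finite J" "J \<subseteq> I"
    and [measurable]: "\<And>j. j \<in> J \<Longrightarrow> f j \<in> borel_measurable borel"
      "\<And>j. j \<in> J \<Longrightarrow> g j \<in> borel_measurable borel"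
  shows "(\<integral>\<^sup>+\<theta>. (\<Prod>j\<in>J. f j (\<theta> j)) * (\<integral>\<^sup>+x. (\<Prod>j\<in>J. g j (x j)) \<partial>obs \<theta>) \<partial>PiM I \<pi>) =
    (\<Prod>j\<in>J. \<integral>\<^sup>+\<theta>. \<integral>\<^sup>+y. f j \<theta> * g j y * normal_density \<theta> s y \<partial>lborel \<partial>\<pi> j)"
proof -
  have "(\<integral>\<^sup>+\<theta>. (\<Prod>j\<in>J. f j (\<theta> j)) * (\<integral>\<^sup>+x. (\<Prod>j\<in>J. g j (x j)) \<partial>obs \<theta>) \<partial>PiM I \<pi>)
    = (\<integral>\<^sup>+\<theta>. (\<Prod>j\<in>J. f j (\<theta> j) * (\<integral>\<^sup>+y. g j y * normal_density (\<theta> j) s y \<partial>lborel)) \<partial>PiM I \<pi>)"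
    using J by (simp add: nn_integral_obs_prod prod.distrib)
  also have "\<dots> = (\<Prod>j\<in>J. \<integral>\<^sup>+\<theta>. f j \<theta> * (\<integral>\<^sup>+y. g j y * normal_density \<theta> s y \<partial>lborel) \<partial>\<pi> j)"
    using J by (intro prior.nn_integral_prod_PiM) measurable
  also have "\<dots> = (\<Prod>j\<in>J. \<integral>\<^sup>+\<theta>. \<integral>\<^sup>+y. f j \<theta> * g j y * normal_density \<theta> s y \<partial>lborel \<partial>\<pi> j)"
    by (intro prod.cong refl nn_integral_cong, subst nn_integral_cmult[symmetric]) (auto simp: mult.assoc)
  finally show ?thesis .
qed

end

section \<open>Bayes' formula for a single coefficient under an arbitrary version of the
  posterior\<close>

locale gaussian_posterior = gaussian_sequence +
  fixes K :: "('a \<Rightarrow> real) \<Rightarrow> ('a \<Rightarrow> real) measure"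
  assumes kernel: "K \<in> PiM I (\<lambda>_. borel) \<rightarrow>\<^sub>M prob_algebra (PiM I \<pi>)"
    and posterior: "\<And>A B. A \<in> sets (PiM I \<pi>) \<Longrightarrow> B \<in> sets (PiM I (\<lambda>_. borel)) \<Longrightarrow>
      (\<integral>\<^sup>+\<theta>. indicator A \<theta> * emeasure (obs \<theta>) B \<partial>PiM I \<pi>) =
      (\<integral>\<^sup>+\<theta>. \<integral>\<^sup>+x. indicator B x * emeasure (K x) A \<partial>obs \<theta> \<partial>PiM I \<pi>)"
begin

lemma kernel_subprob [measurable]: "K \<in> PiM I (\<lambda>_. borel) \<rightarrow>\<^sub>M subprob_algebra (PiM I \<pi>)"
  by (rule measurable_prob_algebraD[OF kernel])

lemma sets_kernel_eq: "x \<in> space (PiM I (\<lambda>_. borel)) \<Longrightarrow> sets (K x) = sets (PiM I \<pi>)"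
  using measurable_space[OF kernel] by (auto simp: space_prob_algebra)

lemma prob_space_kernel: "x \<in> space (PiM I (\<lambda>_. borel)) \<Longrightarrow> prob_space (K x)"
  using measurable_space[OF kernel] by (auto simp: space_prob_algebra)

lemma component_borel_measurable:
  "i \<in> I \<Longrightarrow> (\<lambda>\<theta>. \<theta> i) \<in> borel_measurable (PiM I \<pi>)"
  using measurable_component_singleton[of i I \<pi>] measurable_cong_sets[OF refl sets_prior] by blast

text \<open>Both sides are densities, with respect to \<open>marginal\<close>, of the same finite
  measure: the joint probability of the event for the i-th coefficient and a data set. Such measures
  agree as soon as they agree on cylinders, where everything factorises and only the i-th factor
  needs an argument; uniqueness of densities then gives equality almost everywhere.\<close>

lemma emeasure_kernel_component_AE:
  assumes i: "i \<in> I" and E[measurable]: "E \<in> sets borel"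
  shows "AE x in marginal. emeasure (K x) {\<theta>\<in>space (PiM I \<pi>). \<theta> i \<in> E} = posterior_mean i (indicator E) (x i)"
proof -
  let ?A = "{\<theta>\<in>space (PiM I \<pi>). \<theta> i \<in> E}" and ?H = "posterior_mean i (indicator E)"
  let ?B = "PiM I (\<lambda>_. borel :: real measure)"
  interpret m: prob_space marginal by (rule prob_space_marginal)
  have A[measurable]: "?A \<in> sets (PiM I \<pi>)"
    using measurable_sets[OF component_borel_measurable[OF i] E] by (simp add: vimage_def Int_def conj_commute)
  have mK[measurable]: "(\<lambda>x. emeasure (K x) ?A) \<in> borel_measurable ?B"
    by (rule measurable_compose[OF kernel_subprob measurable_emeasure_subprob_algebra[OF A]])
  have mH[measurable]: "(\<lambda>x. ?H (x i)) \<in> borel_measurable ?B"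
    using i by measurable
  have dK: "emeasure (density marginal (\<lambda>x. emeasure (K x) ?A)) X
      = (\<integral>\<^sup>+\<theta>. indicator ?A \<theta> * emeasure (obs \<theta>) X \<partial>PiM I \<pi>)" if [measurable]: "X \<in> sets ?B" for X
  proof -
    have "emeasure (density marginal (\<lambda>x. emeasure (K x) ?A)) X
      = (\<integral>\<^sup>+x. indicator X x * emeasure (K x) ?A \<partial>marginal)"
      by (subst emeasure_density) (auto simp: mult.commute)
    also have "\<dots> = (\<integral>\<^sup>+\<theta>. \<integral>\<^sup>+x. indicator X x * emeasure (K x) ?A \<partial>obs \<theta> \<partial>PiM I \<pi>)"
      by (rule nn_integral_marginal) measurable
    finally show ?thesis using posterior[OF A that] by simp
  qed
  have "density marginal (\<lambda>x. emeasure (K x) ?A) = density marginal (\<lambda>x. ?H (x i))"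
  proof (rule measure_eqI_PiM_infinite[where I=I and M="\<lambda>_. borel"])
    show "sets (density marginal (\<lambda>x. emeasure (K x) ?A)) = sets ?B"
      "sets (density marginal (\<lambda>x. ?H (x i))) = sets ?B" by (simp_all add: sets_marginal)
    show "finite_measure (density marginal (\<lambda>x. emeasure (K x) ?A))"
    proof
      have "emeasure (density marginal (\<lambda>x. emeasure (K x) ?A)) (space ?B) \<le> (\<integral>\<^sup>+\<theta>. 1 \<partial>PiM I \<pi>)"
        unfolding dK[OF sets.top] using prob_space.emeasure_le_1[OF prob_space_obs]
        by (intro nn_integral_mono) (auto simp: indicator_def)
      then show "emeasure (density marginal (\<lambda>x. emeasure (K x) ?A)) (space (density marginal (\<lambda>x. emeasure (K x) ?A))) \<noteq> \<infinity>"
        using sets_eq_imp_space_eq[OF sets_marginal] by (auto simp: prior.P.emeasure_space_1 top_unique)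
    qed
    fix A J assume J: "finite J" "J \<subseteq> I" and As[measurable]: "\<And>j. j \<in> J \<Longrightarrow> A j \<in> sets (borel :: real measure)"
    \<comment> \<open>The base of the cylinder may miss \<open>i\<close>. Adding \<open>i\<close>
      with trivial factors 1 in \<open>g\<close>, \<open>f\<close> and \<open>h\<close> lets the
      i-th coordinate occur in every product below.\<close>
    let ?X = "prod_emb I (\<lambda>_. borel) J (Pi\<^sub>E J A)" and ?J = "insert i J"
    have X[measurable]: "?X \<in> sets ?B" using J As by (intro sets_PiM_I) auto
    have J': "finite ?J" "?J \<subseteq> I" using J i by auto
    define g where "g j y = (if j \<in> J then indicator (A j) y else 1 :: ennreal)" for j y
    have g[measurable]: "g j \<in> borel_measurable borel" for j
      using As[of j] by (cases "j \<in> J") (auto simp: g_def[abs_def])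
    define f where "f j y = (if j = i then indicator E y else 1 :: ennreal)" for j and y :: real
    have f[measurable]: "f j \<in> borel_measurable borel" for j
      by (cases "j = i") (auto simp: f_def[abs_def])
    define h where "h j y = (if j = i then ?H y else 1 :: ennreal)" for j and y :: real
    have h[measurable]: "h j \<in> borel_measurable borel" for j
      by (cases "j = i") (auto simp: h_def[abs_def])
    have Xg: "indicator ?X x = (\<Prod>j\<in>?J. g j (x j))" if "x \<in> space ?B" for x
    proof -
      have "(\<Prod>j\<in>?J. g j (x j)) = (\<Prod>j\<in>J. g j (x j))"
        using J by (cases "i \<in> J") (auto simp: insert_absorb g_def)
      also have "\<dots> = indicator ?X x"
        by (subst indicator_prod_emb[OF J(2) that J(1)]) (auto simp: g_def)
      finally show ?thesis by simp
    qed
    have prod_if: "(\<Prod>j\<in>?J. if j = i then v else 1) = v" for v :: ennreal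
      using J by (subst prod.delta) auto
    have "emeasure (density marginal (\<lambda>x. emeasure (K x) ?A)) ?X
        = (\<integral>\<^sup>+\<theta>. indicator ?A \<theta> * (\<integral>\<^sup>+x. indicator ?X x \<partial>obs \<theta>) \<partial>PiM I \<pi>)"
      unfolding dK[OF X] by (simp add: sets_obs)
    also have "\<dots> = (\<integral>\<^sup>+\<theta>. (\<Prod>j\<in>?J. f j (\<theta> j)) * (\<integral>\<^sup>+x. (\<Prod>j\<in>?J. g j (x j)) \<partial>obs \<theta>) \<partial>PiM I \<pi>)"
    proof (intro nn_integral_cong arg_cong2[where f="(*)"])
      fix \<theta> assume "\<theta> \<in> space (PiM I \<pi>)"
      then have "indicator ?A \<theta> = (\<Prod>j\<in>?J. if j = i then indicator E (\<theta> i) else 1 :: ennreal)"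
        unfolding prod_if by (auto simp: indicator_def)
      also have "\<dots> = (\<Prod>j\<in>?J. f j (\<theta> j))" by (intro prod.cong) (auto simp: f_def)
      finally show "indicator ?A \<theta> = (\<Prod>j\<in>?J. f j (\<theta> j))" .
    qed (simp add: Xg space_obs)
    also have "\<dots> = (\<Prod>j\<in>?J. \<integral>\<^sup>+\<theta>. \<integral>\<^sup>+y. f j \<theta> * g j y * normal_density \<theta> s y \<partial>lborel \<partial>\<pi> j)"
      using J' by (rule nn_integral_joint_prod) auto
    \<comment> \<open>Only the factor at \<open>i\<close> changes: Fubini brings the prior integral
      inside, where it is \<open>?H\<close> times the marginal density, so the event for the
      parameter becomes the function \<open>?H\<close> of the datum.\<close>
    also have "\<dots> = (\<Prod>j\<in>?J. \<integral>\<^sup>+\<theta>. \<integral>\<^sup>+y. 1 * (h j y * g j y) * normal_density \<theta> s y \<partial>lborel \<partial>\<pi> j)"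
    proof (rule prod.cong[OF refl])
      fix j
      show "(\<integral>\<^sup>+\<theta>. \<integral>\<^sup>+y. f j \<theta> * g j y * normal_density \<theta> s y \<partial>lborel \<partial>\<pi> j)
          = (\<integral>\<^sup>+\<theta>. \<integral>\<^sup>+y. 1 * (h j y * g j y) * normal_density \<theta> s y \<partial>lborel \<partial>\<pi> j)"
      proof (cases "j = i")
        case True
        have "(\<integral>\<^sup>+\<theta>. \<integral>\<^sup>+y. f j \<theta> * g j y * normal_density \<theta> s y \<partial>lborel \<partial>\<pi> j)
            = (\<integral>\<^sup>+y. \<integral>\<^sup>+\<theta>. f j \<theta> * g j y * normal_density \<theta> s y \<partial>\<pi> j \<partial>lborel)"
          by (rule nn_integral_prior_lborel_swap) measurable
        also have "\<dots> = (\<integral>\<^sup>+y. g j y * (\<integral>\<^sup>+\<theta>. (indicator E \<theta> :: ennreal) * normal_density \<theta> s y \<partial>\<pi> i) \<partial>lborel)"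
          using True by (intro nn_integral_cong, subst nn_integral_cmult[symmetric])
            (auto simp: f_def mult_ac intro!: nn_integral_cong)
        also have "\<dots> = (\<integral>\<^sup>+y. (h j y * g j y) * marginal_density i y \<partial>lborel)"
          using True by (intro nn_integral_cong)
            (simp add: h_def posterior_mean_times_marginal_density[symmetric] mult_ac)
        also have "\<dots> = (\<integral>\<^sup>+y. \<integral>\<^sup>+\<theta>. 1 * (h j y * g j y) * normal_density \<theta> s y \<partial>\<pi> j \<partial>lborel)"
          unfolding marginal_density_def using True
          by (intro nn_integral_cong, subst nn_integral_cmult[symmetric]) auto
        also have "\<dots> = (\<integral>\<^sup>+\<theta>. \<integral>\<^sup>+y. 1 * (h j y * g j y) * normal_density \<theta> s y \<partial>lborel \<partial>\<pi> j)"
          by (rule nn_integral_prior_lborel_swap[symmetric]) measurable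
        finally show ?thesis .
      qed (simp add: f_def h_def)
    qed
    also have "\<dots> = (\<integral>\<^sup>+\<theta>. (\<Prod>j\<in>?J. 1) * (\<integral>\<^sup>+x. (\<Prod>j\<in>?J. h j (x j) * g j (x j)) \<partial>obs \<theta>) \<partial>PiM I \<pi>)"
      using J' by (rule nn_integral_joint_prod[symmetric]) auto
    also have "\<dots> = (\<integral>\<^sup>+\<theta>. \<integral>\<^sup>+x. ?H (x i) * indicator ?X x \<partial>obs \<theta> \<partial>PiM I \<pi>)"
    proof -
      have "(\<Prod>j\<in>?J. h j (x j) * g j (x j)) = ?H (x i) * indicator ?X x" if "x \<in> space ?B" for x
      proof -
        have "(\<Prod>j\<in>?J. h j (x j)) = (\<Prod>j\<in>?J. if j = i then ?H (x i) else 1)"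
          by (intro prod.cong) (auto simp: h_def)
        then show ?thesis using Xg[OF that] prod_if by (simp add: prod.distrib)
      qed
      then show ?thesis by (auto intro!: nn_integral_cong simp: space_obs)
    qed
    also have "\<dots> = (\<integral>\<^sup>+x. ?H (x i) * indicator ?X x \<partial>marginal)"
      by (rule nn_integral_marginal[symmetric]) measurable
    also have "\<dots> = emeasure (density marginal (\<lambda>x. ?H (x i))) ?X"
      by (subst emeasure_density) auto
    finally show "emeasure (density marginal (\<lambda>x. emeasure (K x) ?A)) ?X
      = emeasure (density marginal (\<lambda>x. ?H (x i))) ?X" .
  qed
  then show ?thesis by (subst (asm) m.density_unique_iff) auto
qed

text \<open>Absolute continuity moves the almost sure identity for events from
  \<open>marginal\<close> to the law under the truth. The induction on \<open>w\<close> then runs on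
  integrals rather than on almost sure identities, so no exceptional sets have to be combined. The
  weight \<open>u\<close> permits a restriction to data near the truth.\<close>

lemma nn_integral_posterior_component:
  assumes ac: "absolutely_continuous marginal (obs \<theta>\<^sub>0)" and i: "i \<in> I"
    and u[measurable]: "u \<in> borel_measurable borel" and w: "w \<in> borel_measurable borel"
  shows "(\<integral>\<^sup>+x. u (x i) * (\<integral>\<^sup>+\<theta>. w (\<theta> i) \<partial>K x) \<partial>obs \<theta>\<^sub>0) =
    (\<integral>\<^sup>+y. u y * posterior_mean i w y * normal_density (\<theta>\<^sub>0 i) s y \<partial>lborel)"
proof -
  note comp = measurable_compose[OF component_borel_measurable[OF i]]
  have ux[measurable]: "(\<lambda>x. u (x i)) \<in> borel_measurable (PiM I (\<lambda>_. borel))" using i by measurable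
  have Kmeas: "(\<lambda>x. \<integral>\<^sup>+\<theta>. v (\<theta> i) \<partial>K x) \<in> borel_measurable (PiM I (\<lambda>_. borel))"
    if "v \<in> borel_measurable borel" for v
    by (rule measurable_compose[OF kernel_subprob nn_integral_measurable_subprob_algebra[OF comp[OF that]]])
  have wK: "(\<lambda>\<theta>. v (\<theta> i)) \<in> borel_measurable (K x)"
    if "x \<in> space (obs \<theta>\<^sub>0)" "v \<in> borel_measurable borel" for v :: "real \<Rightarrow> ennreal" and x
    using comp[OF that(2)] sets_kernel_eq that(1) by (simp add: space_obs cong: measurable_cong_sets)
  show ?thesis
    using w
  proof (induction w rule: borel_measurable_induct)
    case (cong f g)
    then show ?case by (simp add: posterior_mean_def)
  next
    case (set E)
    then have E: "E \<in> sets borel" .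
    have "AE x in obs \<theta>\<^sub>0. emeasure (K x) {\<theta>\<in>space (PiM I \<pi>). \<theta> i \<in> E} = posterior_mean i (indicator E) (x i)"
      by (rule absolutely_continuous_AE[OF _ ac emeasure_kernel_component_AE[OF i E]])
        (simp add: sets_obs sets_marginal)
    then have "AE x in obs \<theta>\<^sub>0. (\<integral>\<^sup>+\<theta>. indicator E (\<theta> i) \<partial>K x) = posterior_mean i (indicator E) (x i)"
    proof (rule AE_mp[OF _ AE_I2], intro impI)
      fix x assume x: "x \<in> space (obs \<theta>\<^sub>0)"
        and eq: "emeasure (K x) {\<theta>\<in>space (PiM I \<pi>). \<theta> i \<in> E} = posterior_mean i (indicator E) (x i)"
      have s: "sets (K x) = sets (PiM I \<pi>)" using x by (simp add: sets_kernel_eq space_obs)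
      have "(\<integral>\<^sup>+\<theta>. indicator E (\<theta> i) \<partial>K x) = (\<integral>\<^sup>+\<theta>. indicator {\<theta>\<in>space (PiM I \<pi>). \<theta> i \<in> E} \<theta> \<partial>K x)"
        using sets_eq_imp_space_eq[OF s] by (intro nn_integral_cong) (auto simp: indicator_def)
      also have "\<dots> = emeasure (K x) {\<theta>\<in>space (PiM I \<pi>). \<theta> i \<in> E}"
        unfolding s using i E by (intro nn_integral_indicator) (simp add: s)
      finally show "(\<integral>\<^sup>+\<theta>. indicator E (\<theta> i) \<partial>K x) = posterior_mean i (indicator E) (x i)"
        using eq by simp
    qed
    then have "(\<integral>\<^sup>+x. u (x i) * (\<integral>\<^sup>+\<theta>. indicator E (\<theta> i) \<partial>K x) \<partial>obs \<theta>\<^sub>0)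
        = (\<integral>\<^sup>+x. u (x i) * posterior_mean i (indicator E) (x i) \<partial>obs \<theta>\<^sub>0)"
      by (intro nn_integral_cong_AE) auto
    also have "\<dots> = (\<integral>\<^sup>+y. u y * posterior_mean i (indicator E) y * normal_density (\<theta>\<^sub>0 i) s y \<partial>lborel)"
      using E i by (intro nn_integral_obs_component) auto
    finally show ?case .
  next
    case (mult v c)
    note [measurable] = \<open>v \<in> borel_measurable borel\<close>
    have "(\<integral>\<^sup>+x. u (x i) * (\<integral>\<^sup>+\<theta>. c * v (\<theta> i) \<partial>K x) \<partial>obs \<theta>\<^sub>0)
        = (\<integral>\<^sup>+x. c * (u (x i) * (\<integral>\<^sup>+\<theta>. v (\<theta> i) \<partial>K x)) \<partial>obs \<theta>\<^sub>0)"
      using mult(2) by (intro nn_integral_cong) (simp add: nn_integral_cmult wK mult_ac)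
    also have "\<dots> = c * (\<integral>\<^sup>+x. u (x i) * (\<integral>\<^sup>+\<theta>. v (\<theta> i) \<partial>K x) \<partial>obs \<theta>\<^sub>0)"
      using Kmeas[OF mult(2)] by (intro nn_integral_cmult) (simp add: sets_obs cong: measurable_cong_sets)
    also have "\<dots> = (\<integral>\<^sup>+y. c * (u y * posterior_mean i v y * normal_density (\<theta>\<^sub>0 i) s y) \<partial>lborel)"
      unfolding mult(4) by (rule nn_integral_cmult[symmetric]) measurable
    also have "\<dots> = (\<integral>\<^sup>+y. u y * posterior_mean i (\<lambda>\<theta>. c * v \<theta>) y * normal_density (\<theta>\<^sub>0 i) s y \<partial>lborel)"
      by (simp add: posterior_mean_def nn_integral_cmult divide_ennreal_def mult_ac)
    finally show ?case .
  next
    case (add v w)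
    note [measurable] = \<open>v \<in> borel_measurable borel\<close> \<open>w \<in> borel_measurable borel\<close>
    note m[measurable] = Kmeas[OF \<open>v \<in> borel_measurable borel\<close>] Kmeas[OF \<open>w \<in> borel_measurable borel\<close>]
    have "(\<integral>\<^sup>+x. u (x i) * (\<integral>\<^sup>+\<theta>. w (\<theta> i) + v (\<theta> i) \<partial>K x) \<partial>obs \<theta>\<^sub>0)
        = (\<integral>\<^sup>+x. u (x i) * (\<integral>\<^sup>+\<theta>. w (\<theta> i) \<partial>K x) + u (x i) * (\<integral>\<^sup>+\<theta>. v (\<theta> i) \<partial>K x) \<partial>obs \<theta>\<^sub>0)"
      using add by (intro nn_integral_cong) (simp add: nn_integral_add wK distrib_left)
    also have "\<dots> = (\<integral>\<^sup>+x. u (x i) * (\<integral>\<^sup>+\<theta>. w (\<theta> i) \<partial>K x) \<partial>obs \<theta>\<^sub>0)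
        + (\<integral>\<^sup>+x. u (x i) * (\<integral>\<^sup>+\<theta>. v (\<theta> i) \<partial>K x) \<partial>obs \<theta>\<^sub>0)"
      by (rule nn_integral_add) measurable
    also have "\<dots> = (\<integral>\<^sup>+y. u y * posterior_mean i w y * normal_density (\<theta>\<^sub>0 i) s y
          + u y * posterior_mean i v y * normal_density (\<theta>\<^sub>0 i) s y \<partial>lborel)"
      using add by (simp add: nn_integral_add)
    also have "\<dots> = (\<integral>\<^sup>+y. u y * posterior_mean i (\<lambda>\<theta>. w \<theta> + v \<theta>) y * normal_density (\<theta>\<^sub>0 i) s y \<partial>lborel)"
      by (simp add: posterior_mean_def nn_integral_add divide_ennreal_def distrib_left distrib_right mult_ac)
    finally show ?case .
  next
    case (seq U)
    note U[measurable] = seq(1)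
    note m[measurable] = Kmeas[OF U]
    have inc: "incseq (\<lambda>j. u y * posterior_mean i (U j) y * normal_density (\<theta>\<^sub>0 i) s y)" for y
      using \<open>incseq U\<close> unfolding posterior_mean_def divide_ennreal_def
      by (intro incseq_SucI mult_right_mono mult_left_mono nn_integral_mono) (auto simp: incseq_def le_fun_def)
    have pmS: "posterior_mean i (\<lambda>\<theta>. SUP j. U j \<theta>) y = (SUP j. posterior_mean i (U j) y)" for y
    proof -
      have "(\<integral>\<^sup>+\<theta>. (SUP j. U j \<theta>) * normal_density \<theta> s y \<partial>\<pi> i) =
          (\<integral>\<^sup>+\<theta>. (SUP j. U j \<theta> * normal_density \<theta> s y) \<partial>\<pi> i)"
        by (simp add: SUP_mult_right_ennreal)
      also have "\<dots> = (SUP j. \<integral>\<^sup>+\<theta>. U j \<theta> * normal_density \<theta> s y \<partial>\<pi> i)"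
        using \<open>incseq U\<close> by (intro nn_integral_monotone_convergence_SUP)
          (auto simp: incseq_def le_fun_def intro!: mult_right_mono)
      finally show ?thesis
        by (simp add: posterior_mean_def divide_ennreal_def SUP_mult_right_ennreal)
    qed
    have "(\<integral>\<^sup>+x. u (x i) * (\<integral>\<^sup>+\<theta>. (SUP j. U j (\<theta> i)) \<partial>K x) \<partial>obs \<theta>\<^sub>0)
        = (\<integral>\<^sup>+x. (SUP j. u (x i) * (\<integral>\<^sup>+\<theta>. U j (\<theta> i) \<partial>K x)) \<partial>obs \<theta>\<^sub>0)"
    proof (intro nn_integral_cong)
      fix x assume x: "x \<in> space (obs \<theta>\<^sub>0)"
      have "(\<integral>\<^sup>+\<theta>. (SUP j. U j (\<theta> i)) \<partial>K x) = (SUP j. \<integral>\<^sup>+\<theta>. U j (\<theta> i) \<partial>K x)"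
        using \<open>incseq U\<close> by (intro nn_integral_monotone_convergence_SUP wK[OF x U])
          (auto simp: incseq_def le_fun_def)
      then show "u (x i) * (\<integral>\<^sup>+\<theta>. (SUP j. U j (\<theta> i)) \<partial>K x) = (SUP j. u (x i) * (\<integral>\<^sup>+\<theta>. U j (\<theta> i) \<partial>K x))"
        by (simp add: SUP_mult_left_ennreal)
    qed
    also have "\<dots> = (SUP j. \<integral>\<^sup>+x. u (x i) * (\<integral>\<^sup>+\<theta>. U j (\<theta> i) \<partial>K x) \<partial>obs \<theta>\<^sub>0)"
    proof (intro nn_integral_monotone_convergence_SUP)
      show "incseq (\<lambda>j x. u (x i) * (\<integral>\<^sup>+\<theta>. U j (\<theta> i) \<partial>K x))"
        using \<open>incseq U\<close> by (auto simp: incseq_def le_fun_def intro!: mult_left_mono nn_integral_mono)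
    qed measurable
    also have "\<dots> = (SUP j. \<integral>\<^sup>+y. u y * posterior_mean i (U j) y * normal_density (\<theta>\<^sub>0 i) s y \<partial>lborel)"
      using seq by simp
    also have "\<dots> = (\<integral>\<^sup>+y. (SUP j. u y * posterior_mean i (U j) y * normal_density (\<theta>\<^sub>0 i) s y) \<partial>lborel)"
      using inc by (intro nn_integral_monotone_convergence_SUP[symmetric])
        (auto simp: incseq_def le_fun_def)
    also have "\<dots> = (\<integral>\<^sup>+y. u y * posterior_mean i (\<lambda>\<theta>. SUP j. U j \<theta>) y * normal_density (\<theta>\<^sub>0 i) s y \<partial>lborel)"
      by (simp add: pmS SUP_mult_left_ennreal SUP_mult_right_ennreal)
    finally show ?case by (simp add: SUP_apply[abs_def])
  qed
qed

text \<open>The denominator of Bayes' formula cancels: under the truth the datum has a density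
  bounded by 1 / c times the marginal density, and \<open>posterior_mean\<close> times the marginal
  density is the numerator. After Fubini only a prior integral is left.\<close>

lemma nn_integral_posterior_component_le:
  assumes ac: "absolutely_continuous marginal (obs \<theta>\<^sub>0)" and i: "i \<in> I"
    and u[measurable]: "u \<in> borel_measurable borel" and w[measurable]: "w \<in> borel_measurable borel"
    and c: "0 < c" "\<And>y. ennreal (c * normal_density (\<theta>\<^sub>0 i) s y) \<le> marginal_density i y"
  shows "(\<integral>\<^sup>+x. u (x i) * (\<integral>\<^sup>+\<theta>. w (\<theta> i) \<partial>K x) \<partial>obs \<theta>\<^sub>0) \<le>
    ennreal (1/c) * (\<integral>\<^sup>+\<theta>. w \<theta> * (\<integral>\<^sup>+y. u y * normal_density \<theta> s y \<partial>lborel) \<partial>\<pi> i)"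
proof -
  have "(\<integral>\<^sup>+x. u (x i) * (\<integral>\<^sup>+\<theta>. w (\<theta> i) \<partial>K x) \<partial>obs \<theta>\<^sub>0) =
      (\<integral>\<^sup>+y. u y * posterior_mean i w y * normal_density (\<theta>\<^sub>0 i) s y \<partial>lborel)"
    by (rule nn_integral_posterior_component[OF ac i u w])
  also have "\<dots> \<le> (\<integral>\<^sup>+y. ennreal (1/c) * (\<integral>\<^sup>+\<theta>. u y * w \<theta> * normal_density \<theta> s y \<partial>\<pi> i) \<partial>lborel)"
  proof (intro nn_integral_mono)
    fix y
    have "ennreal (normal_density (\<theta>\<^sub>0 i) s y) = ennreal (1/c) * ennreal (c * normal_density (\<theta>\<^sub>0 i) s y)"
      using c(1) by (simp add: ennreal_mult[symmetric])
    also have "\<dots> \<le> ennreal (1/c) * marginal_density i y"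
      by (intro mult_left_mono c) auto
    finally have "u y * posterior_mean i w y * normal_density (\<theta>\<^sub>0 i) s y
        \<le> u y * posterior_mean i w y * (ennreal (1/c) * marginal_density i y)"
      by (intro mult_left_mono) auto
    also have "\<dots> = ennreal (1/c) * (u y * (posterior_mean i w y * marginal_density i y))"
      by (simp add: mult_ac)
    also have "\<dots> = ennreal (1/c) * (\<integral>\<^sup>+\<theta>. u y * w \<theta> * normal_density \<theta> s y \<partial>\<pi> i)"
      unfolding posterior_mean_times_marginal_density
      by (subst nn_integral_cmult[symmetric]) (auto simp: mult_ac)
    finally show "u y * posterior_mean i w y * normal_density (\<theta>\<^sub>0 i) s y
        \<le> ennreal (1/c) * (\<integral>\<^sup>+\<theta>. u y * w \<theta> * normal_density \<theta> s y \<partial>\<pi> i)" .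
  qed
  also have "\<dots> = ennreal (1/c) * (\<integral>\<^sup>+y. \<integral>\<^sup>+\<theta>. u y * w \<theta> * normal_density \<theta> s y \<partial>\<pi> i \<partial>lborel)"
    by (rule nn_integral_cmult) measurable
  also have "(\<integral>\<^sup>+y. \<integral>\<^sup>+\<theta>. u y * w \<theta> * normal_density \<theta> s y \<partial>\<pi> i \<partial>lborel)
      = (\<integral>\<^sup>+\<theta>. \<integral>\<^sup>+y. u y * w \<theta> * normal_density \<theta> s y \<partial>lborel \<partial>\<pi> i)"
    by (rule nn_integral_prior_lborel_swap[symmetric]) measurable
  also have "\<dots> = (\<integral>\<^sup>+\<theta>. w \<theta> * (\<integral>\<^sup>+y. u y * normal_density \<theta> s y \<partial>lborel) \<partial>\<pi> i)"
    by (intro nn_integral_cong, subst nn_integral_cmult[symmetric]) (auto simp: mult_ac)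
  finally show ?thesis .
qed

end

section \<open>Absolute continuity of the true law of the data with respect to its marginal
  law\<close>

lemma nn_integral_normal_density: "0 < s \<Longrightarrow> (\<integral>\<^sup>+y. normal_density \<mu> s y \<partial>lborel) = 1"
  using prob_space.emeasure_space_1[OF prob_space_normal_density[of s \<mu>]] by (simp add: emeasure_density)

text \<open>Completing the square: the squared density with mean a, divided by the density with mean
  b, is the constant on the right times the normal density with mean 2 a - b.\<close>

lemma nn_integral_normal_density_ratio_square:
  assumes s: "0 < s"
  shows "(\<integral>\<^sup>+y. (ennreal (normal_density a s y / normal_density b s y))\<^sup>2 \<partial>density lborel (normal_density b s))
    = ennreal (exp ((a - b)\<^sup>2 / s\<^sup>2))"
proof -
  have eq: "normal_density b s y * (normal_density a s y / normal_density b s y)\<^sup>2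
      = exp ((a - b)\<^sup>2 / s\<^sup>2) * normal_density (2 * a - b) s y" for y
  proof -
    let ?k = "1 / sqrt (2 * pi * s\<^sup>2)"
    have k: "?k > 0" using s by simp
    have "normal_density b s y * (normal_density a s y / normal_density b s y)\<^sup>2
        = normal_density a s y * normal_density a s y / normal_density b s y"
      using normal_density_pos[OF s, of b y] by (simp add: power2_eq_square)
    also have "\<dots> = ?k * (exp (- (y - a)\<^sup>2 / (2 * s\<^sup>2)) * exp (- (y - a)\<^sup>2 / (2 * s\<^sup>2)) / exp (- (y - b)\<^sup>2 / (2 * s\<^sup>2)))"
    proof -
      have "(k * A) * (k * A) / (k * B) = k * (A * A / B)" if "k > 0" for k A B :: real
        using that by simp
      from this[OF k] show ?thesis unfolding normal_density_def .
    qed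
    also have "\<dots> = ?k * exp (- (y - a)\<^sup>2 / (2 * s\<^sup>2) + - (y - a)\<^sup>2 / (2 * s\<^sup>2) - - (y - b)\<^sup>2 / (2 * s\<^sup>2))"
      by (simp only: exp_add exp_diff)
    also have "- (y - a)\<^sup>2 / (2 * s\<^sup>2) + - (y - a)\<^sup>2 / (2 * s\<^sup>2) - - (y - b)\<^sup>2 / (2 * s\<^sup>2)
        = (a - b)\<^sup>2 / s\<^sup>2 + - (y - (2 * a - b))\<^sup>2 / (2 * s\<^sup>2)"
      using s by (simp add: field_simps) (simp add: power2_eq_square algebra_simps)
    also have "?k * exp ((a - b)\<^sup>2 / s\<^sup>2 + - (y - (2 * a - b))\<^sup>2 / (2 * s\<^sup>2))
        = exp ((a - b)\<^sup>2 / s\<^sup>2) * normal_density (2 * a - b) s y"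
      unfolding normal_density_def exp_add by simp
    finally show ?thesis .
  qed
  have "(\<integral>\<^sup>+y. (ennreal (normal_density a s y / normal_density b s y))\<^sup>2 \<partial>density lborel (normal_density b s))
      = (\<integral>\<^sup>+y. ennreal (normal_density b s y) * (ennreal (normal_density a s y / normal_density b s y))\<^sup>2 \<partial>lborel)"
    by (subst nn_integral_density) auto
  also have "\<dots> = (\<integral>\<^sup>+y. ennreal (exp ((a - b)\<^sup>2 / s\<^sup>2)) * ennreal (normal_density (2 * a - b) s y) \<partial>lborel)"
  proof (intro nn_integral_cong)
    fix y
    have "ennreal (normal_density b s y) * (ennreal (normal_density a s y / normal_density b s y))\<^sup>2
        = ennreal (normal_density b s y * (normal_density a s y / normal_density b s y)\<^sup>2)"
      by (simp add: ennreal_power ennreal_mult)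
    also have "\<dots> = ennreal (exp ((a - b)\<^sup>2 / s\<^sup>2)) * ennreal (normal_density (2 * a - b) s y)"
      unfolding eq by (simp add: ennreal_mult)
    finally show "ennreal (normal_density b s y) * (ennreal (normal_density a s y / normal_density b s y))\<^sup>2
        = ennreal (exp ((a - b)\<^sup>2 / s\<^sup>2)) * ennreal (normal_density (2 * a - b) s y)" .
  qed
  also have "\<dots> = ennreal (exp ((a - b)\<^sup>2 / s\<^sup>2))"
    by (subst nn_integral_cmult) (simp_all add: nn_integral_normal_density[OF s])
  finally show ?thesis .
qed

context gaussian_sequence
begin

text \<open>The second moments of the coordinatewise likelihood ratios multiply to the exponential
  of the squared Euclidean distance over \<open>s\<^sup>2\<close>, so bounded partial sums are
  exactly what \<open>PiM_absolutely_continuous\<close> asks for.\<close>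

lemma obs_absolutely_continuous:
  assumes C: "\<And>J. finite J \<Longrightarrow> J \<subseteq> I \<Longrightarrow> (\<Sum>j\<in>J. (\<theta>\<^sub>0 j - \<theta> j)\<^sup>2) \<le> C"
  shows "absolutely_continuous (obs \<theta>) (obs \<theta>\<^sub>0)"
  unfolding obs_def
proof (rule PiM_absolutely_continuous[OF obs_product_prob_space obs_product_prob_space])
  let ?r = "\<lambda>i y. ennreal (normal_density (\<theta>\<^sub>0 i) s y / normal_density (\<theta> i) s y)"
  show "?r i \<in> borel_measurable (density lborel (normal_density (\<theta> i) s))" for i by simp
  show "density lborel (normal_density (\<theta>\<^sub>0 i) s) = density (density lborel (normal_density (\<theta> i) s)) (?r i)" for i
  proof (subst density_density_eq)
    have "ennreal (normal_density (\<theta> i) s x) * ?r i x = ennreal (normal_density (\<theta>\<^sub>0 i) s x)" for x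
      using normal_density_pos[OF s_pos, of "\<theta> i" x] by (simp add: ennreal_mult[symmetric])
    then show "density lborel (normal_density (\<theta>\<^sub>0 i) s)
        = density lborel (\<lambda>x. ennreal (normal_density (\<theta> i) s x) * ?r i x)" by simp
  qed auto
  fix J assume J: "finite J" "J \<subseteq> I"
  have "(\<Prod>j\<in>J. \<integral>\<^sup>+y. (?r j y)\<^sup>2 \<partial>density lborel (normal_density (\<theta> j) s))
      = ennreal (\<Prod>j\<in>J. exp ((\<theta>\<^sub>0 j - \<theta> j)\<^sup>2 / s\<^sup>2))"
    by (simp only: nn_integral_normal_density_ratio_square[OF s_pos]) (simp add: prod_ennreal)
  also have "(\<Prod>j\<in>J. exp ((\<theta>\<^sub>0 j - \<theta> j)\<^sup>2 / s\<^sup>2)) = exp ((\<Sum>j\<in>J. (\<theta>\<^sub>0 j - \<theta> j)\<^sup>2) / s\<^sup>2)"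
    using J by (simp add: exp_sum sum_divide_distrib)
  also have "\<dots> \<le> exp (C / s\<^sup>2)"
    using C[OF J] s_pos by (simp add: divide_right_mono)
  finally show "(\<Prod>j\<in>J. \<integral>\<^sup>+y. (?r j y)\<^sup>2 \<partial>density lborel (normal_density (\<theta> j) s)) \<le> ennreal (exp (C / s\<^sup>2))"
    by (simp add: ennreal_leI)
qed

text \<open>By Cameron-Martin, it suffices that one prior draw \<open>\<theta>\<close> with \<open>\<theta> - \<theta>\<^sub>0\<close> square summable
  gives the null set measure zero; almost every draw does.\<close>

lemma marginal_absolutely_continuous:
  assumes c: "\<And>J. finite J \<Longrightarrow> J \<subseteq> I \<Longrightarrow> (\<Sum>j\<in>J. \<integral>\<^sup>+\<theta>. ennreal ((\<theta>\<^sub>0 j - \<theta>)\<^sup>2) \<partial>\<pi> j) \<le> ennreal c"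
  shows "absolutely_continuous marginal (obs \<theta>\<^sub>0)"
  unfolding absolutely_continuous_def
proof
  fix A assume "A \<in> null_sets marginal"
  then have A[measurable]: "A \<in> sets (PiM I (\<lambda>_. borel))" and A0: "emeasure marginal A = 0"
    by (auto simp: sets_marginal)
  have [measurable]: "(\<lambda>\<theta>. emeasure (obs \<theta>) A) \<in> borel_measurable (PiM I \<pi>)"
    by (rule measurable_compose[OF obs_kernel_prior measurable_emeasure_subprob_algebra[OF A]])
  have "(\<integral>\<^sup>+\<theta>. emeasure (obs \<theta>) A \<partial>PiM I \<pi>) = 0"
    using A0 unfolding marginal_def
    by (subst (asm) emeasure_bind[OF space_PiM_prior_nonempty obs_kernel_prior A])
  then have AE1: "AE \<theta> in PiM I \<pi>. emeasure (obs \<theta>) A = 0"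
    by (subst (asm) nn_integral_0_iff_AE) auto
  \<comment> \<open>An exhaustion of the countable index set by finite sets: monotone convergence
    along it turns the uniform bound on finite sums into almost sure finiteness of the whole
    sum.\<close>
  define J where "J n = {i\<in>I. to_nat i < n}" for n
  have J: "finite (J n)" "J n \<subseteq> I" for n
  proof -
    have "J n \<subseteq> from_nat ` {..<n}" by (force simp: J_def image_iff intro: from_nat_to_nat[symmetric])
    then show "finite (J n)" by (rule finite_subset) simp
  qed (auto simp: J_def)
  define S where "S n \<theta> = (\<Sum>j\<in>J n. ennreal ((\<theta>\<^sub>0 j - \<theta> j)\<^sup>2))" for n and \<theta> :: "'i \<Rightarrow> real"
  have comp: "(\<lambda>\<theta>. ennreal ((\<theta>\<^sub>0 j - \<theta> j)\<^sup>2)) \<in> borel_measurable (PiM I \<pi>)" if "j \<in> I" for j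
  proof -
    have "(\<lambda>\<theta>. \<theta> j) \<in> PiM I \<pi> \<rightarrow>\<^sub>M \<pi> j" using that by auto
    then have [measurable]: "(\<lambda>\<theta>. \<theta> j) \<in> borel_measurable (PiM I \<pi>)"
      using measurable_cong_sets[OF refl sets_prior] by blast
    show ?thesis by measurable
  qed
  have S_meas[measurable]: "S n \<in> borel_measurable (PiM I \<pi>)" for n
    unfolding S_def using J by (intro borel_measurable_sum comp) auto
  have S_inc: "incseq S"
    unfolding S_def incseq_def le_fun_def using J by (intro allI impI sum_mono2) (auto simp: J_def)
  have S_int: "(\<integral>\<^sup>+\<theta>. S n \<theta> \<partial>PiM I \<pi>) \<le> ennreal c" for n
  proof -
    have "(\<integral>\<^sup>+\<theta>. S n \<theta> \<partial>PiM I \<pi>) = (\<Sum>j\<in>J n. \<integral>\<^sup>+\<theta>. ennreal ((\<theta>\<^sub>0 j - \<theta> j)\<^sup>2) \<partial>PiM I \<pi>)"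
      unfolding S_def using J[of n] by (intro nn_integral_sum comp) auto
    also have "\<dots> = (\<Sum>j\<in>J n. \<integral>\<^sup>+\<theta>. ennreal ((\<theta>\<^sub>0 j - \<theta>)\<^sup>2) \<partial>\<pi> j)"
      using J[of n] by (intro sum.cong refl prior.nn_integral_component_PiM) auto
    finally show ?thesis using c[OF J] by simp
  qed
  have "(\<integral>\<^sup>+\<theta>. (SUP n. S n \<theta>) \<partial>PiM I \<pi>) = (SUP n. \<integral>\<^sup>+\<theta>. S n \<theta> \<partial>PiM I \<pi>)"
    by (rule nn_integral_monotone_convergence_SUP[OF S_inc S_meas])
  also have "\<dots> \<le> ennreal c" by (intro SUP_least S_int)
  finally have "(\<integral>\<^sup>+\<theta>. (SUP n. S n \<theta>) \<partial>PiM I \<pi>) \<noteq> \<infinity>" by (auto simp: top_unique)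
  then have AE2: "AE \<theta> in PiM I \<pi>. (SUP n. S n \<theta>) \<noteq> \<infinity>"
    by (intro nn_integral_PInf_AE) auto
  have "ae_filter (PiM I \<pi>) \<noteq> bot"
    by (simp add: ae_filter_eq_bot_iff prior.P.emeasure_space_1)
  moreover have "AE \<theta> in PiM I \<pi>. emeasure (obs \<theta>) A = 0 \<and> (SUP n. S n \<theta>) \<noteq> \<infinity>"
    using AE1 AE2 by eventually_elim simp
  ultimately have "\<exists>\<theta>. emeasure (obs \<theta>) A = 0 \<and> (SUP n. S n \<theta>) \<noteq> \<infinity>"
    by (rule eventually_happens')
  then obtain \<theta> where \<theta>: "emeasure (obs \<theta>) A = 0" "(SUP n. S n \<theta>) \<noteq> \<infinity>" by blast
  define C where "C = enn2real (SUP n. S n \<theta>)"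
  have C: "ennreal C = (SUP n. S n \<theta>)" using \<theta>(2) by (simp only: C_def ennreal_enn2real_if infinity_ennreal_def if_False)
  have "absolutely_continuous (obs \<theta>) (obs \<theta>\<^sub>0)"
  proof (rule obs_absolutely_continuous)
    fix L assume L: "finite L" "L \<subseteq> I"
    then obtain n where n: "\<forall>i\<in>L. to_nat i < n"
      using finite_nat_set_iff_bounded[of "to_nat ` L"] by auto
    have "ennreal (\<Sum>j\<in>L. (\<theta>\<^sub>0 j - \<theta> j)\<^sup>2) \<le> S n \<theta>"
      unfolding S_def using L n J[of n]
      by (subst sum_ennreal[symmetric], simp, intro sum_mono2) (auto simp: J_def)
    also have "\<dots> \<le> ennreal C" unfolding C by (rule SUP_upper) simp
    finally show "(\<Sum>j\<in>L. (\<theta>\<^sub>0 j - \<theta> j)\<^sup>2) \<le> C" by (simp add: ennreal_le_iff C_def)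
  qed
  moreover have "A \<in> null_sets (obs \<theta>)" using \<theta>(1) by (auto simp: sets_obs)
  ultimately show "A \<in> null_sets (obs \<theta>\<^sub>0)" unfolding absolutely_continuous_def by auto
qed

end

section \<open>The supremum distance in terms of the coefficients\<close>

lemma borel_measurable_level_term [measurable]:
  assumes "wavelet_basis \<psi> \<alpha>"
  shows "(\<lambda>t. level_term \<psi> \<theta> t l) \<in> borel_measurable borel"
proof -
  have "\<psi> l k \<in> borel_measurable borel" if "k < 2 ^ l" for k
    using assms that unfolding wavelet_basis_def by simp
  then show ?thesis
    unfolding level_term_def by (intro borel_measurable_sum borel_measurable_times) auto
qed

lemma level_term_diff:
  "level_term \<psi> \<theta> t l - level_term \<psi> \<theta>' t l = level_term \<psi> (\<lambda>i. \<theta> i - \<theta>' i) t l"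
  unfolding level_term_def by (simp add: sum_subtractf left_diff_distrib)

lemma abs_level_term_le:
  assumes "(\<Sum>k<2 ^ l. \<bar>\<psi> l k t\<bar>) \<le> P" "0 \<le> P"
    and D: "\<And>k. k < 2 ^ l \<Longrightarrow> \<bar>d (l, k)\<bar> \<le> D" "0 \<le> D"
  shows "\<bar>level_term \<psi> d t l\<bar> \<le> P * D"
proof -
  have "\<bar>level_term \<psi> d t l\<bar> \<le> (\<Sum>k<2 ^ l. \<bar>d (l, k)\<bar> * \<bar>\<psi> l k t\<bar>)"
    unfolding level_term_def by (rule order_trans[OF sum_abs]) (simp add: abs_mult)
  also have "\<dots> \<le> (\<Sum>k<2 ^ l. D * \<bar>\<psi> l k t\<bar>)"
    using D by (intro sum_mono mult_right_mono) auto
  also have "\<dots> = D * (\<Sum>k<2 ^ l. \<bar>\<psi> l k t\<bar>)" by (simp add: sum_distrib_left)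
  also have "\<dots> \<le> D * P" using assms by (intro mult_left_mono) auto
  finally show ?thesis by (simp add: mult.commute)
qed

lemma set_integrable_bounded_01:
  fixes f :: "real \<Rightarrow> real"
  assumes [measurable]: "f \<in> borel_measurable borel" and "\<And>t. t \<in> {0..1} \<Longrightarrow> \<bar>f t\<bar> \<le> C"
  shows "set_integrable lborel {0..1} f"
  unfolding set_integrable_def
proof (rule Bochner_Integration.integrable_bound)
  show "integrable lborel (\<lambda>t. C * indicator {0..1::real} t)" by simp
  show "AE t in lborel. norm (indicator {0..1} t *\<^sub>R f t) \<le> norm (C * indicator {0..1} t)"
    by (intro AE_I2) (use order_trans[OF assms(2) abs_ge_self] in \<open>auto simp: indicator_def\<close>)
qed simp

text \<open>The Besov bound makes the wavelet series converge uniformly, hence to a bounded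
  \<open>g\<close>. Its coefficients are those of \<open>f0\<close> by orthonormality, so
  \<open>g\<close> - \<open>f0\<close> is a square integrable function with vanishing coefficients,
  and Parseval's identity makes it zero almost everywhere.\<close>

lemma besov_series_AE_eq:
  assumes wav: "wavelet_basis \<psi> \<alpha>" and \<alpha>: "\<alpha> > 0"
    and f0_meas: "f0 \<in> borel_measurable lborel"
    and f0_L2: "set_integrable lborel {0..1} (\<lambda>t. (f0 t)\<^sup>2)"
    and B: "\<And>l k. k < 2 ^ l \<Longrightarrow> \<bar>ip01 f0 (\<psi> l k)\<bar> \<le> B * 2 powr (- (real l * (1 / 2 + \<alpha>)))"
  defines "\<theta>\<^sub>0 \<equiv> (\<lambda>(l, k). ip01 f0 (\<psi> l k))"
  shows "\<And>t. t \<in> {0..1} \<Longrightarrow> summable (level_term \<psi> \<theta>\<^sub>0 t)"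
    and "AE t in lborel. t \<in> {0..1} \<longrightarrow> suminf (level_term \<psi> \<theta>\<^sub>0 t) = f0 t"
proof -
  have [measurable]: "f0 \<in> borel_measurable borel" using f0_meas by simp
  have \<psi>m[measurable]: "\<psi> l k \<in> borel_measurable borel" if "k < 2 ^ l" for l k
    using wav that unfolding wavelet_basis_def by simp
  have orth: "ip01 (\<psi> l k) (\<psi> l' k') = (if (l, k) = (l', k') then 1 else 0)"
    if "k < 2 ^ l" "k' < 2 ^ l'" for l k l' k'
    using wav that unfolding wavelet_basis_def by blast
  have parseval: "((\<lambda>(l, k). (ip01 g (\<psi> l k))\<^sup>2) has_sum ip01 g g) wav_index"
    if "g \<in> borel_measurable lborel" "set_integrable lborel {0..1} (\<lambda>t. (g t)\<^sup>2)" for g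
    using wav that unfolding wavelet_basis_def by blast
  obtain C where C: "C > 0" "\<And>l t. t \<in> {0..1} \<Longrightarrow> (\<Sum>k<2 ^ l. \<bar>\<psi> l k t\<bar>) \<le> C * 2 powr (real l / 2)"
    using wav unfolding wavelet_basis_def by blast
  obtain C' where C': "\<And>l k t. k < 2 ^ l \<Longrightarrow> t \<in> {0..1} \<Longrightarrow> \<bar>\<psi> l k t\<bar> \<le> C' * 2 powr (real l / 2)"
  proof -
    have "\<exists>C>0. \<forall>l k. k < 2 ^ l \<longrightarrow>
        (\<exists>a. \<forall>t\<in>{0..1}. \<psi> l k t \<noteq> 0 \<longrightarrow> \<bar>t - a\<bar> \<le> C * 2 powr (- real l)) \<and>
        (\<forall>t\<in>{0..1}. \<bar>\<psi> l k t\<bar> \<le> C * 2 powr (real l / 2))"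
      using wav unfolding wavelet_basis_def by (elim conjE)
    then show ?thesis using that by metis
  qed
  have "0 \<le> \<bar>ip01 f0 (\<psi> 0 0)\<bar>" by simp
  also have "\<dots> \<le> B" using B[of 0 0] by simp
  finally have B0: "0 \<le> B" .
  \<comment> \<open>The factor 2^(l/2) from the sum of the |psi| cancels the 1/2 in the decay of the
    coefficients; a geometric sequence with ratio 2^(-\<alpha>) remains.\<close>
  define r where "r l = C * B * (2 powr - \<alpha>) ^ l" for l :: nat
  have r_sum: "summable r"
    unfolding r_def using \<alpha> powr_less_mono[of "- \<alpha>" 0 2] by (intro summable_mult summable_geometric) simp
  have r_bound: "\<bar>level_term \<psi> \<theta>\<^sub>0 t l\<bar> \<le> r l" if "t \<in> {0..1}" for t l
  proof -
    have "\<bar>level_term \<psi> \<theta>\<^sub>0 t l\<bar> \<le> (C * 2 powr (real l / 2)) * (B * 2 powr (- (real l * (1 / 2 + \<alpha>))))"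
      using C that B B0 by (intro abs_level_term_le) (auto simp: \<theta>\<^sub>0_def)
    also have "\<dots> = C * B * 2 powr (real l / 2 + - (real l * (1 / 2 + \<alpha>)))"
      by (simp only: powr_add mult_ac)
    also have "real l / 2 + - (real l * (1 / 2 + \<alpha>)) = (- \<alpha>) * real l" by (simp add: algebra_simps)
    also have "2 powr ((- \<alpha>) * real l) = (2 powr - \<alpha>) ^ l"
      by (subst powr_powr[symmetric], subst powr_realpow) auto
    finally show ?thesis by (simp add: r_def)
  qed
  show summ: "summable (level_term \<psi> \<theta>\<^sub>0 t)" if "t \<in> {0..1}" for t
    using r_bound[OF that] by (intro summable_comparison_test'[OF r_sum, of 0]) auto
  have r0: "0 \<le> r l" for l using C(1) B0 by (simp add: r_def)
  define G where "G = suminf r"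
  have part: "\<bar>\<Sum>l<N. level_term \<psi> \<theta>\<^sub>0 t l\<bar> \<le> G" if "t \<in> {0..1}" for t N
  proof -
    have "\<bar>\<Sum>l<N. level_term \<psi> \<theta>\<^sub>0 t l\<bar> \<le> (\<Sum>l<N. r l)"
      by (rule order_trans[OF sum_abs sum_mono]) (use r_bound[OF that] in auto)
    also have "\<dots> \<le> G" unfolding G_def by (intro sum_le_suminf r_sum) (auto simp: r0)
    finally show ?thesis .
  qed
  define g where "g t = suminf (level_term \<psi> \<theta>\<^sub>0 t)" for t
  have lt[measurable]: "(\<lambda>t. level_term \<psi> \<theta>\<^sub>0 t l) \<in> borel_measurable borel" for l
    by (rule borel_measurable_level_term[OF wav])
  have g_meas[measurable]: "g \<in> borel_measurable borel"
    unfolding g_def[abs_def] by (rule borel_measurable_suminf[OF lt])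
  have lim: "(\<lambda>N. \<Sum>l<N. level_term \<psi> \<theta>\<^sub>0 t l) \<longlonglongrightarrow> g t" if "t \<in> {0..1}" for t
    unfolding g_def using summ[OF that] by (rule summable_LIMSEQ)
  have g_bound: "\<bar>g t\<bar> \<le> G" if "t \<in> {0..1}" for t
    by (rule LIMSEQ_le_const2[OF tendsto_rabs[OF lim[OF that]]]) (use part[OF that] in auto)
  have intg\<psi>: "set_integrable lborel {0..1} (\<lambda>t. \<psi> l' k' t * \<psi> l k t)" if "k < 2 ^ l" "k' < 2 ^ l'" for l k l' k'
    using \<psi>m[OF that(1)] \<psi>m[OF that(2)] C'[OF that(1)] C'[OF that(2)]
    by (intro set_integrable_bounded_01[where C="C' * 2 powr (real l' / 2) * (C' * 2 powr (real l / 2))"])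
      (auto simp: abs_mult intro!: mult_mono order_trans[OF abs_ge_zero])
  have ip_g: "ip01 g (\<psi> l k) = \<theta>\<^sub>0 (l, k)" if lk: "k < 2 ^ l" for l k
  proof -
    note [measurable] = \<psi>m[OF lk]
    let ?p = "\<lambda>N t. indicator {0..1} t *\<^sub>R ((\<Sum>l<N. level_term \<psi> \<theta>\<^sub>0 t l) * \<psi> l k t)"
    let ?D = "C' * 2 powr (real l / 2)"
    \<comment> \<open>The uniform bound \<open>G\<close> on the partial sums provides the dominating
      function for exchanging limit and inner product.\<close>
    have "(\<lambda>N. integral\<^sup>L lborel (?p N)) \<longlonglongrightarrow> (LBINT t. indicator {0..1} t *\<^sub>R (g t * \<psi> l k t))"
    proof (rule integral_dominated_convergence)
      show "integrable lborel (\<lambda>t. G * ?D * indicator {0..1::real} t)" by simp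
      show "AE t in lborel. (\<lambda>N. ?p N t) \<longlonglongrightarrow> indicator {0..1} t *\<^sub>R (g t * \<psi> l k t)"
      proof (rule AE_I2)
        fix t show "(\<lambda>N. ?p N t) \<longlonglongrightarrow> indicator {0..1} t *\<^sub>R (g t * \<psi> l k t)"
          by (cases "t \<in> {0..1}") (auto simp del: atLeastAtMost_iff intro!: tendsto_intros lim)
      qed
      show "AE t in lborel. norm (?p N t) \<le> G * ?D * indicator {0..1::real} t" for N
        using part C'[OF lk] by (intro AE_I2) (auto simp: abs_mult indicator_def simp del: atLeastAtMost_iff
          intro!: mult_mono order_trans[OF abs_ge_zero])
    qed measurable
    moreover have "integral\<^sup>L lborel (?p N) = \<theta>\<^sub>0 (l, k)" if "N > l" for N
    proof -
      have "integral\<^sup>L lborel (?p N) = (LBINT t:{0..1}. (\<Sum>l'<N. \<Sum>k'<2 ^ l'. \<theta>\<^sub>0 (l', k') * (\<psi> l' k' t * \<psi> l k t)))"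
        unfolding set_lebesgue_integral_def level_term_def
        by (simp add: sum_distrib_right sum_distrib_left mult_ac)
      also have "\<dots> = (\<Sum>l'<N. \<Sum>k'<2 ^ l'. LBINT t:{0..1}. \<theta>\<^sub>0 (l', k') * (\<psi> l' k' t * \<psi> l k t))"
        unfolding set_lebesgue_integral_def scaleR_sum_right
        using intg\<psi>[OF lk] unfolding set_integrable_def
        by (subst Bochner_Integration.integral_sum; (intro Bochner_Integration.integrable_sum sum.cong refl)?)
          (auto simp: mult.left_commute[of _ "\<theta>\<^sub>0 _"] intro!: Bochner_Integration.integral_sum)
      also have "\<dots> = (\<Sum>l'<N. \<Sum>k'<2 ^ l'. \<theta>\<^sub>0 (l', k') * ip01 (\<psi> l' k') (\<psi> l k))"
        unfolding ip01_def by simp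
      also have "\<dots> = (\<Sum>l'<N. \<Sum>k'<2 ^ l'. if l' = l then (if k' = k then \<theta>\<^sub>0 (l, k) else 0) else 0)"
        using lk by (intro sum.cong refl) (auto simp: orth)
      also have "\<dots> = (\<Sum>l'<N. if l' = l then (\<Sum>k'<2 ^ l. if k' = k then \<theta>\<^sub>0 (l, k) else 0) else 0)"
        by (intro sum.cong refl) auto
      also have "\<dots> = \<theta>\<^sub>0 (l, k)" using lk that by (simp add: sum.delta)
      finally show ?thesis .
    qed
    then have "(\<lambda>N. integral\<^sup>L lborel (?p N)) \<longlonglongrightarrow> \<theta>\<^sub>0 (l, k)"
      by (intro tendsto_eventually eventually_sequentiallyI[of "Suc l"]) auto
    ultimately show ?thesis
      unfolding ip01_def set_lebesgue_integral_def by (rule LIMSEQ_unique)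
  qed
  define h where "h t = g t - f0 t" for t
  have h_meas[measurable]: "h \<in> borel_measurable borel" unfolding h_def[abs_def] by measurable
  have h_L2: "set_integrable lborel {0..1} (\<lambda>t. (h t)\<^sup>2)"
    unfolding set_integrable_def
  proof (rule Bochner_Integration.integrable_bound)
    have g2: "set_integrable lborel {0..1} (\<lambda>t. (g t)\<^sup>2)"
      using order_trans[OF g_bound abs_ge_self]
      by (intro set_integrable_bounded_01[where C="G\<^sup>2"]) (auto simp: abs_le_square_iff[symmetric])
    show "integrable lborel (\<lambda>t. 2 * (indicator {0..1} t *\<^sub>R (g t)\<^sup>2) + 2 * (indicator {0..1} t *\<^sub>R (f0 t)\<^sup>2))"
      using g2 f0_L2 unfolding set_integrable_def by (intro Bochner_Integration.integrable_add integrable_mult_right)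
    show "AE t in lborel. norm (indicator {0..1} t *\<^sub>R (h t)\<^sup>2)
        \<le> norm (2 * (indicator {0..1} t *\<^sub>R (g t)\<^sup>2) + 2 * (indicator {0..1} t *\<^sub>R (f0 t)\<^sup>2))"
    proof (rule AE_I2)
      fix t
      have "(h t)\<^sup>2 \<le> 2 * (g t)\<^sup>2 + 2 * (f0 t)\<^sup>2"
        using zero_le_power2[of "g t + f0 t"] unfolding h_def by (simp add: power2_eq_square algebra_simps)
      then show "norm (indicator {0..1} t *\<^sub>R (h t)\<^sup>2)
        \<le> norm (2 * (indicator {0..1} t *\<^sub>R (g t)\<^sup>2) + 2 * (indicator {0..1} t *\<^sub>R (f0 t)\<^sup>2))"
        by (simp add: indicator_def)
    qed
  qed simp
  have ip_h: "ip01 h (\<psi> l k) = 0" if lk: "k < 2 ^ l" for l k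
  proof -
    note [measurable] = \<psi>m[OF lk]
    have 1: "set_integrable lborel {0..1} (\<lambda>t. g t * \<psi> l k t)"
      using g_bound C'[OF lk]
      by (intro set_integrable_bounded_01[where C="G * (C' * 2 powr (real l / 2))"])
        (auto simp: abs_mult intro!: mult_mono order_trans[OF abs_ge_zero])
    have 2: "set_integrable lborel {0..1} (\<lambda>t. f0 t * \<psi> l k t)"
      unfolding set_integrable_def
    proof (rule Bochner_Integration.integrable_bound)
      show "integrable lborel (\<lambda>t. indicator {0..1} t *\<^sub>R (f0 t)\<^sup>2 + indicator {0..1} t *\<^sub>R (\<psi> l k t * \<psi> l k t))"
        using f0_L2 intg\<psi>[OF lk lk] unfolding set_integrable_def by (rule Bochner_Integration.integrable_add)
      show "AE t in lborel. norm (indicator {0..1} t *\<^sub>R (f0 t * \<psi> l k t))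
        \<le> norm (indicator {0..1} t *\<^sub>R (f0 t)\<^sup>2 + indicator {0..1} t *\<^sub>R (\<psi> l k t * \<psi> l k t))"
      proof (rule AE_I2)
        fix t
        have "\<bar>f0 t * \<psi> l k t\<bar> \<le> (f0 t)\<^sup>2 + (\<psi> l k t)\<^sup>2"
          using zero_le_power2[of "\<bar>f0 t\<bar> - \<bar>\<psi> l k t\<bar>"] mult_nonneg_nonneg[OF abs_ge_zero[of "f0 t"] abs_ge_zero[of "\<psi> l k t"]]
          unfolding power2_diff power2_abs abs_mult by linarith
        then show "norm (indicator {0..1} t *\<^sub>R (f0 t * \<psi> l k t))
          \<le> norm (indicator {0..1} t *\<^sub>R (f0 t)\<^sup>2 + indicator {0..1} t *\<^sub>R (\<psi> l k t * \<psi> l k t))"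
          by (simp add: indicator_def power2_eq_square)
      qed
    qed simp
    have "ip01 h (\<psi> l k) = ip01 g (\<psi> l k) - ip01 f0 (\<psi> l k)"
      unfolding ip01_def h_def left_diff_distrib using 1 2 by (rule set_integral_diff(2))
    then show ?thesis using ip_g[OF lk] by (simp add: \<theta>\<^sub>0_def)
  qed
  \<comment> \<open>Completeness of the basis enters here.\<close>
  have "((\<lambda>(l, k). (ip01 h (\<psi> l k))\<^sup>2) has_sum ip01 h h) wav_index"
    by (rule parseval[OF _ h_L2]) simp
  moreover have "((\<lambda>(l, k). (ip01 h (\<psi> l k))\<^sup>2) has_sum 0) wav_index"
    by (rule has_sum_0) (auto simp: wav_index_def ip_h)
  ultimately have "ip01 h h = 0" by (rule has_sum_unique)
  then have "(LBINT t. indicator {0..1} t *\<^sub>R (h t)\<^sup>2) = 0"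
    unfolding ip01_def set_lebesgue_integral_def by (simp add: power2_eq_square)
  then have "AE t in lborel. indicator {0..1} t *\<^sub>R (h t)\<^sup>2 = 0"
    using h_L2 unfolding set_integrable_def by (subst (asm) integral_nonneg_eq_0_iff_AE) auto
  then show "AE t in lborel. t \<in> {0..1} \<longrightarrow> suminf (level_term \<psi> \<theta>\<^sub>0 t) = f0 t"
    by eventually_elim (auto simp: h_def g_def)
qed

text \<open>On each level the largest deviation is at most the threshold \<open>a l\<close> plus all
  excesses over it; \<open>ennreal\<close> sends negative reals to 0, so every summand is a positive
  part. The thresholds are free and get chosen later. If the right-hand side is infinite there is
  nothing to show; otherwise it supplies a summable majorant of the levels, so that the series
  converges and \<open>sup_dist\<close> takes its first branch.\<close>

lemma sup_dist_le:
  assumes wav: "wavelet_basis \<psi> \<alpha>" and \<alpha>: "\<alpha> > 0"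
    and f0_meas: "f0 \<in> borel_measurable lborel"
    and f0_L2: "set_integrable lborel {0..1} (\<lambda>t. (f0 t)\<^sup>2)"
    and B: "\<And>l k. k < 2 ^ l \<Longrightarrow> \<bar>ip01 f0 (\<psi> l k)\<bar> \<le> B * 2 powr (- (real l * (1 / 2 + \<alpha>)))"
    and C: "C > 0" "\<And>l t. t \<in> {0..1} \<Longrightarrow> (\<Sum>k<2 ^ l. \<bar>\<psi> l k t\<bar>) \<le> C * 2 powr (real l / 2)"
    and a: "\<And>l. 0 \<le> a l"
  shows "sup_dist \<psi> f0 \<theta> \<le> (\<Sum>l. ennreal (C * 2 powr (real l / 2)) *
    (ennreal (a l) + (\<Sum>k<2 ^ l. ennreal (\<bar>\<theta> (l, k) - ip01 f0 (\<psi> l k)\<bar> - a l))))"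
    (is "_ \<le> (\<Sum>l. ?R l)")
proof (cases "(\<Sum>l. ?R l) = \<top>")
  case False
  define \<theta>\<^sub>0 where "\<theta>\<^sub>0 = (\<lambda>(l, k). ip01 f0 (\<psi> l k))"
  have ser1: "summable (level_term \<psi> \<theta>\<^sub>0 t)" if "t \<in> {0..1}" for t
    unfolding \<theta>\<^sub>0_def by (rule besov_series_AE_eq(1)[OF wav \<alpha> f0_meas f0_L2 _ that]) (rule B)
  have ser2: "AE t in lborel. t \<in> {0..1} \<longrightarrow> suminf (level_term \<psi> \<theta>\<^sub>0 t) = f0 t"
    unfolding \<theta>\<^sub>0_def by (rule besov_series_AE_eq(2)[OF wav \<alpha> f0_meas f0_L2]) (rule B)
  \<comment> \<open>The same level bound in real numbers, with \<open>max 0\<close> reproducing the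
    truncation done by \<open>ennreal\<close>.\<close>
  define r where "r l = C * 2 powr (real l / 2) *
    (a l + (\<Sum>k<2 ^ l. max 0 (\<bar>\<theta> (l, k) - \<theta>\<^sub>0 (l, k)\<bar> - a l)))" for l
  have r0: "0 \<le> r l" for l
    unfolding r_def using C(1) a by (intro mult_nonneg_nonneg add_nonneg_nonneg sum_nonneg) auto
  have Rr: "?R l = ennreal (r l)" for l
  proof -
    have "(\<Sum>k<2 ^ l. ennreal (\<bar>\<theta> (l, k) - ip01 f0 (\<psi> l k)\<bar> - a l))
        = (\<Sum>k<2 ^ l. ennreal (max 0 (\<bar>\<theta> (l, k) - \<theta>\<^sub>0 (l, k)\<bar> - a l)))"
      by (intro sum.cong refl) (auto simp: \<theta>\<^sub>0_def max_def ennreal_neg)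
    also have "\<dots> = ennreal (\<Sum>k<2 ^ l. max 0 (\<bar>\<theta> (l, k) - \<theta>\<^sub>0 (l, k)\<bar> - a l))"
      by (intro sum_ennreal) auto
    finally show ?thesis
      unfolding r_def using a C(1) by (simp add: ennreal_mult sum_nonneg add_nonneg_nonneg)
  qed
  have r_sum: "summable r"
    using False r0 unfolding Rr by (intro summable_suminf_not_top) auto
  have sum_eq: "(\<Sum>l. ?R l) = ennreal (suminf r)"
    unfolding Rr using r0 by (intro suminf_ennreal2 r_sum)
  have bound: "\<bar>level_term \<psi> (\<lambda>i. \<theta> i - \<theta>\<^sub>0 i) t l\<bar> \<le> r l" if "t \<in> {0..1}" for t l
    unfolding r_def
  proof (rule abs_level_term_le)
    show "(\<Sum>k<2 ^ l. \<bar>\<psi> l k t\<bar>) \<le> C * 2 powr (real l / 2)" by (rule C(2)[OF that])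
    show "0 \<le> C * 2 powr (real l / 2)" using C(1) by simp
    show "0 \<le> a l + (\<Sum>k<2 ^ l. max 0 (\<bar>\<theta> (l, k) - \<theta>\<^sub>0 (l, k)\<bar> - a l))"
      using a by (intro add_nonneg_nonneg sum_nonneg) auto
    fix k :: nat assume k: "k < 2 ^ l"
    have "\<bar>\<theta> (l, k) - \<theta>\<^sub>0 (l, k)\<bar> - a l \<le> max 0 (\<bar>\<theta> (l, k) - \<theta>\<^sub>0 (l, k)\<bar> - a l)" by simp
    also have "\<dots> \<le> (\<Sum>k<2 ^ l. max 0 (\<bar>\<theta> (l, k) - \<theta>\<^sub>0 (l, k)\<bar> - a l))"
      using k by (intro member_le_sum) auto
    finally show "\<bar>\<theta> (l, k) - \<theta>\<^sub>0 (l, k)\<bar> \<le> a l + (\<Sum>k<2 ^ l. max 0 (\<bar>\<theta> (l, k) - \<theta>\<^sub>0 (l, k)\<bar> - a l))"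
      by simp
  qed
  have dsum: "summable (level_term \<psi> (\<lambda>i. \<theta> i - \<theta>\<^sub>0 i) t)" if "t \<in> {0..1}" for t
    using bound[OF that] by (intro summable_comparison_test'[OF r_sum, of 0]) auto
  have lt: "level_term \<psi> \<theta> t = (\<lambda>l. level_term \<psi> (\<lambda>i. \<theta> i - \<theta>\<^sub>0 i) t l + level_term \<psi> \<theta>\<^sub>0 t l)" for t
    by (simp add: level_term_diff[symmetric] fun_eq_iff)
  have tsum: "summable (level_term \<psi> \<theta> t)" if "t \<in> {0..1}" for t
    unfolding lt using dsum[OF that] ser1[OF that] by (rule summable_add)
  have diff: "\<bar>suminf (level_term \<psi> \<theta> t) - suminf (level_term \<psi> \<theta>\<^sub>0 t)\<bar> \<le> suminf r" if "t \<in> {0..1}" for t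
  proof -
    have "suminf (level_term \<psi> \<theta> t) - suminf (level_term \<psi> \<theta>\<^sub>0 t) = suminf (level_term \<psi> (\<lambda>i. \<theta> i - \<theta>\<^sub>0 i) t)"
      unfolding lt using suminf_add[OF dsum[OF that] ser1[OF that]] by simp
    also have "\<bar>\<dots>\<bar> \<le> suminf r"
    proof -
      have ab: "summable (\<lambda>l. \<bar>level_term \<psi> (\<lambda>i. \<theta> i - \<theta>\<^sub>0 i) t l\<bar>)"
        using bound[OF that] by (intro summable_comparison_test'[OF r_sum, of 0]) auto
      show ?thesis
        by (rule order_trans[OF summable_rabs[OF ab] suminf_le[OF bound[OF that] ab r_sum]])
    qed
    finally show ?thesis .
  qed
  have lm: "(\<lambda>t. suminf (level_term \<psi> \<theta> t)) \<in> borel_measurable borel"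
    by (rule borel_measurable_suminf[OF borel_measurable_level_term[OF wav]])
  have "esssup (restrict_space lborel {0..1}) (\<lambda>t. ennreal \<bar>suminf (level_term \<psi> \<theta> t) - f0 t\<bar>)
      \<le> ennreal (suminf r)"
  proof (rule esssup_I)
    have "(\<lambda>t. ennreal \<bar>suminf (level_term \<psi> \<theta> t) - f0 t\<bar>) \<in> borel_measurable lborel"
      using lm f0_meas by simp
    then show "(\<lambda>t. ennreal \<bar>suminf (level_term \<psi> \<theta> t) - f0 t\<bar>) \<in> borel_measurable (restrict_space lborel {0..1})"
      by (rule measurable_restrict_space1)
    have "AE t in lborel. t \<in> {0..1} \<longrightarrow> ennreal \<bar>suminf (level_term \<psi> \<theta> t) - f0 t\<bar> \<le> ennreal (suminf r)"
      using ser2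
    proof eventually_elim
      case (elim t)
      then show ?case using diff[of t] by (auto intro!: ennreal_leI)
    qed
    then show "AE t in restrict_space lborel {0..1}. ennreal \<bar>suminf (level_term \<psi> \<theta> t) - f0 t\<bar> \<le> ennreal (suminf r)"
      by (subst AE_restrict_space_iff) auto
  qed
  moreover have "AE t in restrict_space lborel {0..1}. summable (level_term \<psi> \<theta> t)"
    using tsum by (intro AE_I2) (simp add: space_restrict_space)
  ultimately show ?thesis unfolding sup_dist_def sum_eq by simp
qed simp

section \<open>One-dimensional estimates\<close>

text \<open>Half of the Gaussian exponent is bounded by its value at distance r, and the other half
  is the exponent of a normal density of doubled variance. This explains the 4 in the exponent and
  the factor sqrt 2, the ratio of the normalising constants.\<close>

lemma normal_density_tail:
  assumes s: "0 < s" and r: "0 \<le> r"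
  shows "(\<integral>\<^sup>+y. indicator {y. r \<le> \<bar>y - \<theta>\<bar>} y * ennreal (normal_density \<theta> s y) \<partial>lborel)
    \<le> ennreal (sqrt 2 * exp (- r\<^sup>2 / (4 * s\<^sup>2)))"
proof -
  have "(\<integral>\<^sup>+y. indicator {y. r \<le> \<bar>y - \<theta>\<bar>} y * ennreal (normal_density \<theta> s y) \<partial>lborel)
      \<le> (\<integral>\<^sup>+y. ennreal (sqrt 2 * exp (- r\<^sup>2 / (4 * s\<^sup>2))) * ennreal (normal_density \<theta> (sqrt 2 * s) y) \<partial>lborel)"
  proof (intro nn_integral_mono)
    fix y
    show "indicator {y. r \<le> \<bar>y - \<theta>\<bar>} y * ennreal (normal_density \<theta> s y)
      \<le> ennreal (sqrt 2 * exp (- r\<^sup>2 / (4 * s\<^sup>2))) * ennreal (normal_density \<theta> (sqrt 2 * s) y)"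
    proof (cases "r \<le> \<bar>y - \<theta>\<bar>")
      case True
      have "r\<^sup>2 \<le> (y - \<theta>)\<^sup>2"
        using True r by (metis abs_le_square_iff abs_of_nonneg)
      then have "- (y - \<theta>)\<^sup>2 / (2 * s\<^sup>2) \<le> - r\<^sup>2 / (4 * s\<^sup>2) + - (y - \<theta>)\<^sup>2 / (2 * (sqrt 2 * s)\<^sup>2)"
        using s by (simp add: power_mult_distrib field_simps)
      then have "exp (- (y - \<theta>)\<^sup>2 / (2 * s\<^sup>2))
          \<le> exp (- r\<^sup>2 / (4 * s\<^sup>2)) * exp (- (y - \<theta>)\<^sup>2 / (2 * (sqrt 2 * s)\<^sup>2))"
        by (simp only: exp_add[symmetric] exp_le_cancel_iff)
      then have "normal_density \<theta> s y
          \<le> 1 / sqrt (2 * pi * s\<^sup>2) * (exp (- r\<^sup>2 / (4 * s\<^sup>2)) * exp (- (y - \<theta>)\<^sup>2 / (2 * (sqrt 2 * s)\<^sup>2)))"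
        unfolding normal_density_def by (rule mult_left_mono) (use s in simp)
      also have "\<dots> = sqrt 2 * exp (- r\<^sup>2 / (4 * s\<^sup>2)) * normal_density \<theta> (sqrt 2 * s) y"
      proof -
        have "2 * pi * (sqrt 2 * s)\<^sup>2 = 2 * (2 * pi * s\<^sup>2)" by (simp add: power_mult_distrib)
        then have k: "1 / sqrt (2 * pi * s\<^sup>2) = sqrt 2 * (1 / sqrt (2 * pi * (sqrt 2 * s)\<^sup>2))"
          by (simp only: real_sqrt_mult[of 2 "2 * pi * s\<^sup>2"]) simp
        show ?thesis unfolding normal_density_def k by (simp only: mult_ac)
      qed
      finally have "normal_density \<theta> s y \<le> sqrt 2 * exp (- r\<^sup>2 / (4 * s\<^sup>2)) * normal_density \<theta> (sqrt 2 * s) y" .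
      then show ?thesis using True by (simp add: ennreal_mult[symmetric] ennreal_leI)
    qed simp
  qed
  also have "\<dots> = ennreal (sqrt 2 * exp (- r\<^sup>2 / (4 * s\<^sup>2)))"
    using s by (subst nn_integral_cmult) (auto simp: nn_integral_normal_density)
  finally show ?thesis .
qed

text \<open>Half of the interval \<open>[\<theta>\<^sub>0 - h, \<theta>\<^sub>0 + h]\<close> lies on the same side of \<open>\<theta>\<^sub>0\<close> as the observation \<open>x\<close>;
  there the likelihood drops by at most a factor \<open>exp (-1/2)\<close> compared with \<open>\<theta>\<^sub>0\<close>.\<close>

lemma marginal_lower_bound:
  assumes s: "0 < s" and h: "0 < h" "h \<le> s" and q: "0 \<le> q" "\<And>\<theta>. \<bar>\<theta> - \<theta>\<^sub>0\<bar> \<le> h \<Longrightarrow> q \<le> p \<theta>"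
  shows "ennreal (q * h / 2 * normal_density \<theta>\<^sub>0 s x) \<le> (\<integral>\<^sup>+\<theta>. ennreal (p \<theta>) * ennreal (normal_density \<theta> s x) \<partial>lborel)"
proof -
  define S where "S = (if \<theta>\<^sub>0 \<le> x then {\<theta>\<^sub>0..\<theta>\<^sub>0 + h} else {\<theta>\<^sub>0 - h..\<theta>\<^sub>0})"
  have "ennreal (q * h / 2 * normal_density \<theta>\<^sub>0 s x) = ennreal (q / 2 * normal_density \<theta>\<^sub>0 s x) * emeasure lborel S"
    using h q by (simp add: S_def ennreal_mult[symmetric] mult_ac)
  also have "\<dots> = (\<integral>\<^sup>+\<theta>. ennreal (q / 2 * normal_density \<theta>\<^sub>0 s x) * indicator S \<theta> \<partial>lborel)"
    by (subst nn_integral_cmult_indicator) (auto simp: S_def)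
  also have "\<dots> \<le> (\<integral>\<^sup>+\<theta>. ennreal (p \<theta>) * ennreal (normal_density \<theta> s x) \<partial>lborel)"
  proof (intro nn_integral_mono)
    fix \<theta>
    show "ennreal (q / 2 * normal_density \<theta>\<^sub>0 s x) * indicator S \<theta> \<le> ennreal (p \<theta>) * ennreal (normal_density \<theta> s x)"
    proof (cases "\<theta> \<in> S")
      case True
      have d: "\<bar>\<theta> - \<theta>\<^sub>0\<bar> \<le> h" "0 \<le> (\<theta> - \<theta>\<^sub>0) * (x - \<theta>\<^sub>0)"
        using True h by (auto simp: S_def mult_nonneg_nonneg mult_nonpos_nonpos split: if_splits)
      have "(x - \<theta>)\<^sup>2 = (x - \<theta>\<^sub>0)\<^sup>2 + (\<theta> - \<theta>\<^sub>0)\<^sup>2 - 2 * ((\<theta> - \<theta>\<^sub>0) * (x - \<theta>\<^sub>0))"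
        by (simp add: power2_eq_square algebra_simps)
      also have "\<dots> \<le> (x - \<theta>\<^sub>0)\<^sup>2 + s\<^sup>2"
        using d h s abs_le_square_iff[of "\<theta> - \<theta>\<^sub>0" s] by auto
      finally have "- (x - \<theta>\<^sub>0)\<^sup>2 / (2 * s\<^sup>2) + - 1/2 \<le> - (x - \<theta>)\<^sup>2 / (2 * s\<^sup>2)"
      proof -
        assume "(x - \<theta>)\<^sup>2 \<le> (x - \<theta>\<^sub>0)\<^sup>2 + s\<^sup>2"
        then have "(x - \<theta>)\<^sup>2 / (2 * s\<^sup>2) \<le> ((x - \<theta>\<^sub>0)\<^sup>2 + s\<^sup>2) / (2 * s\<^sup>2)"
          by (intro divide_right_mono) auto
        also have "\<dots> = (x - \<theta>\<^sub>0)\<^sup>2 / (2 * s\<^sup>2) + 1/2" using s by (simp add: add_divide_distrib)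
        finally show ?thesis by simp
      qed
      then have "exp (- (x - \<theta>\<^sub>0)\<^sup>2 / (2 * s\<^sup>2)) * exp (- 1/2) \<le> exp (- (x - \<theta>)\<^sup>2 / (2 * s\<^sup>2))"
        by (simp only: exp_add[symmetric] exp_le_cancel_iff)
      moreover have "1/2 \<le> exp (- 1/2 :: real)" using exp_ge_add_one_self[of "- 1/2 :: real"] by simp
      ultimately have "exp (- (x - \<theta>\<^sub>0)\<^sup>2 / (2 * s\<^sup>2)) * (1/2) \<le> exp (- (x - \<theta>)\<^sup>2 / (2 * s\<^sup>2))"
        by (meson exp_ge_zero mult_left_mono order_trans)
      then have "1 / sqrt (2 * pi * s\<^sup>2) * (exp (- (x - \<theta>\<^sub>0)\<^sup>2 / (2 * s\<^sup>2)) * (1/2)) \<le> normal_density \<theta> s x"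
        unfolding normal_density_def by (rule mult_left_mono) (use s in simp)
      then have "1/2 * normal_density \<theta>\<^sub>0 s x \<le> normal_density \<theta> s x"
        unfolding normal_density_def by simp
      then have "q * (1/2 * normal_density \<theta>\<^sub>0 s x) \<le> p \<theta> * normal_density \<theta> s x"
        using q(2)[OF d(1)] q(1) by (intro mult_mono) auto
      then show ?thesis using True q(2)[OF d(1)] q(1) by (simp add: ennreal_mult[symmetric] ennreal_leI)
    qed simp
  qed
  finally show ?thesis .
qed

text \<open>From (1 + x/4)^4 <= exp x. The fourth power is needed to absorb
  \<open>(1 + u\<^sup>2)\<^sup>2\<close> in the bound for \<open>exp_moment\<close>.\<close>

lemma exp_ge_pow4: "0 \<le> x \<Longrightarrow> x ^ 4 / 256 \<le> exp (x :: real)"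
proof -
  assume x: "0 \<le> x"
  have "x ^ 4 / 256 = (x / 4) ^ 4" by (simp add: power_divide)
  also have "\<dots> \<le> (1 + x / real 4) ^ 4" using x by (intro power_mono) auto
  also have "\<dots> \<le> exp x" using x exp_ge_one_plus_x_over_n_power_n[of 4 x] by simp
  finally show ?thesis .
qed

lemma integrable_inverse_1_plus_square_lborel: "integrable lborel (\<lambda>u::real. 1 / (1 + u\<^sup>2))"
  using integrable_inverse_1_plus_square
  by (simp add: set_integrable_def einterval_def inverse_eq_divide)

section \<open>Prior densities with tails of the form exp (-b |x|^(1 + \<delta>))\<close>

locale exp_power_density =
  fixes \<phi> :: "real \<Rightarrow> real" and b1 b2 c1 c2 \<delta> :: real
  assumes cont: "continuous_on UNIV \<phi>"
    and nonneg: "\<And>x. \<phi> x \<ge> 0"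
    and int: "(\<integral>\<^sup>+ x. ennreal (\<phi> x) \<partial>lborel) = 1"
    and pos: "\<And>x. \<bar>x\<bar> \<le> 1 \<Longrightarrow> \<phi> x > 0"
    and consts_pos: "b1 > 0" "b2 > 0" "c1 > 0" "c2 > 0" "\<delta> > 0"
    and tails: "\<And>x. \<bar>x\<bar> \<ge> 1 \<Longrightarrow>
        c1 * exp (- b1 * \<bar>x\<bar> powr (1 + \<delta>)) \<le> \<phi> x \<and> \<phi> x \<le> c2 * exp (- b2 * \<bar>x\<bar> powr (1 + \<delta>))"
begin

lemma borel_measurable_density [measurable]: "\<phi> \<in> borel_measurable borel"
  using cont by (rule borel_measurable_continuous_onI)

text \<open>On [-1, 1] a continuous positive function has a positive minimum; outside, raising the
  bound on |u| to the power 1 + \<delta> turns the tail exponent into a multiple of L. Here L will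
  be l + 1, and D will be B + 1, to reach the truth together with a small window around it.\<close>

lemma density_lower_bound:
  assumes D: "D \<ge> 1"
  shows "\<exists>\<kappa>>0. \<exists>C>0. \<forall>L\<ge>1. \<forall>u. \<bar>u\<bar> \<le> D * L powr (1 / (1 + \<delta>)) \<longrightarrow> \<kappa> * exp (- C * L) \<le> \<phi> u"
proof -
  have "continuous_on {-1..1} \<phi>" using cont by (rule continuous_on_subset) auto
  then obtain m where m: "m \<in> {-1..1}" "\<And>x. x \<in> {-1..1} \<Longrightarrow> \<phi> m \<le> \<phi> x"
    using continuous_attains_inf[of "{-1..1::real}" \<phi>] by auto
  define C where "C = b1 * D powr (1 + \<delta>)"
  have C: "C > 0" using consts_pos D by (simp add: C_def)
  define \<kappa> where "\<kappa> = min (\<phi> m) c1"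
  have \<kappa>: "\<kappa> > 0" using pos[of m] m(1) consts_pos by (simp add: \<kappa>_def abs_le_iff)
  have "\<kappa> * exp (- C * L) \<le> \<phi> u" if L: "L \<ge> 1" and u: "\<bar>u\<bar> \<le> D * L powr (1 / (1 + \<delta>))" for L u
  proof (cases "\<bar>u\<bar> \<le> 1")
    case True
    have "\<kappa> * exp (- C * L) \<le> \<kappa> * 1" using \<kappa> C L by (intro mult_left_mono) auto
    also have "\<dots> \<le> \<phi> u" using m(2)[of u] True by (auto simp: \<kappa>_def abs_le_iff min_le_iff_disj)
    finally show ?thesis .
  next
    case False
    have "\<bar>u\<bar> powr (1 + \<delta>) \<le> (D * L powr (1 / (1 + \<delta>))) powr (1 + \<delta>)"
      using u consts_pos by (intro powr_mono2) auto
    also have "\<dots> = D powr (1 + \<delta>) * L"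
      using D L consts_pos by (simp add: powr_mult powr_powr)
    finally have "b1 * \<bar>u\<bar> powr (1 + \<delta>) \<le> C * L"
      using consts_pos unfolding C_def mult.assoc by (intro mult_left_mono) auto
    then have "\<kappa> * exp (- C * L) \<le> c1 * exp (- b1 * \<bar>u\<bar> powr (1 + \<delta>))"
      using \<kappa> by (intro mult_mono) (auto simp: \<kappa>_def)
    also have "\<dots> \<le> \<phi> u" using tails[of u] False by auto
    finally show ?thesis .
  qed
  then show ?thesis using \<kappa> C by blast
qed

text \<open>The exponential weight uses half of the tail rate \<open>b2\<close>, which keeps the
  integral finite and is still enough for a Chernoff bound; the factor \<open>1 + u\<^sup>2\<close>
  dominates both |u| and \<open>u\<^sup>2\<close>. The default value 0 of \<open>enn2real\<close> at
  infinity is ruled out by \<open>nn_integral_exp_moment\<close>.\<close>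

definition exp_moment :: real where
  "exp_moment = enn2real (\<integral>\<^sup>+u. ennreal ((1 + u\<^sup>2) * exp (b2 / 2 * \<bar>u\<bar> powr (1 + \<delta>)) * \<phi> u) \<partial>lborel)"

lemma nn_integral_exp_moment:
  "(\<integral>\<^sup>+u. ennreal ((1 + u\<^sup>2) * exp (b2 / 2 * \<bar>u\<bar> powr (1 + \<delta>)) * \<phi> u) \<partial>lborel) = ennreal exp_moment"
proof -
  let ?f = "\<lambda>u. (1 + u\<^sup>2) * exp (b2 / 2 * \<bar>u\<bar> powr (1 + \<delta>)) * \<phi> u"
  have "continuous_on {-1..1} \<phi>" using cont by (rule continuous_on_subset) auto
  then obtain m where "\<forall>x\<in>{-1..1}. \<phi> x \<le> \<phi> m"
    using continuous_attains_sup[of "{-1..1::real}" \<phi>] by auto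
  then have m: "\<phi> x \<le> \<phi> m" if "x \<in> {-1..1}" for x using that by blast
  define b where "b = b2 / 2"
  have b: "b > 0" using consts_pos by (simp add: b_def)
  \<comment> \<open>A bound for the integrand times one more factor \<open>1 + u\<^sup>2\<close>, so
    that the integral is compared with that of \<open>1 / (1 + u\<^sup>2)\<close>. The squared
    factor \<open>(1 + u\<^sup>2)\<^sup>2\<close> is at most 4 on [-1, 1] and at most 4 |u|^4
    outside, and 256 / b^4 bounds |u|^4 exp (-b |u|).\<close>
  define C where "C = 4 * exp b * \<phi> m + 4 * c2 * 256 / b ^ 4"
  have C0: "0 \<le> 4 * exp b * \<phi> m" "0 \<le> 4 * c2 * 256 / b ^ 4"
    using nonneg[of m] consts_pos b by simp_all
  have bound: "?f u \<le> C * (1 / (1 + u\<^sup>2))" for u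
  proof -
    have pu: "0 < 1 + u\<^sup>2" by (simp add: add_pos_nonneg)
    have "(1 + u\<^sup>2) * ?f u \<le> C"
    proof (cases "\<bar>u\<bar> \<le> 1")
      case True
      then have u2: "u\<^sup>2 \<le> 1" by (simp add: abs_square_le_1)
      have "\<bar>u\<bar> powr (1 + \<delta>) \<le> 1 powr (1 + \<delta>)" using True consts_pos by (intro powr_mono2) auto
      then have e: "exp (b2 / 2 * \<bar>u\<bar> powr (1 + \<delta>)) \<le> exp b" using b by (simp add: b_def)
      have "(1 + u\<^sup>2) * ?f u = ((1 + u\<^sup>2) * (1 + u\<^sup>2)) * exp (b2 / 2 * \<bar>u\<bar> powr (1 + \<delta>)) * \<phi> u"
        by (simp only: mult_ac)
      also have "\<dots> \<le> ((1 + 1) * (1 + 1)) * exp b * \<phi> m"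
        using u2 e m[of u] True nonneg by (intro mult_mono add_mono) (auto simp: abs_le_iff)
      finally show ?thesis using C0 by (simp add: C_def)
    next
      case False
      then have u1: "1 \<le> \<bar>u\<bar>" by simp
      then have "1 \<le> u\<^sup>2" using abs_le_square_iff[of 1 u] by simp
      then have "(1 + u\<^sup>2) * (1 + u\<^sup>2) \<le> (2 * u\<^sup>2) * (2 * u\<^sup>2)" by (intro mult_mono) auto
      also have "\<dots> = 4 * \<bar>u\<bar> ^ 4" by (simp add: power2_eq_square power4_eq_xxxx)
      finally have 1: "(1 + u\<^sup>2) * (1 + u\<^sup>2) \<le> 4 * \<bar>u\<bar> ^ 4" .
      have "\<bar>u\<bar> powr 1 \<le> \<bar>u\<bar> powr (1 + \<delta>)" using u1 consts_pos by (intro powr_mono) auto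
      then have pw: "\<bar>u\<bar> \<le> \<bar>u\<bar> powr (1 + \<delta>)" using u1 by simp
      have "\<phi> u \<le> c2 * exp (- b2 * \<bar>u\<bar> powr (1 + \<delta>))" using tails[OF u1] by simp
      then have "exp (b2 / 2 * \<bar>u\<bar> powr (1 + \<delta>)) * \<phi> u
          \<le> exp (b2 / 2 * \<bar>u\<bar> powr (1 + \<delta>)) * (c2 * exp (- b2 * \<bar>u\<bar> powr (1 + \<delta>)))"
        by (intro mult_left_mono) auto
      also have "\<dots> = c2 * exp (b2 / 2 * \<bar>u\<bar> powr (1 + \<delta>) + - b2 * \<bar>u\<bar> powr (1 + \<delta>))"
        by (simp only: exp_add mult_ac)
      also have "b2 / 2 * \<bar>u\<bar> powr (1 + \<delta>) + - b2 * \<bar>u\<bar> powr (1 + \<delta>) = - (b * \<bar>u\<bar> powr (1 + \<delta>))"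
        by (simp add: b_def field_simps)
      also have "c2 * exp (- (b * \<bar>u\<bar> powr (1 + \<delta>))) \<le> c2 * exp (- (b * \<bar>u\<bar>))"
        using pw b consts_pos by (intro mult_left_mono) auto
      finally have 2: "exp (b2 / 2 * \<bar>u\<bar> powr (1 + \<delta>)) * \<phi> u \<le> c2 * exp (- (b * \<bar>u\<bar>))" .
      have 3: "\<bar>u\<bar> ^ 4 * exp (- (b * \<bar>u\<bar>)) \<le> 256 / b ^ 4"
      proof -
        have "(b * \<bar>u\<bar>) ^ 4 / 256 \<le> exp (b * \<bar>u\<bar>)" using b by (intro exp_ge_pow4) auto
        then show ?thesis using b by (simp add: exp_minus power_mult_distrib field_simps)
      qed
      have "(1 + u\<^sup>2) * ?f u = ((1 + u\<^sup>2) * (1 + u\<^sup>2)) * (exp (b2 / 2 * \<bar>u\<bar> powr (1 + \<delta>)) * \<phi> u)"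
        by (simp only: mult_ac)
      also have "\<dots> \<le> (4 * \<bar>u\<bar> ^ 4) * (c2 * exp (- (b * \<bar>u\<bar>)))"
        using nonneg by (intro mult_mono 1 2) auto
      also have "\<dots> = (4 * c2) * (\<bar>u\<bar> ^ 4 * exp (- (b * \<bar>u\<bar>)))" by (simp only: mult_ac)
      also have "\<dots> \<le> (4 * c2) * (256 / b ^ 4)"
        using consts_pos by (intro mult_left_mono 3) auto
      finally show ?thesis using C0 by (simp add: C_def)
    qed
    then show ?thesis using pu by (simp add: field_simps)
  qed
  have "(\<integral>\<^sup>+u. ennreal (?f u) \<partial>lborel) \<le> (\<integral>\<^sup>+u. ennreal (C * (1 / (1 + u\<^sup>2))) \<partial>lborel)"
    using bound by (intro nn_integral_mono ennreal_leI) auto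
  also have "\<dots> < \<infinity>"
    using integrable_mult_right[OF integrable_inverse_1_plus_square_lborel, of C]
    by (subst nn_integral_eq_integral) (use C0 in \<open>auto simp: C_def add_nonneg_nonneg\<close>)
  finally show ?thesis unfolding exp_moment_def by simp
qed

lemma exp_moment_nonneg: "0 \<le> exp_moment"
  by (simp add: exp_moment_def)

definition scaled :: "real \<Rightarrow> real measure" where
  "scaled \<sigma> = density lborel (\<lambda>x. ennreal (\<phi> (x / \<sigma>) / \<sigma>))"

lemma sets_scaled [measurable_cong, simp]: "sets (scaled \<sigma>) = sets borel"
  by (simp add: scaled_def)

lemma nn_integral_scaled:
  assumes \<sigma>: "0 < \<sigma>" and [measurable]: "g \<in> borel_measurable borel"
  shows "(\<integral>\<^sup>+x. g x \<partial>scaled \<sigma>) = (\<integral>\<^sup>+u. g (\<sigma> * u) * ennreal (\<phi> u) \<partial>lborel)"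
proof -
  have "(\<integral>\<^sup>+x. g x \<partial>scaled \<sigma>) = (\<integral>\<^sup>+x. ennreal (\<phi> (x / \<sigma>) / \<sigma>) * g x \<partial>lborel)"
    unfolding scaled_def by (subst nn_integral_density) auto
  also have "\<dots> = ennreal \<bar>\<sigma>\<bar> * (\<integral>\<^sup>+u. ennreal (\<phi> ((0 + \<sigma> * u) / \<sigma>) / \<sigma>) * g (0 + \<sigma> * u) \<partial>lborel)"
    using \<sigma> by (intro nn_integral_real_affine) auto
  also have "\<dots> = (\<integral>\<^sup>+u. ennreal \<bar>\<sigma>\<bar> * (ennreal (\<phi> ((0 + \<sigma> * u) / \<sigma>) / \<sigma>) * g (0 + \<sigma> * u)) \<partial>lborel)"
    by (subst nn_integral_cmult) auto
  also have "\<dots> = (\<integral>\<^sup>+u. g (\<sigma> * u) * ennreal (\<phi> u) \<partial>lborel)"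
  proof (intro nn_integral_cong)
    fix u
    have "ennreal \<bar>\<sigma>\<bar> * ennreal (\<phi> ((0 + \<sigma> * u) / \<sigma>) / \<sigma>) = ennreal (\<phi> u)"
      using \<sigma> nonneg by (simp add: ennreal_mult[symmetric])
    then show "ennreal \<bar>\<sigma>\<bar> * (ennreal (\<phi> ((0 + \<sigma> * u) / \<sigma>) / \<sigma>) * g (0 + \<sigma> * u)) = g (\<sigma> * u) * ennreal (\<phi> u)"
      by (simp only: mult.assoc[symmetric] add_0) (simp only: mult.commute)
  qed
  finally show ?thesis .
qed

lemma prob_space_scaled: "0 < \<sigma> \<Longrightarrow> prob_space (scaled \<sigma>)"
proof
  assume \<sigma>: "0 < \<sigma>"
  have "emeasure (scaled \<sigma>) (space (scaled \<sigma>)) = (\<integral>\<^sup>+x. 1 \<partial>scaled \<sigma>)" by simp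
  also have "\<dots> = 1" using int by (subst nn_integral_scaled[OF \<sigma>]) auto
  finally show "emeasure (scaled \<sigma>) (space (scaled \<sigma>)) = 1" .
qed

lemma nn_integral_scaled_le_exp_moment:
  assumes \<sigma>: "0 < \<sigma>" and [measurable]: "g \<in> borel_measurable borel" and c: "0 \<le> c"
    and g: "\<And>u. g (\<sigma> * u) \<le> c * ((1 + u\<^sup>2) * exp (b2 / 2 * \<bar>u\<bar> powr (1 + \<delta>)))"
  shows "(\<integral>\<^sup>+x. ennreal (g x) \<partial>scaled \<sigma>) \<le> ennreal (c * exp_moment)"
proof -
  have "(\<integral>\<^sup>+x. ennreal (g x) \<partial>scaled \<sigma>) = (\<integral>\<^sup>+u. ennreal (g (\<sigma> * u)) * ennreal (\<phi> u) \<partial>lborel)"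
    by (rule nn_integral_scaled[OF \<sigma>]) measurable
  also have "\<dots> \<le> (\<integral>\<^sup>+u. ennreal c * ennreal ((1 + u\<^sup>2) * exp (b2 / 2 * \<bar>u\<bar> powr (1 + \<delta>)) * \<phi> u) \<partial>lborel)"
  proof (intro nn_integral_mono)
    fix u
    have "ennreal (g (\<sigma> * u)) * ennreal (\<phi> u) = ennreal (g (\<sigma> * u) * \<phi> u)"
      using nonneg by (simp add: ennreal_mult'')
    also have "\<dots> \<le> ennreal (c * ((1 + u\<^sup>2) * exp (b2 / 2 * \<bar>u\<bar> powr (1 + \<delta>)) * \<phi> u))"
      using mult_right_mono[OF g nonneg, of u u] by (intro ennreal_leI) (simp only: mult_ac)
    also have "\<dots> = ennreal c * ennreal ((1 + u\<^sup>2) * exp (b2 / 2 * \<bar>u\<bar> powr (1 + \<delta>)) * \<phi> u)"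
      using c by (simp add: ennreal_mult')
    finally show "ennreal (g (\<sigma> * u)) * ennreal (\<phi> u)
      \<le> ennreal c * ennreal ((1 + u\<^sup>2) * exp (b2 / 2 * \<bar>u\<bar> powr (1 + \<delta>)) * \<phi> u)" .
  qed
  also have "\<dots> = ennreal (c * exp_moment)"
    by (subst nn_integral_cmult, measurable) (simp only: nn_integral_exp_moment ennreal_mult[OF c exp_moment_nonneg])
  finally show ?thesis .
qed

lemma scaled_second_moment:
  assumes \<sigma>: "0 < \<sigma>"
  shows "(\<integral>\<^sup>+x. ennreal ((\<theta>\<^sub>0 - x)\<^sup>2) \<partial>scaled \<sigma>) \<le> ennreal (2 * (\<sigma>\<^sup>2 + \<theta>\<^sub>0\<^sup>2) * exp_moment)"
proof (rule nn_integral_scaled_le_exp_moment[OF \<sigma>])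
  fix u
  have "(\<theta>\<^sub>0 - \<sigma> * u)\<^sup>2 \<le> 2 * (\<sigma> * u)\<^sup>2 + 2 * \<theta>\<^sub>0\<^sup>2"
    using zero_le_power2[of "\<theta>\<^sub>0 + \<sigma> * u"] by (simp add: power2_eq_square algebra_simps)
  also have "\<dots> \<le> 2 * (\<sigma>\<^sup>2 + \<theta>\<^sub>0\<^sup>2) * ((1 + u\<^sup>2) * 1)"
    by (simp add: power_mult_distrib algebra_simps)
  also have "\<dots> \<le> 2 * (\<sigma>\<^sup>2 + \<theta>\<^sub>0\<^sup>2) * ((1 + u\<^sup>2) * exp (b2 / 2 * \<bar>u\<bar> powr (1 + \<delta>)))"
    using consts_pos by (intro mult_left_mono) (auto intro!: add_nonneg_nonneg)
  finally show "(\<theta>\<^sub>0 - \<sigma> * u)\<^sup>2 \<le> 2 * (\<sigma>\<^sup>2 + \<theta>\<^sub>0\<^sup>2) * ((1 + u\<^sup>2) * exp (b2 / 2 * \<bar>u\<bar> powr (1 + \<delta>)))" .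
qed auto

text \<open>Chernoff's bound. For |u| <= A L^(1/(1+\<delta>)) the threshold makes the excess
  nonpositive; for larger |u| the product of exp (-(b2/2) A^(1+\<delta>) L) and the weight in
  \<open>exp_moment\<close> is at least 1 and may be inserted.\<close>

lemma scaled_excess:
  assumes \<sigma>: "0 < \<sigma>" and A: "0 \<le> A" and L: "0 \<le> L" and a: "A * \<sigma> * L powr (1 / (1 + \<delta>)) + \<bar>\<theta>\<^sub>0\<bar> \<le> a"
  shows "(\<integral>\<^sup>+x. ennreal (\<bar>x - \<theta>\<^sub>0\<bar> - a) \<partial>scaled \<sigma>)
    \<le> ennreal (\<sigma> * exp (- (b2 / 2 * A powr (1 + \<delta>)) * L) * exp_moment)"
proof (rule nn_integral_scaled_le_exp_moment[OF \<sigma>])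
  fix u
  let ?R = "\<sigma> * exp (- (b2 / 2 * A powr (1 + \<delta>)) * L) * ((1 + u\<^sup>2) * exp (b2 / 2 * \<bar>u\<bar> powr (1 + \<delta>)))"
  show "\<bar>\<sigma> * u - \<theta>\<^sub>0\<bar> - a \<le> ?R"
  proof (cases "\<bar>u\<bar> \<le> A * L powr (1 / (1 + \<delta>))")
    case True
    have "\<bar>\<sigma> * u - \<theta>\<^sub>0\<bar> - a \<le> \<sigma> * \<bar>u\<bar> + \<bar>\<theta>\<^sub>0\<bar> - a"
      using \<sigma> abs_triangle_ineq4[of "\<sigma> * u" \<theta>\<^sub>0] by (simp add: abs_mult)
    also have "\<dots> \<le> 0"
    proof -
      have "\<sigma> * \<bar>u\<bar> \<le> \<sigma> * (A * L powr (1 / (1 + \<delta>)))" using \<sigma> True by (intro mult_left_mono) auto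
      also have "\<dots> = A * \<sigma> * L powr (1 / (1 + \<delta>))" by (simp only: mult_ac)
      finally show ?thesis using a by linarith
    qed
    also have "0 \<le> ?R" using \<sigma> by (intro mult_nonneg_nonneg) (auto simp: add_nonneg_nonneg)
    finally show ?thesis .
  next
    case False
    have "A powr (1 + \<delta>) * L = (A * L powr (1 / (1 + \<delta>))) powr (1 + \<delta>)"
      using A L consts_pos by (simp add: powr_mult powr_powr)
    also have "\<dots> \<le> \<bar>u\<bar> powr (1 + \<delta>)"
      using False A L consts_pos by (intro powr_mono2) auto
    finally have "b2 / 2 * (A powr (1 + \<delta>) * L) \<le> b2 / 2 * \<bar>u\<bar> powr (1 + \<delta>)"
      using consts_pos by (intro mult_left_mono) auto
    then have "1 \<le> exp (- (b2 / 2 * A powr (1 + \<delta>)) * L) * exp (b2 / 2 * \<bar>u\<bar> powr (1 + \<delta>))"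
      by (simp add: exp_add[symmetric] mult.assoc)
    moreover have "\<bar>u\<bar> \<le> 1 + u\<^sup>2"
      using zero_le_power2[of "\<bar>u\<bar> - 1"] by (simp add: power2_eq_square algebra_simps) 
    ultimately have "\<sigma> * (\<bar>u\<bar> * 1) \<le> \<sigma> * ((1 + u\<^sup>2) * (exp (- (b2 / 2 * A powr (1 + \<delta>)) * L) * exp (b2 / 2 * \<bar>u\<bar> powr (1 + \<delta>))))"
      using \<sigma> by (intro mult_left_mono mult_mono) auto
    also have "\<dots> = ?R" by (simp only: mult_ac)
    finally have "\<sigma> * \<bar>u\<bar> \<le> ?R" by simp
    moreover have "\<bar>\<sigma> * u - \<theta>\<^sub>0\<bar> - a \<le> \<sigma> * \<bar>u\<bar> + \<bar>\<theta>\<^sub>0\<bar> - a"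
      using \<sigma> abs_triangle_ineq4[of "\<sigma> * u" \<theta>\<^sub>0] by (simp add: abs_mult)
    moreover have "0 \<le> A * \<sigma> * L powr (1 / (1 + \<delta>))" using A \<sigma> by simp
    ultimately show ?thesis using a by linarith
  qed
qed (use \<sigma> in auto)

end

section \<open>Posterior excess of a single coefficient\<close>

context gaussian_posterior
begin

definition posterior_exp :: "('a \<Rightarrow> real) \<Rightarrow> (('a \<Rightarrow> real) \<Rightarrow> ennreal) \<Rightarrow> ennreal" where
  "posterior_exp \<theta>\<^sub>0 f = (\<integral>\<^sup>+x. (\<integral>\<^sup>+\<theta>. f \<theta> \<partial>K x) \<partial>obs \<theta>\<^sub>0)"

lemma borel_measurable_kernel:
  assumes "x \<in> space (obs \<theta>\<^sub>0)" "f \<in> borel_measurable (PiM I \<pi>)"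
  shows "f \<in> borel_measurable (K x)"
  using assms measurable_cong_sets[OF sets_kernel_eq refl] by (auto simp: space_obs)

lemma borel_measurable_nn_integral_kernel:
  assumes "f \<in> borel_measurable (PiM I \<pi>)"
  shows "(\<lambda>x. \<integral>\<^sup>+\<theta>. f \<theta> \<partial>K x) \<in> borel_measurable (obs \<theta>\<^sub>0)"
  using measurable_compose[OF kernel_subprob nn_integral_measurable_subprob_algebra[OF assms]]
  by (simp add: sets_obs cong: measurable_cong_sets)

text \<open>Valid for arbitrary functions, as a nonnegative integral is a supremum over the simple
  functions below the integrand. This is what lets \<open>sup_dist\<close> be replaced by a
  measurable majorant.\<close>

lemma posterior_exp_mono: "(\<And>\<theta>. f \<theta> \<le> g \<theta>) \<Longrightarrow> posterior_exp \<theta>\<^sub>0 f \<le> posterior_exp \<theta>\<^sub>0 g"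
  unfolding posterior_exp_def by (intro nn_integral_mono)

lemma posterior_exp_suminf:
  assumes "\<And>l::nat. f l \<in> borel_measurable (PiM I \<pi>)"
  shows "posterior_exp \<theta>\<^sub>0 (\<lambda>\<theta>. \<Sum>l. f l \<theta>) = (\<Sum>l. posterior_exp \<theta>\<^sub>0 (f l))"
proof -
  have "posterior_exp \<theta>\<^sub>0 (\<lambda>\<theta>. \<Sum>l. f l \<theta>) = (\<integral>\<^sup>+x. (\<Sum>l. \<integral>\<^sup>+\<theta>. f l \<theta> \<partial>K x) \<partial>obs \<theta>\<^sub>0)"
    unfolding posterior_exp_def
    by (intro nn_integral_cong nn_integral_suminf borel_measurable_kernel[OF _ assms])
  also have "\<dots> = (\<Sum>l. posterior_exp \<theta>\<^sub>0 (f l))"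
    unfolding posterior_exp_def by (intro nn_integral_suminf borel_measurable_nn_integral_kernel assms)
  finally show ?thesis .
qed

lemma posterior_exp_sum:
  assumes "\<And>k. k \<in> S \<Longrightarrow> f k \<in> borel_measurable (PiM I \<pi>)"
  shows "posterior_exp \<theta>\<^sub>0 (\<lambda>\<theta>. \<Sum>k\<in>S. f k \<theta>) = (\<Sum>k\<in>S. posterior_exp \<theta>\<^sub>0 (f k))"
proof -
  have "posterior_exp \<theta>\<^sub>0 (\<lambda>\<theta>. \<Sum>k\<in>S. f k \<theta>) = (\<integral>\<^sup>+x. (\<Sum>k\<in>S. \<integral>\<^sup>+\<theta>. f k \<theta> \<partial>K x) \<partial>obs \<theta>\<^sub>0)"
    unfolding posterior_exp_def
    by (intro nn_integral_cong nn_integral_sum borel_measurable_kernel[OF _ assms])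
  also have "\<dots> = (\<Sum>k\<in>S. posterior_exp \<theta>\<^sub>0 (f k))"
    unfolding posterior_exp_def by (intro nn_integral_sum borel_measurable_nn_integral_kernel assms)
  finally show ?thesis .
qed

lemma posterior_exp_add_const:
  assumes "f \<in> borel_measurable (PiM I \<pi>)"
  shows "posterior_exp \<theta>\<^sub>0 (\<lambda>\<theta>. c + f \<theta>) = c + posterior_exp \<theta>\<^sub>0 f"
proof -
  have "posterior_exp \<theta>\<^sub>0 (\<lambda>\<theta>. c + f \<theta>) = (\<integral>\<^sup>+x. c + (\<integral>\<^sup>+\<theta>. f \<theta> \<partial>K x) \<partial>obs \<theta>\<^sub>0)"
    unfolding posterior_exp_def
    by (intro nn_integral_cong, subst nn_integral_add)
      (auto intro: borel_measurable_kernel[OF _ assms] simp: space_obs prob_space.emeasure_space_1[OF prob_space_kernel])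
  also have "\<dots> = c + posterior_exp \<theta>\<^sub>0 f"
    unfolding posterior_exp_def
    by (subst nn_integral_add)
      (auto intro: borel_measurable_nn_integral_kernel[OF assms] simp: prob_space.emeasure_space_1[OF prob_space_obs])
  finally show ?thesis .
qed

lemma posterior_exp_cmult:
  assumes "f \<in> borel_measurable (PiM I \<pi>)"
  shows "posterior_exp \<theta>\<^sub>0 (\<lambda>\<theta>. c * f \<theta>) = c * posterior_exp \<theta>\<^sub>0 f"
proof -
  have "posterior_exp \<theta>\<^sub>0 (\<lambda>\<theta>. c * f \<theta>) = (\<integral>\<^sup>+x. c * (\<integral>\<^sup>+\<theta>. f \<theta> \<partial>K x) \<partial>obs \<theta>\<^sub>0)"
    unfolding posterior_exp_def
    by (intro nn_integral_cong nn_integral_cmult borel_measurable_kernel[OF _ assms])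
  also have "\<dots> = c * posterior_exp \<theta>\<^sub>0 f"
    unfolding posterior_exp_def by (intro nn_integral_cmult borel_measurable_nn_integral_kernel assms)
  finally show ?thesis .
qed

text \<open>The bound for high levels: the data are ignored (weight 1), and the factor 1 / c has to
  be paid by the tails of the prior.\<close>

lemma posterior_excess_le_prior_excess:
  assumes ac: "absolutely_continuous marginal (obs \<theta>\<^sub>0)" and i: "i \<in> I"
    and c: "0 < c" "\<And>y. ennreal (c * normal_density (\<theta>\<^sub>0 i) s y) \<le> marginal_density i y"
  shows "posterior_exp \<theta>\<^sub>0 (\<lambda>\<theta>. ennreal (\<bar>\<theta> i - \<theta>\<^sub>0 i\<bar> - a))
    \<le> ennreal (1/c) * (\<integral>\<^sup>+\<theta>. ennreal (\<bar>\<theta> - \<theta>\<^sub>0 i\<bar> - a) \<partial>\<pi> i)"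
  using nn_integral_posterior_component_le[OF ac i _ _ c, of "\<lambda>_. 1" "\<lambda>\<theta>. ennreal (\<bar>\<theta> - \<theta>\<^sub>0 i\<bar> - a)"]
  by (simp add: posterior_exp_def nn_integral_normal_density[OF s_pos])

text \<open>If the observation is within \<open>a/2\<close> of \<open>\<theta>\<^sub>0\<close>, then parameters at distance more than \<open>a\<close> from
  \<open>\<theta>\<^sub>0\<close> have exponentially small likelihood; otherwise the excess \<open>w\<close> is split by
  \<open>w \<le> \<eta> w\<^sup>2 + 1/\<eta>\<close>.\<close>

lemma posterior_excess_le_tails:
  assumes ac: "absolutely_continuous marginal (obs \<theta>\<^sub>0)" and i: "i \<in> I"
    and c: "0 < c" "\<And>y. ennreal (c * normal_density (\<theta>\<^sub>0 i) s y) \<le> marginal_density i y"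
    and a: "0 \<le> a" and \<eta>: "0 < \<eta>"
    and m: "0 \<le> m" "(\<integral>\<^sup>+\<theta>. ennreal ((\<theta>\<^sub>0 i - \<theta>)\<^sup>2) \<partial>\<pi> i) \<le> ennreal m"
  defines "T \<equiv> sqrt 2 * exp (- (a/2)\<^sup>2 / (4 * s\<^sup>2))"
  shows "posterior_exp \<theta>\<^sub>0 (\<lambda>\<theta>. ennreal (\<bar>\<theta> i - \<theta>\<^sub>0 i\<bar> - a)) \<le> ennreal ((T * (1 + m) + \<eta> * m) / c + T / \<eta>)"
proof -
  define w where "w \<theta> = ennreal (\<bar>\<theta> - \<theta>\<^sub>0 i\<bar> - a)" for \<theta>
  have w[measurable]: "w \<in> borel_measurable borel" unfolding w_def by measurable
  define u1 u2 :: "real \<Rightarrow> ennreal" where "u1 = indicator {x. \<bar>x - \<theta>\<^sub>0 i\<bar> < a/2}"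
    and "u2 = indicator {x. a/2 \<le> \<bar>x - \<theta>\<^sub>0 i\<bar>}"
  have u1[measurable]: "u1 \<in> borel_measurable borel" unfolding u1_def by measurable
  have u2[measurable]: "u2 \<in> borel_measurable borel" unfolding u2_def by measurable
  have T: "0 \<le> T" by (simp add: T_def)
  have wi: "(\<lambda>\<theta>. w (\<theta> i)) \<in> borel_measurable (PiM I \<pi>)"
    by (rule measurable_compose[OF component_borel_measurable[OF i] w])
  have wi2: "(\<lambda>\<theta>. (w (\<theta> i))\<^sup>2) \<in> borel_measurable (PiM I \<pi>)"
    using wi by measurable
  have sp: "(\<integral>\<^sup>+\<theta>. w (\<theta> i) \<partial>K x) \<le>
      u1 (x i) * (\<integral>\<^sup>+\<theta>. w (\<theta> i) \<partial>K x) + (ennreal \<eta> * (1 * (\<integral>\<^sup>+\<theta>. (w (\<theta> i))\<^sup>2 \<partial>K x)) + ennreal (1/\<eta>) * u2 (x i))"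
    if x: "x \<in> space (obs \<theta>\<^sub>0)" for x
  proof (cases "\<bar>x i - \<theta>\<^sub>0 i\<bar> < a/2")
    case True
    then show ?thesis by (simp add: u1_def)
  next
    case False
    have "(\<integral>\<^sup>+\<theta>. w (\<theta> i) \<partial>K x) \<le> (\<integral>\<^sup>+\<theta>. ennreal \<eta> * (w (\<theta> i))\<^sup>2 + ennreal (1/\<eta>) \<partial>K x)"
      by (intro nn_integral_mono ennreal_le_square_plus \<eta>)
    also have "\<dots> = ennreal \<eta> * (\<integral>\<^sup>+\<theta>. (w (\<theta> i))\<^sup>2 \<partial>K x) + ennreal (1/\<eta>)"
      using borel_measurable_kernel[OF x wi2] prob_space.emeasure_space_1[OF prob_space_kernel, of x] x
      by (simp add: nn_integral_add nn_integral_cmult space_obs)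
    finally show ?thesis using False by (simp add: u1_def u2_def)
  qed
  have mu: "(\<lambda>x. u (x i)) \<in> borel_measurable (obs \<theta>\<^sub>0)" if "u \<in> borel_measurable borel" for u :: "real \<Rightarrow> ennreal"
  proof -
    have "(\<lambda>x. x i) \<in> borel_measurable (PiM I (\<lambda>_. borel :: real measure))" using i by measurable
    from measurable_compose[OF this that] show ?thesis by (simp add: sets_obs cong: measurable_cong_sets)
  qed
  note m1[measurable] = borel_measurable_nn_integral_kernel[OF wi, of \<theta>\<^sub>0]
    borel_measurable_nn_integral_kernel[OF wi2, of \<theta>\<^sub>0] mu[OF u1] mu[OF u2]
  have "posterior_exp \<theta>\<^sub>0 (\<lambda>\<theta>. ennreal (\<bar>\<theta> i - \<theta>\<^sub>0 i\<bar> - a)) = (\<integral>\<^sup>+x. (\<integral>\<^sup>+\<theta>. w (\<theta> i) \<partial>K x) \<partial>obs \<theta>\<^sub>0)"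
    unfolding posterior_exp_def w_def ..
  also have "\<dots> \<le> (\<integral>\<^sup>+x. u1 (x i) * (\<integral>\<^sup>+\<theta>. w (\<theta> i) \<partial>K x)
      + (ennreal \<eta> * (1 * (\<integral>\<^sup>+\<theta>. (w (\<theta> i))\<^sup>2 \<partial>K x)) + ennreal (1/\<eta>) * u2 (x i)) \<partial>obs \<theta>\<^sub>0)"
    by (intro nn_integral_mono sp)
  also have "\<dots> = (\<integral>\<^sup>+x. u1 (x i) * (\<integral>\<^sup>+\<theta>. w (\<theta> i) \<partial>K x) \<partial>obs \<theta>\<^sub>0)
      + (ennreal \<eta> * (\<integral>\<^sup>+x. 1 * (\<integral>\<^sup>+\<theta>. (w (\<theta> i))\<^sup>2 \<partial>K x) \<partial>obs \<theta>\<^sub>0) + ennreal (1/\<eta>) * (\<integral>\<^sup>+x. u2 (x i) \<partial>obs \<theta>\<^sub>0))"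
    by (simp add: nn_integral_add nn_integral_cmult)
  \<comment> \<open>The first term gains the small likelihood factor \<open>T\<close>. The second
    has 1 / c with no gain, so \<open>\<eta>\<close> must be chosen small; the third pays 1 / \<eta>
    for this, but carries \<open>T\<close> as the probability of an atypical observation.\<close>
  also have "\<dots> \<le> ennreal (1/c) * ennreal (T * (1 + m))
      + (ennreal \<eta> * (ennreal (1/c) * ennreal m) + ennreal (1/\<eta>) * ennreal T)"
  proof (intro add_mono mult_left_mono)
    have "(\<integral>\<^sup>+x. u1 (x i) * (\<integral>\<^sup>+\<theta>. w (\<theta> i) \<partial>K x) \<partial>obs \<theta>\<^sub>0)
        \<le> ennreal (1/c) * (\<integral>\<^sup>+\<theta>. w \<theta> * (\<integral>\<^sup>+y. u1 y * normal_density \<theta> s y \<partial>lborel) \<partial>\<pi> i)"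
      by (rule nn_integral_posterior_component_le[OF ac i u1 w c])
    also have "(\<integral>\<^sup>+\<theta>. w \<theta> * (\<integral>\<^sup>+y. u1 y * normal_density \<theta> s y \<partial>lborel) \<partial>\<pi> i)
        \<le> (\<integral>\<^sup>+\<theta>. ennreal T * (1 + ennreal ((\<theta>\<^sub>0 i - \<theta>)\<^sup>2)) \<partial>\<pi> i)"
    proof (intro nn_integral_mono)
      fix \<theta>
      show "w \<theta> * (\<integral>\<^sup>+y. u1 y * normal_density \<theta> s y \<partial>lborel) \<le> ennreal T * (1 + ennreal ((\<theta>\<^sub>0 i - \<theta>)\<^sup>2))"
      proof (cases "\<bar>\<theta> - \<theta>\<^sub>0 i\<bar> \<le> a")
        case True
        then show ?thesis by (simp add: w_def ennreal_neg)
      next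
        case False
        have "(\<integral>\<^sup>+y. u1 y * normal_density \<theta> s y \<partial>lborel)
            \<le> (\<integral>\<^sup>+y. indicator {y. a/2 \<le> \<bar>y - \<theta>\<bar>} y * ennreal (normal_density \<theta> s y) \<partial>lborel)"
        proof (intro nn_integral_mono mult_right_mono)
          fix y
          have "a/2 \<le> \<bar>y - \<theta>\<bar>" if "\<bar>y - \<theta>\<^sub>0 i\<bar> < a/2" using that False by linarith
          then show "u1 y \<le> indicator {y. a/2 \<le> \<bar>y - \<theta>\<bar>} y" by (auto simp: u1_def indicator_def)
        qed simp
        also have "\<dots> \<le> ennreal T"
          unfolding T_def using a by (intro normal_density_tail s_pos) auto
        finally have 1: "(\<integral>\<^sup>+y. u1 y * normal_density \<theta> s y \<partial>lborel) \<le> ennreal T" .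
        have "\<bar>\<theta> - \<theta>\<^sub>0 i\<bar> - a \<le> 1 + (\<theta>\<^sub>0 i - \<theta>)\<^sup>2"
        proof -
          have "\<bar>\<theta> - \<theta>\<^sub>0 i\<bar> \<le> 1 + \<bar>\<theta> - \<theta>\<^sub>0 i\<bar>\<^sup>2"
          proof -
            have "z \<le> 1 + z\<^sup>2" if "0 \<le> z" for z :: real
              using zero_le_power2[of "z - 1"] that unfolding power2_diff by simp
            from this[OF abs_ge_zero] show ?thesis .
          qed
          then show ?thesis using a by (simp add: power2_commute)
        qed
        then have "w \<theta> \<le> 1 + ennreal ((\<theta>\<^sub>0 i - \<theta>)\<^sup>2)"
          unfolding w_def by (metis ennreal_1 ennreal_leI ennreal_plus zero_le_one zero_le_power2)
        from mult_mono[OF this 1] show ?thesis by (simp add: mult.commute)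
      qed
    qed
    also have "\<dots> = ennreal T * (1 + (\<integral>\<^sup>+\<theta>. ennreal ((\<theta>\<^sub>0 i - \<theta>)\<^sup>2) \<partial>\<pi> i))"
      by (simp add: nn_integral_cmult nn_integral_add prior.M.emeasure_space_1)
    also have "\<dots> \<le> ennreal T * (1 + ennreal m)"
      by (intro mult_left_mono add_left_mono m) auto
    also have "\<dots> = ennreal (T * (1 + m))"
      using T m(1) by (simp add: ennreal_mult)
    finally show "(\<integral>\<^sup>+x. u1 (x i) * (\<integral>\<^sup>+\<theta>. w (\<theta> i) \<partial>K x) \<partial>obs \<theta>\<^sub>0) \<le> ennreal (1/c) * ennreal (T * (1 + m))"
      by (simp add: mult_left_mono)
  next
    have "(\<integral>\<^sup>+x. 1 * (\<integral>\<^sup>+\<theta>. (w (\<theta> i))\<^sup>2 \<partial>K x) \<partial>obs \<theta>\<^sub>0)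
        \<le> ennreal (1/c) * (\<integral>\<^sup>+\<theta>. (w \<theta>)\<^sup>2 * (\<integral>\<^sup>+y. 1 * ennreal (normal_density \<theta> s y) \<partial>lborel) \<partial>\<pi> i)"
      by (rule nn_integral_posterior_component_le[OF ac i _ _ c]) auto
    also have "(\<integral>\<^sup>+\<theta>. (w \<theta>)\<^sup>2 * (\<integral>\<^sup>+y. 1 * ennreal (normal_density \<theta> s y) \<partial>lborel) \<partial>\<pi> i) = (\<integral>\<^sup>+\<theta>. (w \<theta>)\<^sup>2 \<partial>\<pi> i)"
      by (simp add: nn_integral_normal_density[OF s_pos])
    also have "\<dots> \<le> (\<integral>\<^sup>+\<theta>. ennreal ((\<theta>\<^sub>0 i - \<theta>)\<^sup>2) \<partial>\<pi> i)"
    proof (intro nn_integral_mono)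
      fix \<theta>
      show "(w \<theta>)\<^sup>2 \<le> ennreal ((\<theta>\<^sub>0 i - \<theta>)\<^sup>2)"
      proof (cases "\<bar>\<theta> - \<theta>\<^sub>0 i\<bar> \<le> a")
        case True
        then show ?thesis by (simp add: w_def ennreal_neg)
      next
        case False
        then have "(\<bar>\<theta> - \<theta>\<^sub>0 i\<bar> - a)\<^sup>2 \<le> \<bar>\<theta> - \<theta>\<^sub>0 i\<bar>\<^sup>2" using a by (intro power_mono) auto
        then show ?thesis using False by (simp add: w_def ennreal_power ennreal_leI power2_commute)
      qed
    qed
    also note m(2)
    finally show "(\<integral>\<^sup>+x. 1 * (\<integral>\<^sup>+\<theta>. (w (\<theta> i))\<^sup>2 \<partial>K x) \<partial>obs \<theta>\<^sub>0) \<le> ennreal (1/c) * ennreal m"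
      by (simp add: mult_left_mono)
  next
    have "(\<integral>\<^sup>+x. u2 (x i) \<partial>obs \<theta>\<^sub>0) = (\<integral>\<^sup>+y. u2 y * normal_density (\<theta>\<^sub>0 i) s y \<partial>lborel)"
      by (rule nn_integral_obs_component[OF i u2])
    also have "\<dots> \<le> ennreal T"
      unfolding u2_def T_def using a by (intro normal_density_tail s_pos) auto
    finally show "(\<integral>\<^sup>+x. u2 (x i) \<partial>obs \<theta>\<^sub>0) \<le> ennreal T" .
  qed auto
  also have "\<dots> = ennreal ((T * (1 + m) + \<eta> * m) / c + T / \<eta>)"
  proof -
    have nn: "0 \<le> 1/c" "0 \<le> T * (1 + m)" "0 \<le> \<eta>" "0 \<le> 1/\<eta>" using c(1) T m(1) \<eta> by auto
    have "(T * (1 + m) + \<eta> * m) / c + T / \<eta> = 1/c * (T * (1 + m)) + (\<eta> * (1/c * m) + 1/\<eta> * T)"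
      by (simp add: add_divide_distrib)
    then show ?thesis using nn T m(1)
      by (simp only: ennreal_mult ennreal_plus mult_nonneg_nonneg add_nonneg_nonneg)
  qed
  finally show ?thesis .
qed

end

section \<open>Levels and rates\<close>

lemma sum_geometric_le:
  fixes \<rho> :: real assumes "0 \<le> \<rho>" "\<rho> < 1"
  shows "(\<Sum>l<n. \<rho> ^ l) \<le> 1 / (1 - \<rho>)"
  using sum_le_suminf[OF summable_geometric, of \<rho> "{..<n}"] suminf_geometric[of \<rho>] assms by simp

text \<open>Up to the cut-off N, the integer part of log2 y, the terms grow like 2^(l/2); beyond it
  they decay like 2^(-\<alpha> l); at the cut-off both are of order y^(-\<alpha>). Moving away from
  it in either direction, the terms fall at least as fast as the powers of 2^(-min (1/2) \<alpha>),
  so two geometric series bound the sum.\<close>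

lemma suminf_level_rates:
  assumes \<alpha>: "0 < \<alpha>"
  shows "\<exists>S>0. \<forall>y\<ge>1. (\<Sum>l. ennreal (2 powr (real l / 2) *
      (if 2 ^ l \<le> y then y powr (- (\<alpha> + 1/2)) else 2 powr (- (real l * (1/2 + \<alpha>))))))
    \<le> ennreal (S * y powr (- \<alpha>))"
proof -
  define \<beta> where "\<beta> = min (1/2) \<alpha>"
  have \<beta>: "0 < \<beta>" "\<beta> \<le> 1/2" "\<beta> \<le> \<alpha>" using \<alpha> by (auto simp: \<beta>_def)
  define \<rho> where "\<rho> = 2 powr (- \<beta>)"
  have \<rho>: "0 < \<rho>" "\<rho> < 1" using \<beta> powr_less_mono[of "- \<beta>" 0 2] by (auto simp: \<rho>_def)
  have \<rho>_pow: "\<rho> ^ j = 2 powr (- \<beta> * real j)" for j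
    unfolding \<rho>_def by (subst powr_powr[symmetric], subst powr_realpow) auto
  have "(\<Sum>l. ennreal (2 powr (real l / 2) *
      (if 2 ^ l \<le> y then y powr (- (\<alpha> + 1/2)) else 2 powr (- (real l * (1/2 + \<alpha>))))))
    \<le> ennreal (2 / (1 - \<rho>) * y powr (- \<alpha>))" if y: "1 \<le> y" for y
  proof -
    define t where "t = log 2 y"
    have t: "0 \<le> t" "y = 2 powr t" using y by (auto simp: t_def)
    define N where "N = nat \<lfloor>t\<rfloor>"
    have N: "real N \<le> t" "t < real N + 1" using t(1) by (auto simp: N_def)
    \<comment> \<open>Beyond the cut-off the exponent counts from \<open>Suc N\<close>, since
      \<open>t\<close> may be anywhere below N + 1 and only the distance to N + 1 is a safe lower
      bound for \<open>real l - t\<close>.\<close>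
    define v where "v l = (if l \<le> N then \<rho> ^ (N - l) else \<rho> ^ (l - Suc N))" for l
    let ?f = "\<lambda>l. 2 powr (real l / 2) * (if 2 ^ l \<le> y then y powr (- (\<alpha> + 1/2)) else 2 powr (- (real l * (1/2 + \<alpha>))))"
    have small: "2 ^ l \<le> y \<longleftrightarrow> l \<le> N" for l
    proof -
      have "2 ^ l \<le> y \<longleftrightarrow> (2::real) powr real l \<le> 2 powr t" unfolding t(2) by (simp add: powr_realpow)
      also have "\<dots> \<longleftrightarrow> real l \<le> t" by simp
      also have "\<dots> \<longleftrightarrow> l \<le> N" using N by linarith
      finally show ?thesis .
    qed
    have f_le: "?f l \<le> v l * y powr (- \<alpha>)" for l
    proof (cases "l \<le> N")
      case True
      have "?f l = 2 powr (real l / 2 + t * (- (\<alpha> + 1/2)))"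
      proof -
        have "?f l = 2 powr (real l / 2) * y powr (- (\<alpha> + 1/2))" using True small[of l] by simp
        then show ?thesis by (simp only: t(2) powr_powr powr_add)
      qed
      also have "real l / 2 + t * (- (\<alpha> + 1/2)) = - (1/2) * (t - real l) + t * (- \<alpha>)"
        by (simp add: field_simps)
      also have "2 powr \<dots> \<le> 2 powr (- \<beta> * real (N - l) + t * (- \<alpha>))"
      proof (intro powr_mono add_right_mono)
        have "\<beta> * real (N - l) \<le> 1/2 * (t - real l)"
          using \<beta> N True by (intro mult_mono) auto
        then show "- (1/2) * (t - real l) \<le> - \<beta> * real (N - l)" by simp
      qed auto
      also have "\<dots> = v l * y powr (- \<alpha>)"
        using True by (simp only: v_def \<rho>_pow t(2) powr_add powr_powr if_True)
      finally show ?thesis .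
    next
      case False
      have "?f l = 2 powr (real l / 2 + - (real l * (1/2 + \<alpha>)))"
      proof -
        have "?f l = 2 powr (real l / 2) * 2 powr (- (real l * (1/2 + \<alpha>)))" using False small[of l] by simp
        then show ?thesis by (simp only: powr_add)
      qed
      also have "real l / 2 + - (real l * (1/2 + \<alpha>)) = - \<alpha> * (real l - t) + t * (- \<alpha>)"
        by (simp add: algebra_simps)
      also have "2 powr \<dots> \<le> 2 powr (- \<beta> * real (l - Suc N) + t * (- \<alpha>))"
      proof (intro powr_mono add_right_mono)
        have "\<beta> * real (l - Suc N) \<le> \<alpha> * (real l - t)"
          using \<beta> N False by (intro mult_mono) auto
        then show "- \<alpha> * (real l - t) \<le> - \<beta> * real (l - Suc N)" by simp
      qed auto
      also have "\<dots> = v l * y powr (- \<alpha>)"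
        using False by (simp only: v_def \<rho>_pow t(2) powr_add powr_powr if_False)
      finally show ?thesis .
    qed
    have v0: "0 \<le> v l" for l using \<rho> by (simp add: v_def)
    have vsum: "(\<Sum>l<n. v l) \<le> 2 / (1 - \<rho>)" for n
    proof -
      \<comment> \<open>The longer range adds nonnegative terms only and splits exactly at the
        cut-off, whether or not n exceeds N.\<close>
      have "(\<Sum>l<n. v l) \<le> (\<Sum>l<Suc N + n. v l)" using v0 by (intro sum_mono2) auto
      also have "\<dots> = (\<Sum>l<Suc N. v l) + (\<Sum>l<n. v (Suc N + l))"
        by (induction n) simp_all
      also have "(\<Sum>l<n. v (Suc N + l)) = (\<Sum>l<n. \<rho> ^ l)" by (simp add: v_def)
      also have "(\<Sum>l<Suc N. v l) = (\<Sum>l<Suc N. \<rho> ^ (Suc N - Suc l))"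
        by (intro sum.cong) (auto simp: v_def)
      also have "\<dots> = (\<Sum>l<Suc N. \<rho> ^ l)" by (rule sum.nat_diff_reindex)
      also have "(\<Sum>l<Suc N. \<rho> ^ l) + (\<Sum>l<n. \<rho> ^ l) \<le> 1 / (1 - \<rho>) + 1 / (1 - \<rho>)"
        using \<rho> by (intro add_mono sum_geometric_le) auto
      finally show ?thesis by simp
    qed
    show ?thesis
    proof (rule suminf_le_const)
      show "summable (\<lambda>l. ennreal (?f l))" by (rule summableI)
      fix n
      have "(\<Sum>l<n. ennreal (?f l)) = ennreal (\<Sum>l<n. ?f l)"
        by (rule sum_ennreal) auto
      also have "(\<Sum>l<n. ?f l) \<le> (\<Sum>l<n. v l) * y powr (- \<alpha>)"
        unfolding sum_distrib_right by (intro sum_mono f_le)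
      also have "\<dots> \<le> 2 / (1 - \<rho>) * y powr (- \<alpha>)"
        by (intro mult_right_mono vsum) auto
      finally show "(\<Sum>l<n. ennreal (?f l)) \<le> ennreal (2 / (1 - \<rho>) * y powr (- \<alpha>))"
        by (simp add: ennreal_leI)
    qed
  qed
  moreover have "2 / (1 - \<rho>) > 0" using \<rho> by simp
  ultimately show ?thesis by blast
qed

lemma two_power_le_exp: "(2::real) ^ l \<le> exp (real l)"
proof -
  have "(2::real) ^ l \<le> exp 1 ^ l" using exp_ge_add_one_self[of 1] by (intro power_mono) auto
  then show ?thesis by (simp add: exp_of_nat_mult[symmetric])
qed

lemma ln_ge_half: "2 \<le> n \<Longrightarrow> 1/2 \<le> ln (real n)"
proof -
  assume n: "2 \<le> n"
  have "1/2 \<le> ln (2::real)" using ln_le_minus_one[of "1/2::real"] by (simp add: ln_div)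
  also have "\<dots> \<le> ln (real n)" using n by simp
  finally show ?thesis .
qed

text \<open>With t the fourth root of x: 4 ln t <= 4 (t - 1) <= t^2. It serves to bound sqrt n by n
  / ln n.\<close>

lemma ln_le_sqrt: "0 < x \<Longrightarrow> ln x \<le> sqrt x"
proof -
  assume x: "0 < x"
  define t where "t = sqrt (sqrt x)"
  have t2: "sqrt x = t\<^sup>2" using x by (simp add: t_def)
  have "x = (sqrt x)\<^sup>2" using x by simp
  also have "\<dots> = t ^ 4" unfolding t2 by simp
  finally have t4: "x = t ^ 4" .
  have t: "0 < t" using x by (simp add: t_def)
  have "ln x = 4 * ln t" unfolding t4 using t by (simp add: ln_realpow)
  also have "\<dots> \<le> 4 * (t - 1)" using ln_le_minus_one[OF t] by simp
  also have "\<dots> \<le> t\<^sup>2" using zero_le_power2[of "t - 2"] by (simp add: power2_eq_square algebra_simps)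
  finally show ?thesis unfolding t2 .
qed

text \<open>The frequency 2^l at which the noise level sqrt (ln n / n) meets the coefficient bound
  2^(-l (1/2 + \<alpha>)) of the Besov ball; see the second identity of
  \<open>resolution_powr\<close>.\<close>

definition resolution :: "real \<Rightarrow> nat \<Rightarrow> real" where
  "resolution \<alpha> n = (real n / ln (real n)) powr (1 / (2 * \<alpha> + 1))"

lemma resolution_ge_1: "0 < \<alpha> \<Longrightarrow> 2 \<le> n \<Longrightarrow> 1 \<le> resolution \<alpha> n"
proof -
  assume a: "0 < \<alpha>" and n: "2 \<le> n"
  have "ln (real n) \<le> real n - 1" using n by (intro ln_le_minus_one) auto
  then have "1 \<le> real n / ln (real n)" using ln_ge_half[OF n] by (simp add: le_divide_eq)
  then show ?thesis unfolding resolution_def using a by (intro ge_one_powr_ge_zero) auto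
qed

lemma resolution_powr:
  assumes "0 < \<alpha>" "2 \<le> n"
  shows "resolution \<alpha> n powr (- \<alpha>) = (ln (real n) / real n) powr (\<alpha> / (2 * \<alpha> + 1))"
    and "resolution \<alpha> n powr (- (\<alpha> + 1/2)) = sqrt (ln (real n) / real n)"
    and "resolution \<alpha> n powr (2 * \<alpha> + 1) = real n / ln (real n)"
proof -
  have q: "0 < real n / ln (real n)" using ln_ge_half[OF assms(2)] assms(2) by simp
  have inv: "(real n / ln (real n)) powr (- x) = (ln (real n) / real n) powr x" for x
  proof -
    have "ln (real n) / real n = inverse (real n / ln (real n))" by simp
    then show ?thesis using q by (simp only: powr_minus inverse_powr)
  qed
  have "resolution \<alpha> n powr (- \<alpha>) = (real n / ln (real n)) powr (- (\<alpha> / (2 * \<alpha> + 1)))"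
    unfolding resolution_def powr_powr by (simp add: field_simps)
  then show "resolution \<alpha> n powr (- \<alpha>) = (ln (real n) / real n) powr (\<alpha> / (2 * \<alpha> + 1))"
    by (simp only: inv)
  have "resolution \<alpha> n powr (- (\<alpha> + 1/2)) = (real n / ln (real n)) powr (- (1/2))"
  proof -
    have "1 / (2 * \<alpha> + 1) * (- (\<alpha> + 1/2)) = - (1/2)" using assms(1) by (simp add: field_simps)
    then show ?thesis unfolding resolution_def powr_powr by simp
  qed
  then show "resolution \<alpha> n powr (- (\<alpha> + 1/2)) = sqrt (ln (real n) / real n)"
    using q ln_ge_half[OF assms(2)] by (simp only: inv) (simp add: powr_half_sqrt)
  show "resolution \<alpha> n powr (2 * \<alpha> + 1) = real n / ln (real n)"
    unfolding resolution_def powr_powr using assms(1) q ln_ge_half[OF assms(2)] by simp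
qed

text \<open>From 2^l <= n^2 and ln 2 >= 1/2 follows l <= 4 ln n, and 1 <= 2 ln n accounts for the
  rest of the 6. Thus exp (C (l + 1)) is at most a power of n on these levels.\<close>

lemma small_level_le:
  assumes "0 < \<alpha>" "2 \<le> n" "2 ^ l \<le> resolution \<alpha> n"
  shows "real (l + 1) \<le> 6 * ln (real n)"
proof -
  note h = ln_ge_half[OF assms(2)]
  have "(2::real) ^ l \<le> resolution \<alpha> n powr 1" using assms resolution_ge_1[of \<alpha> n] by simp
  also have "\<dots> \<le> resolution \<alpha> n powr (2 * \<alpha> + 1)"
    using assms resolution_ge_1[of \<alpha> n] by (intro powr_mono) auto
  also have "\<dots> = real n / ln (real n)" using assms by (simp add: resolution_powr)
  also have "\<dots> \<le> real n / (1/2)" using h assms by (intro divide_left_mono) auto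
  also have "\<dots> \<le> real n * real n" using assms by simp
  finally have "ln ((2::real) ^ l) \<le> ln (real n * real n)" using assms by simp
  then have "real l * ln 2 \<le> 2 * ln (real n)" using assms by (simp add: ln_mult ln_realpow)
  moreover have "1/2 \<le> ln (2::real)" using ln_ge_half[of 2] by simp
  then have "real l * (1/2) \<le> real l * ln 2" by (intro mult_left_mono) auto
  ultimately show ?thesis using h by simp
qed

text \<open>The chain sqrt n <= n / ln n = (resolution)^(2\<alpha>+1) <= 2^(l (2\<alpha>+1)). It
  converts the factor sqrt n in 1 / c into one that the prior tails can absorb.\<close>

lemma large_level_sqrt_le:
  assumes "0 < \<alpha>" "2 \<le> n" "\<not> 2 ^ l \<le> resolution \<alpha> n"
  shows "sqrt (real n) \<le> exp ((1 + 2 * \<alpha>) * real (l + 1))"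
proof -
  have n: "0 < real n" "0 < ln (real n)" using ln_ge_half[OF assms(2)] assms(2) by auto
  have "sqrt (real n) * ln (real n) \<le> sqrt (real n) * sqrt (real n)"
    using n by (intro mult_left_mono ln_le_sqrt) auto
  then have "sqrt (real n) \<le> real n / ln (real n)" using n by (simp add: le_divide_eq)
  also have "\<dots> = resolution \<alpha> n powr (2 * \<alpha> + 1)" using assms by (simp add: resolution_powr)
  also have "\<dots> \<le> exp (real l) powr (2 * \<alpha> + 1)"
    using assms resolution_ge_1[of \<alpha> n] two_power_le_exp[of l] by (intro powr_mono2) auto
  also have "\<dots> = exp ((1 + 2 * \<alpha>) * real l)" by (simp add: powr_def algebra_simps)
  also have "\<dots> \<le> exp ((1 + 2 * \<alpha>) * real (l + 1))" using assms by (simp add: mult_left_mono)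
  finally show ?thesis .
qed

lemma finite_wav_index_subset:
  assumes "finite J" "J \<subseteq> wav_index"
  shows "\<exists>N. J \<subseteq> Sigma {..<N} (\<lambda>l. {..<(2::nat) ^ l})"
proof -
  obtain N where "\<forall>l\<in>fst ` J. l < N"
    using assms(1) finite_nat_set_iff_bounded[of "fst ` J"] by auto
  then have "J \<subseteq> Sigma {..<N} (\<lambda>l. {..<(2::nat) ^ l})"
    using assms(2) by (force simp: wav_index_def)
  then show ?thesis ..
qed

section \<open>Truth in a Besov ball, prior scaled level by level\<close>

locale besov_model = exp_power_density +
  fixes \<alpha> B :: real and \<theta>\<^sub>0 :: "nat \<times> nat \<Rightarrow> real"
  assumes \<alpha>: "0 < \<alpha>" and B: "0 \<le> B"
    and coeff_le: "\<And>l k. k < 2 ^ l \<Longrightarrow> \<bar>\<theta>\<^sub>0 (l, k)\<bar> \<le> B * 2 powr (- (real l * (1 / 2 + \<alpha>)))"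
begin

definition level_scale :: "nat \<Rightarrow> real" where
  "level_scale l = 2 powr (- (real l * (1 / 2 + \<alpha>)))"

definition \<sigma> :: "nat \<Rightarrow> real" where
  "\<sigma> l = 2 powr (- real l * (1 / 2 + \<alpha>)) / real (l + 1) powr (1 / (1 + \<delta>))"

definition coord_prior :: "nat \<times> nat \<Rightarrow> real measure" where
  "coord_prior = (\<lambda>(l, k). scaled (\<sigma> l))"

lemma level_scale: "0 < level_scale l" "level_scale l \<le> 1"
proof -
  have "level_scale l \<le> 2 powr 0" unfolding level_scale_def using \<alpha> by (intro powr_mono) auto
  then show "level_scale l \<le> 1" by simp
qed (simp add: level_scale_def)

lemma \<sigma>_mult: "\<sigma> l * real (l + 1) powr (1 / (1 + \<delta>)) = level_scale l"
  by (simp add: \<sigma>_def level_scale_def)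

lemma \<sigma>: "0 < \<sigma> l" "\<sigma> l \<le> level_scale l"
proof -
  show s: "0 < \<sigma> l" by (simp add: \<sigma>_def)
  have "1 \<le> real (l + 1) powr (1 / (1 + \<delta>))" using consts_pos by (intro ge_one_powr_ge_zero) auto
  then show "\<sigma> l \<le> level_scale l" using mult_left_mono[of 1 _ "\<sigma> l"] s unfolding \<sigma>_mult[symmetric] by simp
qed

lemma \<theta>\<^sub>0_le: "k < 2 ^ l \<Longrightarrow> \<bar>\<theta>\<^sub>0 (l, k)\<bar> \<le> B * level_scale l"
  using coeff_le by (simp add: level_scale_def)

lemma two_power_level_scale_square: "2 ^ l * (level_scale l)\<^sup>2 = (2 powr (- (2 * \<alpha>))) ^ l"
proof -
  have "2 ^ l * (level_scale l)\<^sup>2 = 2 powr real l * (2 powr (- (real l * (1 / 2 + \<alpha>))) * 2 powr (- (real l * (1 / 2 + \<alpha>))))"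
    by (simp add: level_scale_def powr_realpow power2_eq_square)
  also have "\<dots> = 2 powr (real l + (- (real l * (1 / 2 + \<alpha>)) + - (real l * (1 / 2 + \<alpha>))))"
    by (simp only: powr_add)
  also have "real l + (- (real l * (1 / 2 + \<alpha>)) + - (real l * (1 / 2 + \<alpha>))) = (- (2 * \<alpha>)) * real l"
    by (simp add: algebra_simps)
  also have "2 powr \<dots> = (2 powr (- (2 * \<alpha>))) ^ l"
    by (subst powr_powr[symmetric], subst powr_realpow) auto
  finally show ?thesis .
qed

lemma second_moment_le:
  assumes "k < 2 ^ l"
  shows "(\<integral>\<^sup>+\<theta>. ennreal ((\<theta>\<^sub>0 (l, k) - \<theta>)\<^sup>2) \<partial>coord_prior (l, k))
    \<le> ennreal (2 * (1 + B\<^sup>2) * exp_moment * (level_scale l)\<^sup>2)"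
proof -
  have "(\<sigma> l)\<^sup>2 \<le> (level_scale l)\<^sup>2" using \<sigma>[of l] by (intro power_mono) auto
  moreover have "\<bar>\<theta>\<^sub>0 (l, k)\<bar>\<^sup>2 \<le> (B * level_scale l)\<^sup>2" using \<theta>\<^sub>0_le[OF assms] by (intro power_mono) auto
  ultimately have "(\<sigma> l)\<^sup>2 + (\<theta>\<^sub>0 (l, k))\<^sup>2 \<le> (1 + B\<^sup>2) * (level_scale l)\<^sup>2"
    by (simp add: power_mult_distrib algebra_simps)
  then have "2 * ((\<sigma> l)\<^sup>2 + (\<theta>\<^sub>0 (l, k))\<^sup>2) * exp_moment \<le> 2 * ((1 + B\<^sup>2) * (level_scale l)\<^sup>2) * exp_moment"
    using exp_moment_nonneg by (intro mult_right_mono mult_left_mono) auto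
  then have "ennreal (2 * ((\<sigma> l)\<^sup>2 + (\<theta>\<^sub>0 (l, k))\<^sup>2) * exp_moment) \<le> ennreal (2 * (1 + B\<^sup>2) * exp_moment * (level_scale l)\<^sup>2)"
    by (intro ennreal_leI) (simp only: mult_ac)
  then show ?thesis
    using scaled_second_moment[OF \<sigma>(1)[of l], of "\<theta>\<^sub>0 (l, k)"] unfolding coord_prior_def prod.case by (rule order_trans[rotated])
qed

text \<open>Level l has 2^l coefficients with second moments of order 2^(-l (1 + 2\<alpha>)), which
  leaves a geometric series. The bound is the hypothesis of
  \<open>marginal_absolutely_continuous\<close>.\<close>

lemma sum_second_moments_le:
  "\<exists>c. \<forall>J. finite J \<longrightarrow> J \<subseteq> wav_index \<longrightarrow>
    (\<Sum>j\<in>J. \<integral>\<^sup>+\<theta>. ennreal ((\<theta>\<^sub>0 j - \<theta>)\<^sup>2) \<partial>coord_prior j) \<le> ennreal c"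
proof -
  define m where "m = 2 * (1 + B\<^sup>2) * exp_moment"
  have m: "0 \<le> m" using exp_moment_nonneg by (simp add: m_def)
  define \<rho> where "\<rho> = 2 powr (- (2 * \<alpha>))"
  have \<rho>: "0 \<le> \<rho>" "\<rho> < 1" using \<alpha> powr_less_mono[of "- (2 * \<alpha>)" 0 2] by (auto simp: \<rho>_def)
  have "(\<Sum>j\<in>J. \<integral>\<^sup>+\<theta>. ennreal ((\<theta>\<^sub>0 j - \<theta>)\<^sup>2) \<partial>coord_prior j) \<le> ennreal (m * (1 / (1 - \<rho>)))"
    if J: "finite J" "J \<subseteq> wav_index" for J
  proof -
    obtain N where N: "J \<subseteq> Sigma {..<N} (\<lambda>l. {..<(2::nat) ^ l})"
      using finite_wav_index_subset[OF J] by blast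
    have "(\<Sum>j\<in>J. \<integral>\<^sup>+\<theta>. ennreal ((\<theta>\<^sub>0 j - \<theta>)\<^sup>2) \<partial>coord_prior j) \<le> (\<Sum>j\<in>J. ennreal (m * (level_scale (fst j))\<^sup>2))"
      using J second_moment_le by (intro sum_mono) (auto simp: wav_index_def m_def)
    also have "\<dots> \<le> (\<Sum>j\<in>Sigma {..<N} (\<lambda>l. {..<(2::nat) ^ l}). ennreal (m * (level_scale (fst j))\<^sup>2))"
      using N by (intro sum_mono2) auto
    also have "\<dots> = ennreal (\<Sum>j\<in>Sigma {..<N} (\<lambda>l. {..<(2::nat) ^ l}). m * (level_scale (fst j))\<^sup>2)"
      using m by (intro sum_ennreal) auto
    also have "(\<Sum>j\<in>Sigma {..<N} (\<lambda>l. {..<(2::nat) ^ l}). m * (level_scale (fst j))\<^sup>2)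
        = (\<Sum>l<N. \<Sum>k<(2::nat) ^ l. m * (level_scale l)\<^sup>2)"
      by (subst sum.Sigma) (auto simp: case_prod_beta)
    also have "\<dots> = m * (\<Sum>l<N. \<rho> ^ l)"
    proof -
      have level: "(\<Sum>k<(2::nat) ^ l. m * (level_scale l)\<^sup>2) = m * \<rho> ^ l" for l :: nat
        unfolding \<rho>_def two_power_level_scale_square[symmetric] by simp
      show ?thesis unfolding level sum_distrib_left ..
    qed
    also have "\<dots> \<le> m * (1 / (1 - \<rho>))"
      using m \<rho> by (intro mult_left_mono sum_geometric_le) auto
    finally show ?thesis by (simp add: ennreal_leI)
  qed
  then show ?thesis by blast
qed

lemma gaussian_sequence_obs_law:
  assumes n: "2 \<le> n"
  shows "gaussian_sequence coord_prior (1 / sqrt (real n))"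
    and "gaussian_sequence.obs wav_index (1 / sqrt (real n)) = obs_law n"
proof -
  show gs: "gaussian_sequence coord_prior (1 / sqrt (real n))"
  proof (rule gaussian_sequence.intro)
    show "prob_space (coord_prior i)" for i
      unfolding coord_prior_def by (cases i) (simp add: prob_space_scaled \<sigma>(1))
    show "sets (coord_prior i) = sets borel" for i
      unfolding coord_prior_def by (cases i) simp
    show "0 < 1 / sqrt (real n)" using n by simp
  qed
  show "gaussian_sequence.obs wav_index (1 / sqrt (real n)) = obs_law n"
    unfolding gaussian_sequence.obs_def[OF gs, abs_def] obs_law_def[abs_def] ..
qed

lemma gaussian_posteriorI:
  assumes n: "2 \<le> n" and post: "is_posterior (wav_prior \<phi> \<sigma>) (obs_law n) K"
  shows "gaussian_posterior wav_index coord_prior (1 / sqrt (real n)) K"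
proof -
  interpret gaussian_sequence wav_index coord_prior "1 / sqrt (real n)"
    by (rule gaussian_sequence_obs_law[OF n])
  have prior: "wav_prior \<phi> \<sigma> = PiM wav_index coord_prior"
    unfolding wav_prior_def coord_prior_def scaled_def ..
  show ?thesis
  proof (rule gaussian_posterior.intro[OF gaussian_sequence_obs_law(1)[OF n] gaussian_posterior_axioms.intro])
    note p = post[unfolded is_posterior_def prior coef_space_def gaussian_sequence_obs_law(2)[OF n, symmetric]]
    show "K \<in> PiM wav_index (\<lambda>_. borel) \<rightarrow>\<^sub>M prob_algebra (PiM wav_index coord_prior)"
      using p by blast
    show "(\<integral>\<^sup>+\<theta>. indicator A \<theta> * emeasure (obs \<theta>) B \<partial>PiM wav_index coord_prior) =
        (\<integral>\<^sup>+\<theta>. \<integral>\<^sup>+x. indicator B x * emeasure (K x) A \<partial>obs \<theta> \<partial>PiM wav_index coord_prior)"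
      if "A \<in> sets (PiM wav_index coord_prior)" "B \<in> sets (PiM wav_index (\<lambda>_. borel))" for A B
      using p that by blast
  qed
qed

text \<open>\<open>marginal_lower_bound\<close> is applied with half-width
  \<open>\<sigma> l * s\<close>. In units of \<open>\<sigma> l\<close> this window stays within (B +
  1) (l + 1)^(1/(1+\<delta>)) of 0, where \<open>density_lower_bound\<close> costs exp (-C (l + 1)).
  The 1 / \<open>\<sigma> l\<close> in the prior density cancels against the width, so that of the
  window only \<open>s\<close> survives.\<close>

lemma likelihood_bound:
  "\<exists>\<kappa>>0. \<exists>C>0. \<forall>s l k y. 0 < s \<longrightarrow> s \<le> 1 \<longrightarrow> k < 2 ^ l \<longrightarrow>
    ennreal (\<kappa> * exp (- C * real (l + 1)) * s * normal_density (\<theta>\<^sub>0 (l, k)) s y)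
      \<le> (\<integral>\<^sup>+\<theta>. ennreal (normal_density \<theta> s y) \<partial>coord_prior (l, k))"
proof -
  obtain \<kappa> C where \<kappa>: "\<kappa> > 0" and C: "C > 0" and low: "\<And>L u. 1 \<le> L \<Longrightarrow>
      \<bar>u\<bar> \<le> (B + 1) * L powr (1 / (1 + \<delta>)) \<Longrightarrow> \<kappa> * exp (- C * L) \<le> \<phi> u"
    using density_lower_bound[of "B + 1"] B by auto
  have "ennreal (\<kappa> / 2 * exp (- C * real (l + 1)) * s * normal_density (\<theta>\<^sub>0 (l, k)) s y)
      \<le> (\<integral>\<^sup>+\<theta>. ennreal (normal_density \<theta> s y) \<partial>coord_prior (l, k))"
    if s: "0 < s" "s \<le> 1" and k: "k < 2 ^ l" for s l k y
  proof -
    let ?L = "real (l + 1)"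
    let ?q = "\<kappa> * exp (- C * ?L) / \<sigma> l"
    note \<sigma>l = \<sigma>[of l] level_scale[of l]
    have q: "?q \<le> \<phi> (\<theta> / \<sigma> l) / \<sigma> l" if "\<bar>\<theta> - \<theta>\<^sub>0 (l, k)\<bar> \<le> \<sigma> l * s" for \<theta>
    proof (intro divide_right_mono low)
      have "\<bar>\<theta>\<bar> \<le> \<bar>\<theta> - \<theta>\<^sub>0 (l, k)\<bar> + \<bar>\<theta>\<^sub>0 (l, k)\<bar>" by linarith
      also have "\<dots> \<le> \<sigma> l * 1 + B * level_scale l"
        using that s \<sigma>l \<theta>\<^sub>0_le[OF k] by (intro add_mono order_trans[OF that] mult_left_mono) auto
      also have "\<dots> \<le> level_scale l + B * level_scale l" using \<sigma>l by simp
      also have "\<dots> = \<sigma> l * ((B + 1) * ?L powr (1 / (1 + \<delta>)))"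
        unfolding \<sigma>_mult[symmetric] by (simp add: algebra_simps)
      finally show "\<bar>\<theta> / \<sigma> l\<bar> \<le> (B + 1) * ?L powr (1 / (1 + \<delta>))"
        using \<sigma>l by (simp add: divide_le_eq mult.commute)
    qed (use \<sigma>l in auto)
    have "ennreal (?q * (\<sigma> l * s) / 2 * normal_density (\<theta>\<^sub>0 (l, k)) s y)
        \<le> (\<integral>\<^sup>+\<theta>. ennreal (\<phi> (\<theta> / \<sigma> l) / \<sigma> l) * ennreal (normal_density \<theta> s y) \<partial>lborel)"
      using s \<sigma>l \<kappa> by (intro marginal_lower_bound q) (auto simp: mult_le_cancel_right1)
    also have "\<dots> = (\<integral>\<^sup>+\<theta>. ennreal (normal_density \<theta> s y) \<partial>coord_prior (l, k))"
      unfolding coord_prior_def prod.case scaled_def by (subst nn_integral_density) auto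
    also have "?q * (\<sigma> l * s) / 2 = \<kappa> / 2 * exp (- C * ?L) * s" using \<sigma>l by simp
    finally show ?thesis .
  qed
  moreover have "\<kappa> / 2 > 0" using \<kappa> by simp
  ultimately show ?thesis using C by blast
qed

end

context besov_model
begin

definition level_rate :: "nat \<Rightarrow> nat \<Rightarrow> real" where
  "level_rate n l = (if 2 ^ l \<le> resolution \<alpha> n then sqrt (ln (real n) / real n) else level_scale l)"

lemma level_rate_nonneg: "2 \<le> n \<Longrightarrow> 0 \<le> level_rate n l"
  using ln_ge_half[of n] level_scale(1)[of l] by (simp add: level_rate_def)

text \<open>The factor \<open>exp (C (l + 1))\<close> lost in the likelihood bound is polynomial in \<open>n\<close> on the small
  levels, where a large constant in the threshold absorbs it, and on the large levels it is absorbed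
  by the tails of the prior.\<close>

lemma coordinate_excess:
  "\<exists>D>0. \<exists>a. \<forall>n\<ge>2. \<forall>l. 0 \<le> a n l \<and> a n l \<le> D * level_rate n l \<and>
    (\<forall>K k. is_posterior (wav_prior \<phi> \<sigma>) (obs_law n) K \<longrightarrow> k < 2 ^ l \<longrightarrow>
      (\<integral>\<^sup>+x. (\<integral>\<^sup>+\<theta>. ennreal (\<bar>\<theta> (l, k) - \<theta>\<^sub>0 (l, k)\<bar> - a n l) \<partial>K x) \<partial>obs_law n \<theta>\<^sub>0)
        \<le> ennreal (D * level_rate n l / 2 ^ l))"
proof -
  obtain \<kappa> C where \<kappa>: "\<kappa> > 0" and C: "C > 0" and lik: "\<And>s l k y. 0 < s \<Longrightarrow> s \<le> 1 \<Longrightarrow> k < 2 ^ l \<Longrightarrow>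
      ennreal (\<kappa> * exp (- C * real (l + 1)) * s * normal_density (\<theta>\<^sub>0 (l, k)) s y)
        \<le> (\<integral>\<^sup>+\<theta>. ennreal (normal_density \<theta> s y) \<partial>coord_prior (l, k))"
    using likelihood_bound by metis
  obtain c\<^sub>2 where c2: "\<And>J. finite J \<Longrightarrow> J \<subseteq> wav_index \<Longrightarrow>
      (\<Sum>j\<in>J. \<integral>\<^sup>+\<theta>. ennreal ((\<theta>\<^sub>0 j - \<theta>)\<^sup>2) \<partial>coord_prior j) \<le> ennreal c\<^sub>2"
    using sum_second_moments_le by blast
  \<comment> \<open>\<open>A\<close> gives the prior tail the rate C + 2 + 2\<alpha> per level: C
    pays for the likelihood bound, 1 + 2\<alpha> for sqrt n, and the remaining 1 for the factor
    2^(-l).\<close>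
  define A where "A = ((C + 2 + 2 * \<alpha>) * 2 / b2) powr (1 / (1 + \<delta>))"
  have A0: "0 \<le> A" by (simp add: A_def)
  have A: "b2 / 2 * A powr (1 + \<delta>) = C + 2 + 2 * \<alpha>"
  proof -
    have "A powr (1 + \<delta>) = (C + 2 + 2 * \<alpha>) * 2 / b2"
      unfolding A_def using C \<alpha> consts_pos by (simp add: powr_powr)
    then show ?thesis using consts_pos by simp
  qed
  \<comment> \<open>On small levels 1 / c is at most n^(6C+1) / \<kappa>, with 6C from l + 1 <= 6 ln
    n and 1 from sqrt n <= n. Thus n^(-P) leaves n^(-7): one factor 1 / n is at most sqrt (ln n /
    n), and n^(-6) is at most 2^(-l).\<close>
  define P where "P = 6 * C + 8"
  have P: "0 < P" using C by (simp add: P_def)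
  define m where "m = 2 * (1 + B\<^sup>2) * exp_moment"
  have m: "0 \<le> m" using exp_moment_nonneg by (simp add: m_def)
  define Q where "Q = (sqrt 2 * (1 + m) + m) / \<kappa> + sqrt 2"
  have Q: "0 \<le> Q" using m \<kappa> by (simp add: Q_def)
  define D where "D = (sqrt (32 * P) + Q) + ((A + B) + exp_moment / \<kappa>)"
  have em: "0 \<le> exp_moment / \<kappa>" using exp_moment_nonneg \<kappa> by simp
  have Dpos: "0 < D"
    using P Q A0 B em by (simp add: D_def add_pos_nonneg)
  have Dge: "sqrt (32 * P) \<le> D" "Q \<le> D" "A + B \<le> D" "exp_moment / \<kappa> \<le> D"
    using P Q A0 B em real_sqrt_ge_zero[of "32 * P"] by (auto simp: D_def)
  \<comment> \<open>With noise variance 1 / n, the 32 P makes the tail exponent in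
    \<open>posterior_excess_le_tails\<close> equal to 2 P ln n. On large levels \<open>A\<close> is
    the tail threshold, as \<open>\<sigma> l\<close> times (l + 1)^(1/(1+\<delta>)) equals
    \<open>level_scale l\<close>, and \<open>B\<close> covers the true coefficient.\<close>
  define a where "a n l = (if 2 ^ l \<le> resolution \<alpha> n then sqrt (32 * P) * sqrt (ln (real n) / real n)
      else (A + B) * level_scale l)" for n l
  have "0 \<le> a n l \<and> a n l \<le> D * level_rate n l \<and>
    (\<forall>K k. is_posterior (wav_prior \<phi> \<sigma>) (obs_law n) K \<longrightarrow> k < 2 ^ l \<longrightarrow>
      (\<integral>\<^sup>+x. (\<integral>\<^sup>+\<theta>. ennreal (\<bar>\<theta> (l, k) - \<theta>\<^sub>0 (l, k)\<bar> - a n l) \<partial>K x) \<partial>obs_law n \<theta>\<^sub>0)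
        \<le> ennreal (D * level_rate n l / 2 ^ l))" if n: "2 \<le> n" for n l
  proof (intro conjI allI impI)
    note ln_n = ln_ge_half[OF n]
    have eps0: "0 \<le> sqrt (ln (real n) / real n)" using ln_n by simp
    show a0: "0 \<le> a n l"
      unfolding a_def using P A0 B eps0 level_scale(1)[of l] by auto
    show "a n l \<le> D * level_rate n l"
      unfolding a_def level_rate_def using Dge eps0 level_scale(1)[of l] by (auto intro!: mult_right_mono)
    fix K and k :: nat assume post: "is_posterior (wav_prior \<phi> \<sigma>) (obs_law n) K" and k: "k < 2 ^ l"
    let ?s = "1 / sqrt (real n)"
    let ?L = "real (l + 1)"
    interpret gp: gaussian_posterior wav_index coord_prior ?s K
      by (rule gaussian_posteriorI[OF n post])
    have obs: "gp.obs = obs_law n" by (rule gaussian_sequence_obs_law(2)[OF n])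
    have ac: "absolutely_continuous gp.marginal (gp.obs \<theta>\<^sub>0)"
      by (rule gp.marginal_absolutely_continuous) (rule c2)
    have lk: "(l, k) \<in> wav_index" using k by (simp add: wav_index_def)
    have s: "0 < ?s" "?s \<le> 1" using n by auto
    define c where "c = \<kappa> * exp (- C * ?L) * ?s"
    have c: "0 < c" using \<kappa> s by (simp add: c_def)
    have c_le: "ennreal (c * normal_density (\<theta>\<^sub>0 (l, k)) ?s y) \<le> gp.marginal_density (l, k) y" for y
      unfolding c_def gp.marginal_density_def by (rule lik[OF s k])
    have inv_c: "1 / c = exp (C * ?L) * sqrt (real n) / \<kappa>"
      using n by (simp add: c_def exp_minus divide_simps)
    have exp_L: "2 ^ l \<le> exp ?L"
      by (rule order_trans[OF two_power_le_exp]) simp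
    have "gp.posterior_exp \<theta>\<^sub>0 (\<lambda>\<theta>. ennreal (\<bar>\<theta> (l, k) - \<theta>\<^sub>0 (l, k)\<bar> - a n l))
        \<le> ennreal (D * level_rate n l / 2 ^ l)"
    proof (cases "2 ^ l \<le> resolution \<alpha> n")
      case True
      \<comment> \<open>X = n^(-P) serves as \<open>\<eta>\<close>. The Gaussian tail is sqrt 2 X^2,
        so even after division by \<open>\<eta>\<close> every term keeps a factor X.\<close>
      define X where "X = exp (- P * ln (real n))"
      have X: "0 < X" "X \<le> 1" using P ln_n by (auto simp: X_def)
      have m2: "(\<integral>\<^sup>+\<theta>. ennreal ((\<theta>\<^sub>0 (l, k) - \<theta>)\<^sup>2) \<partial>coord_prior (l, k)) \<le> ennreal m"
      proof (rule order_trans[OF second_moment_le[OF k]])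
        have "m * (level_scale l)\<^sup>2 \<le> m * 1" using m level_scale[of l] by (intro mult_left_mono) (auto simp: power_le_one)
        then show "ennreal (2 * (1 + B\<^sup>2) * exp_moment * (level_scale l)\<^sup>2) \<le> ennreal m"
          by (intro ennreal_leI) (simp add: m_def)
      qed
      have T: "sqrt 2 * exp (- (a n l / 2)\<^sup>2 / (4 * ?s\<^sup>2)) = sqrt 2 * X\<^sup>2"
      proof -
        have "(a n l)\<^sup>2 = 32 * P * (ln (real n) / real n)"
          using True P ln_n by (simp add: a_def power_mult_distrib)
        moreover have "?s\<^sup>2 = 1 / real n" using n by (simp add: power_divide)
        ultimately have "- (a n l / 2)\<^sup>2 / (4 * ?s\<^sup>2) = - P * ln (real n) + - P * ln (real n)"
          using n by (simp add: power_divide)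
        then show ?thesis by (simp only: X_def power2_eq_square exp_add)
      qed
      have "gp.posterior_exp \<theta>\<^sub>0 (\<lambda>\<theta>. ennreal (\<bar>\<theta> (l, k) - \<theta>\<^sub>0 (l, k)\<bar> - a n l))
          \<le> ennreal ((sqrt 2 * X\<^sup>2 * (1 + m) + X * m) / c + sqrt 2 * X\<^sup>2 / X)"
        using gp.posterior_excess_le_tails[OF ac lk c c_le a0 X(1) m m2] unfolding T .
      also have "(sqrt 2 * X\<^sup>2 * (1 + m) + X * m) / c + sqrt 2 * X\<^sup>2 / X \<le> D * level_rate n l / 2 ^ l"
      proof -
        let ?E = "exp ((6 * C + 1) * ln (real n))"
        have L6: "?L \<le> 6 * ln (real n)" by (rule small_level_le[OF \<alpha> n True])
        have E1: "1 \<le> ?E" using C ln_n by simp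
        have "sqrt (real n) \<le> real n"
          using n real_sqrt_le_iff[of "real n" "(real n)\<^sup>2"] by (simp add: power2_eq_square)
        then have sq: "sqrt (real n) \<le> exp (ln (real n))" using n by simp
        have "exp (C * ?L) * sqrt (real n) \<le> exp (C * (6 * ln (real n))) * exp (ln (real n))"
          using C L6 sq by (intro mult_mono) auto
        also have "\<dots> = ?E" by (simp add: exp_add[symmetric] algebra_simps)
        finally have ic: "1 / c \<le> ?E / \<kappa>"
          unfolding inv_c using \<kappa> by (intro divide_right_mono) auto
        have "(sqrt 2 * X\<^sup>2 * (1 + m) + X * m) / c + sqrt 2 * X\<^sup>2 / X
            = X * ((sqrt 2 * (1 + m) * X + m) * (1 / c) + sqrt 2)"
          using X by (simp add: power2_eq_square field_simps)
        also have "\<dots> \<le> X * ((sqrt 2 * (1 + m) * 1 + m) * (?E / \<kappa>) + sqrt 2 * ?E)"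
          using X m c E1 ic by (intro mult_left_mono add_mono mult_mono) auto
        also have "\<dots> = (X * ?E) * Q" by (simp add: Q_def algebra_simps)
        \<comment> \<open>The exponents leave n^(-7), split into n^(-1) for the rate and n^(-6) for
          the factor 2^(-l).\<close>
        also have "X * ?E = exp (- ln (real n)) * exp (- (6 * ln (real n)))"
          unfolding X_def exp_add[symmetric] P_def by (simp add: algebra_simps)
        also have "\<dots> \<le> sqrt (ln (real n) / real n) * (1 / 2 ^ l)"
        proof (intro mult_mono)
          have "1 / real n \<le> 1/2" using n by simp
          then have "1 / real n \<le> ln (real n)" using ln_n by linarith
          then have "1 / real n * (1 / real n) \<le> ln (real n) * (1 / real n)" by (intro mult_right_mono) auto
          then have "(1 / real n)\<^sup>2 \<le> ln (real n) / real n" by (simp add: power2_eq_square)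
          then have "1 / real n \<le> sqrt (ln (real n) / real n)" by (rule real_le_rsqrt)
          then show "exp (- ln (real n)) \<le> sqrt (ln (real n) / real n)"
            using n by (simp add: exp_minus divide_inverse)
          have "2 ^ l \<le> exp (6 * ln (real n))" using exp_L L6 by (meson exp_le_cancel_iff order_trans)
          then show "exp (- (6 * ln (real n))) \<le> 1 / 2 ^ l"
            by (simp add: exp_minus divide_simps)
        qed (use eps0 in auto)
        finally have "(sqrt 2 * X\<^sup>2 * (1 + m) + X * m) / c + sqrt 2 * X\<^sup>2 / X
            \<le> sqrt (ln (real n) / real n) * (1 / 2 ^ l) * Q" using Q by (simp add: mult_right_mono)
        also have "\<dots> \<le> sqrt (ln (real n) / real n) * (1 / 2 ^ l) * D"
          using eps0 Dge by (intro mult_left_mono) auto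
        finally show ?thesis using True by (simp add: level_rate_def mult_ac)
      qed
      finally show ?thesis by (simp add: ennreal_leI)
    next
      case False
      have "gp.posterior_exp \<theta>\<^sub>0 (\<lambda>\<theta>. ennreal (\<bar>\<theta> (l, k) - \<theta>\<^sub>0 (l, k)\<bar> - a n l))
          \<le> ennreal (1/c) * (\<integral>\<^sup>+\<theta>. ennreal (\<bar>\<theta> - \<theta>\<^sub>0 (l, k)\<bar> - a n l) \<partial>coord_prior (l, k))"
        by (rule gp.posterior_excess_le_prior_excess[OF ac lk c c_le])
      also have "\<dots> \<le> ennreal (1/c) * ennreal (\<sigma> l * exp (- (b2 / 2 * A powr (1 + \<delta>)) * ?L) * exp_moment)"
      proof (rule mult_left_mono)
        have "A * \<sigma> l * ?L powr (1 / (1 + \<delta>)) + \<bar>\<theta>\<^sub>0 (l, k)\<bar> \<le> a n l"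
          using \<theta>\<^sub>0_le[OF k] False \<sigma>_mult[of l] by (simp add: a_def mult.assoc distrib_right)
        then show "(\<integral>\<^sup>+\<theta>. ennreal (\<bar>\<theta> - \<theta>\<^sub>0 (l, k)\<bar> - a n l) \<partial>coord_prior (l, k))
            \<le> ennreal (\<sigma> l * exp (- (b2 / 2 * A powr (1 + \<delta>)) * ?L) * exp_moment)"
          unfolding coord_prior_def prod.case using A0 \<sigma>(1) by (intro scaled_excess) auto
      qed simp
      also have "\<dots> = ennreal (1/c * (\<sigma> l * exp (- (C + 2 + 2 * \<alpha>) * ?L) * exp_moment))"
        using c \<sigma>(1)[of l] exp_moment_nonneg unfolding A by (subst ennreal_mult) auto
      also have "1/c * (\<sigma> l * exp (- (C + 2 + 2 * \<alpha>) * ?L) * exp_moment) \<le> D * level_rate n l / 2 ^ l"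
      proof -
        have "1/c \<le> exp (C * ?L) * exp ((1 + 2 * \<alpha>) * ?L) / \<kappa>"
          unfolding inv_c using \<kappa> large_level_sqrt_le[OF \<alpha> n False]
          by (intro divide_right_mono mult_left_mono) auto
        then have "1/c * (\<sigma> l * exp (- (C + 2 + 2 * \<alpha>) * ?L) * exp_moment)
            \<le> exp (C * ?L) * exp ((1 + 2 * \<alpha>) * ?L) / \<kappa> * (level_scale l * exp (- (C + 2 + 2 * \<alpha>) * ?L) * exp_moment)"
          using \<sigma>[of l] c \<kappa> exp_moment_nonneg by (intro mult_mono) auto
        also have "\<dots> = exp_moment / \<kappa> * level_scale l * (exp (C * ?L) * exp ((1 + 2 * \<alpha>) * ?L) * exp (- (C + 2 + 2 * \<alpha>) * ?L))"
          by (simp add: mult_ac)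
        also have "exp (C * ?L) * exp ((1 + 2 * \<alpha>) * ?L) * exp (- (C + 2 + 2 * \<alpha>) * ?L) = exp (- ?L)"
          unfolding exp_add[symmetric] by (simp add: algebra_simps)
        also have "exp_moment / \<kappa> * level_scale l * exp (- ?L) \<le> D * level_scale l * (1 / 2 ^ l)"
        proof (intro mult_mono)
          show "exp (- ?L) \<le> 1 / 2 ^ l"
            using le_imp_inverse_le[OF exp_L] by (simp only: exp_minus inverse_eq_divide) simp
        qed (use Dge em Dpos level_scale[of l] in auto)
        finally show ?thesis using False by (simp add: level_rate_def)
      qed
      finally show ?thesis by (simp add: ennreal_leI)
    qed
    then show "(\<integral>\<^sup>+x. (\<integral>\<^sup>+\<theta>. ennreal (\<bar>\<theta> (l, k) - \<theta>\<^sub>0 (l, k)\<bar> - a n l) \<partial>K x) \<partial>obs_law n \<theta>\<^sub>0)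
        \<le> ennreal (D * level_rate n l / 2 ^ l)"
      unfolding gp.posterior_exp_def obs .
  qed
  then show ?thesis using Dpos by blast
qed

end

section \<open>Summation over all levels and the resulting rate\<close>

theorem theorem1:
  fixes \<alpha> :: real and \<psi> :: "nat \<Rightarrow> nat \<Rightarrow> real \<Rightarrow> real"
    and f0 :: "real \<Rightarrow> real" and \<phi> :: "real \<Rightarrow> real"
    and b1 b2 c1 c2 \<delta> :: real
  assumes \<alpha>_pos: "\<alpha> > 0"
    and wav: "wavelet_basis \<psi> \<alpha>"
    and f0_meas: "f0 \<in> borel_measurable lborel"
    and f0_L2: "set_integrable lborel {0..1} (\<lambda>t. (f0 t)\<^sup>2)"
    and f0_besov: "\<exists>B. \<forall>l k. k < 2 ^ l \<longrightarrow>
                     2 powr (real l * (1 / 2 + \<alpha>)) * \<bar>ip01 f0 (\<psi> l k)\<bar> \<le> B"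
    and \<phi>_cont: "continuous_on UNIV \<phi>"
    and \<phi>_nonneg: "\<And>x. \<phi> x \<ge> 0"
    and \<phi>_int: "(\<integral>\<^sup>+ x. ennreal (\<phi> x) \<partial>lborel) = 1"
    and \<phi>_pos: "\<And>x. \<bar>x\<bar> \<le> 1 \<Longrightarrow> \<phi> x > 0"
    and consts_pos: "b1 > 0" "b2 > 0" "c1 > 0" "c2 > 0" "\<delta> > 0"
    and \<phi>_tails: "\<And>x. \<bar>x\<bar> \<ge> 1 \<Longrightarrow>
        c1 * exp (- b1 * \<bar>x\<bar> powr (1 + \<delta>)) \<le> \<phi> x \<and> \<phi> x \<le> c2 * exp (- b2 * \<bar>x\<bar> powr (1 + \<delta>))"
  shows "\<exists>M>0. \<forall>n::nat. n \<ge> 2 \<longrightarrow>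
     (\<forall>K. is_posterior
            (wav_prior \<phi> (\<lambda>l. 2 powr (- real l * (1 / 2 + \<alpha>)) / real (l + 1) powr (1 / (1 + \<delta>))))
            (obs_law n) K \<longrightarrow>
        (\<integral>\<^sup>+ x. (\<integral>\<^sup>+ \<theta>. sup_dist \<psi> f0 \<theta> \<partial>K x)
            \<partial>obs_law n (\<lambda>(l, k). ip01 f0 (\<psi> l k)))
        \<le> ennreal (M * (ln (real n) / real n) powr (\<alpha> / (2 * \<alpha> + 1))))"
proof -
  obtain B where B': "\<And>l k. k < 2 ^ l \<Longrightarrow> 2 powr (real l * (1 / 2 + \<alpha>)) * \<bar>ip01 f0 (\<psi> l k)\<bar> \<le> B"
    using f0_besov by blast
  have B_le: "\<bar>ip01 f0 (\<psi> l k)\<bar> \<le> B * 2 powr (- (real l * (1 / 2 + \<alpha>)))" if "k < 2 ^ l" for l k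
    using B'[OF that] by (simp add: powr_minus field_simps)
  have B0: "0 \<le> B" using order_trans[OF abs_ge_zero B_le[of 0 0]] by simp
  obtain C where C: "C > 0" "\<And>l t. t \<in> {0..1} \<Longrightarrow> (\<Sum>k<2 ^ l. \<bar>\<psi> l k t\<bar>) \<le> C * 2 powr (real l / 2)"
    using wav unfolding wavelet_basis_def by blast
  define \<theta>\<^sub>0 where "\<theta>\<^sub>0 = (\<lambda>(l, k). ip01 f0 (\<psi> l k))"
  interpret besov_model \<phi> b1 b2 c1 c2 \<delta> \<alpha> B \<theta>\<^sub>0
  proof (intro besov_model.intro exp_power_density.intro besov_model_axioms.intro)
    show "\<bar>\<theta>\<^sub>0 (l, k)\<bar> \<le> B * 2 powr (- (real l * (1 / 2 + \<alpha>)))" if "k < 2 ^ l" for l k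
      using B_le[OF that] by (simp add: \<theta>\<^sub>0_def)
  qed (fact assms B0)+
  obtain D a where D: "D > 0" and Da: "\<forall>n\<ge>2. \<forall>l. 0 \<le> a n l \<and> a n l \<le> D * level_rate n l \<and>
    (\<forall>K k. is_posterior (wav_prior \<phi> \<sigma>) (obs_law n) K \<longrightarrow> k < 2 ^ l \<longrightarrow>
      (\<integral>\<^sup>+x. (\<integral>\<^sup>+\<theta>. ennreal (\<bar>\<theta> (l, k) - \<theta>\<^sub>0 (l, k)\<bar> - a n l) \<partial>K x) \<partial>obs_law n \<theta>\<^sub>0)
        \<le> ennreal (D * level_rate n l / 2 ^ l))"
    using coordinate_excess by (elim exE conjE)
  have a: "0 \<le> a n l" "a n l \<le> D * level_rate n l" if "2 \<le> n" for n l
    using Da that by auto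
  have excess: "(\<integral>\<^sup>+x. (\<integral>\<^sup>+\<theta>. ennreal (\<bar>\<theta> (l, k) - \<theta>\<^sub>0 (l, k)\<bar> - a n l) \<partial>K x) \<partial>obs_law n \<theta>\<^sub>0)
        \<le> ennreal (D * level_rate n l / 2 ^ l)"
    if "2 \<le> n" "is_posterior (wav_prior \<phi> \<sigma>) (obs_law n) K" "k < 2 ^ l" for n l K k
    using Da that by blast
  obtain S where S: "S > 0" "\<And>y. 1 \<le> y \<Longrightarrow> (\<Sum>l. ennreal (2 powr (real l / 2) *
      (if 2 ^ l \<le> y then y powr (- (\<alpha> + 1/2)) else 2 powr (- (real l * (1/2 + \<alpha>)))))) \<le> ennreal (S * y powr (- \<alpha>))"
    using suminf_level_rates[OF \<alpha>_pos] by blast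
  \<comment> \<open>\<open>D\<close> occurs twice on each level: once for the threshold, and once
    for 2^l excesses of at most D 2^(-l) times the level rate each.\<close>
  define M where "M = C * (2 * D) * S"
  have "M > 0" using C D S by (simp add: M_def)
  moreover have "(\<integral>\<^sup>+ x. (\<integral>\<^sup>+ \<theta>. sup_dist \<psi> f0 \<theta> \<partial>K x) \<partial>obs_law n \<theta>\<^sub>0)
      \<le> ennreal (M * (ln (real n) / real n) powr (\<alpha> / (2 * \<alpha> + 1)))"
    if n: "2 \<le> n" and post: "is_posterior (wav_prior \<phi> \<sigma>) (obs_law n) K" for n K
  proof -
    interpret gp: gaussian_posterior wav_index coord_prior "1 / sqrt (real n)" K
      by (rule gaussian_posteriorI[OF n post])
    have obs: "gp.obs = obs_law n" by (rule gaussian_sequence_obs_law(2)[OF n])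
    let ?w = "\<lambda>l k \<theta>. ennreal (\<bar>\<theta> (l, k) - \<theta>\<^sub>0 (l, k)\<bar> - a n l)"
    have w: "?w l k \<in> borel_measurable (PiM wav_index coord_prior)" if "k < 2 ^ l" for l k
    proof -
      have [measurable]: "(\<lambda>\<theta>. \<theta> (l, k)) \<in> borel_measurable (PiM wav_index coord_prior)"
        using that by (intro gp.component_borel_measurable) (simp add: wav_index_def)
      show ?thesis by measurable
    qed
    have ws: "(\<lambda>\<theta>. \<Sum>k<2 ^ l. ?w l k \<theta>) \<in> borel_measurable (PiM wav_index coord_prior)" for l
      using w by (intro borel_measurable_sum) auto
    have level: "gp.posterior_exp \<theta>\<^sub>0 (\<lambda>\<theta>. ennreal (C * 2 powr (real l / 2)) * (ennreal (a n l) + (\<Sum>k<2 ^ l. ?w l k \<theta>)))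
        \<le> ennreal (C * (2 * D)) * ennreal (2 powr (real l / 2) * level_rate n l)" for l
    proof -
      have r: "0 \<le> D * level_rate n l" using D level_rate_nonneg[OF n] by simp
      have "gp.posterior_exp \<theta>\<^sub>0 (\<lambda>\<theta>. ennreal (C * 2 powr (real l / 2)) * (ennreal (a n l) + (\<Sum>k<2 ^ l. ?w l k \<theta>)))
          = ennreal (C * 2 powr (real l / 2)) * (ennreal (a n l) + (\<Sum>k<2 ^ l. gp.posterior_exp \<theta>\<^sub>0 (?w l k)))"
        using w ws by (subst gp.posterior_exp_cmult gp.posterior_exp_add_const gp.posterior_exp_sum; simp)+
      also have "\<dots> \<le> ennreal (C * 2 powr (real l / 2)) *
          (ennreal (D * level_rate n l) + (\<Sum>k<(2::nat) ^ l. ennreal (D * level_rate n l / 2 ^ l)))"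
        using a(2)[OF n] excess[OF n post]
        by (intro mult_left_mono add_mono sum_mono ennreal_leI) (auto simp: gp.posterior_exp_def obs)
      also have "(\<Sum>k<(2::nat) ^ l. ennreal (D * level_rate n l / 2 ^ l)) = ennreal (D * level_rate n l)"
        using r by (subst sum_ennreal) auto
      also have "ennreal (C * 2 powr (real l / 2)) * (ennreal (D * level_rate n l) + ennreal (D * level_rate n l))
          = ennreal (C * 2 powr (real l / 2) * (D * level_rate n l + D * level_rate n l))"
        using r C(1) by (subst ennreal_plus[symmetric]) (auto simp: ennreal_mult)
      also have "C * 2 powr (real l / 2) * (D * level_rate n l + D * level_rate n l)
          = C * (2 * D) * (2 powr (real l / 2) * level_rate n l)" by (simp add: algebra_simps)
      also have "ennreal \<dots> = ennreal (C * (2 * D)) * ennreal (2 powr (real l / 2) * level_rate n l)"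
        using C D level_rate_nonneg[OF n] by (intro ennreal_mult) auto
      finally show ?thesis .
    qed
    have "(\<integral>\<^sup>+ x. (\<integral>\<^sup>+ \<theta>. sup_dist \<psi> f0 \<theta> \<partial>K x) \<partial>obs_law n \<theta>\<^sub>0) = gp.posterior_exp \<theta>\<^sub>0 (sup_dist \<psi> f0)"
      by (simp add: gp.posterior_exp_def obs)
    \<comment> \<open>From here on the integrand is a series of measurable functions of single
      coefficients, so the expectation passes through both sums.\<close>
    also have "\<dots> \<le> gp.posterior_exp \<theta>\<^sub>0 (\<lambda>\<theta>. \<Sum>l. ennreal (C * 2 powr (real l / 2)) * (ennreal (a n l) + (\<Sum>k<2 ^ l. ?w l k \<theta>)))"
      unfolding \<theta>\<^sub>0_def prod.case
      by (intro gp.posterior_exp_mono, rule sup_dist_le[OF wav \<alpha>_pos f0_meas f0_L2 B_le C a(1)[OF n]])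
    also have "\<dots> = (\<Sum>l. gp.posterior_exp \<theta>\<^sub>0 (\<lambda>\<theta>. ennreal (C * 2 powr (real l / 2)) * (ennreal (a n l) + (\<Sum>k<2 ^ l. ?w l k \<theta>))))"
      using ws by (intro gp.posterior_exp_suminf) auto
    also have "\<dots> \<le> (\<Sum>l. ennreal (C * (2 * D)) * ennreal (2 powr (real l / 2) * level_rate n l))"
      by (intro suminf_le level summableI)
    also have "\<dots> = ennreal (C * (2 * D)) * (\<Sum>l. ennreal (2 powr (real l / 2) * level_rate n l))"
      by (rule ennreal_suminf_cmult)
    \<comment> \<open>At y = \<open>resolution \<alpha> n\<close> the summands of
      \<open>suminf_level_rates\<close> are the level rates and y^(-\<alpha>) is the claimed rate,
      both by \<open>resolution_powr\<close>.\<close>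
    also have "\<dots> \<le> ennreal (C * (2 * D)) * ennreal (S * (ln (real n) / real n) powr (\<alpha> / (2 * \<alpha> + 1)))"
      using S(2)[OF resolution_ge_1[OF \<alpha>_pos n]]
      unfolding level_rate_def level_scale_def resolution_powr[OF \<alpha>_pos n] by (rule mult_left_mono) simp
    also have "\<dots> = ennreal (M * (ln (real n) / real n) powr (\<alpha> / (2 * \<alpha> + 1)))"
      using C D S by (simp add: M_def ennreal_mult[symmetric] mult.assoc)
    finally show ?thesis .
  qed
  ultimately show ?thesis
    unfolding \<theta>\<^sub>0_def \<sigma>_def[abs_def] by blast
qed

end
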